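(* Let $k$ be an integer and $n$ a positive integer, and let $w_0\in B_n$ be given by $w_0(i)=-i$ for all $i$. Then for every $y\in B_n$, \[ \sum_{C\in\mathrm{Conj}(B_n):\,C^k=\{1\}}\psi^C(y)+\sum_{C\in\mathrm{Conj}(B_n):\,C^k=\{w_0\}}\psi^C(y)=\begin{cases}2\,\mathrm{roots}_k^{D_n}(y),& y\in D_n,\\ 0,&\text{otherwise},\end{cases} \] where $C^k=\{x^k:x\in C\}$.
   Context: $\mathrm{roots}_k^G(g)=|\{h\in G:h^k=g\}|$. $B_n$ is the group of bijections $w$ of $\{\pm1,\dots,\pm n\}$ with $w(-i)=-w(i)$; $D_n$ is the subgroup of $w\in B_n$ with an even number of $1\le i\le n$ such that $w(i)<0$. Cycles: if $c=(a_1,\dots,a_\ell)$ is a cycle of $w$ on $\{\pm1,\dots,\pm n\}$ so is $\bar c=(-a_1,\dots,-a_\ell)$; if $c\ne\bar c$, $c\bar c$ is a cycle of length $\ell$ and $\mathbb Z_2$-class $+1$; if $c=\bar c$, it is a cycle of length $\ell/2$ and class $-1$. Higher Lie characters $\psi^C$: for $x\in B_n$ with $a_{i,\varepsilon}$ cycles of length $i$ and class $\varepsilon$, $Z_{B_n}(x)\cong\prod_{i,\varepsilon}G_{i,\varepsilon}\wr S_{a_{i,\varepsilon}}$, where $G_{i,+}\cong\mathbb Z_2\times\mathbb Z_i$ is the centralizer in $B_i$ of one cycle of length $i$ and class $+1$ ($\mathbb Z_2$ generated by $[-1,\dots,-i]$, $\mathbb Z_i$ by the cycle) and $G_{i,-}\cong\mathbb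 Z_{2i}$ is generated by one cycle of length $i$ and class $-1$. $\omega_{i,+}$ is the linear character of $G_{i,+}\wr S_a$ equal on the base group to the product over factors of (trivial on $\mathbb Z_2$)$\times$(faithful linear character of $\mathbb Z_i$) and trivial on the complement $S_a$; $\omega_{i,-}$ is the product over base factors of a faithful linear character of $\mathbb Z_{2i}$, trivial on $S_a$. $\omega^x=\bigotimes\omega_{i,\varepsilon}$ and $\psi^C=\psi^x=\mathrm{Ind}_{Z_{B_n}(x)}^{B_n}\omega^x$ for $x\in C$. *)

theory Defs
  imports
    Complex_Main
    "HOL-Combinatorics.Orbits"
    "HOL-Algebra.Generated_Groups"
begin

section \<open>The groups $B_n$ and $D_n$\<close>

definition pm :: "nat \<Rightarrow> int set" where
  "pm n = {- int n..int n} - {0}"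

text \<open>As usual with \<open>permutes\<close>, a signed permutation is a function on all
  integers that is the identity outside \<open>pm n\<close>.\<close>

definition B_group :: "nat \<Rightarrow> (int \<Rightarrow> int) monoid" where
  "B_group n =
     \<lparr>carrier = {w. w permutes pm n \<and> (\<forall>i\<in>pm n. w (- i) = - w i)}, mult = (\<circ>), one = id\<rparr>"

definition D_group :: "nat \<Rightarrow> (int \<Rightarrow> int) monoid" where
  "D_group n = (B_group n)
     \<lparr>carrier := {w \<in> carrier (B_group n). even (card {i \<in> {1..int n}. w i < 0})}\<rparr>"

definition w0 :: "nat \<Rightarrow> int \<Rightarrow> int" where
  "w0 n = perm_restrict uminus (pm n)"

section \<open>Roots, conjugacy classes, centralizers, induced characters\<close>

definition roots :: "('a, 'b) monoid_scheme \<Rightarrow> int \<Rightarrow> 'a \<Rightarrow> nat" where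
  "roots G k g = card {h \<in> carrier G. h [^]\<^bsub>G\<^esub> k = g}"

definition conj_class :: "('a, 'b) monoid_scheme \<Rightarrow> 'a \<Rightarrow> 'a set" where
  "conj_class G x = (\<lambda>g. g \<otimes>\<^bsub>G\<^esub> x \<otimes>\<^bsub>G\<^esub> inv\<^bsub>G\<^esub> g) ` carrier G"

definition conj_classes :: "('a, 'b) monoid_scheme \<Rightarrow> 'a set set" where
  "conj_classes G = conj_class G ` carrier G"

definition class_power :: "('a, 'b) monoid_scheme \<Rightarrow> 'a set \<Rightarrow> int \<Rightarrow> 'a set" where
  "class_power G C k = (\<lambda>x. x [^]\<^bsub>G\<^esub> k) ` C"

definition centralizer :: "('a, 'b) monoid_scheme \<Rightarrow> 'a \<Rightarrow> 'a set" where
  "centralizer G x = {z \<in> carrier G. z \<otimes>\<^bsub>G\<^esub> x = x \<otimes>\<^bsub>G\<^esub> z}"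

definition linear_character_on :: "('a, 'b) monoid_scheme \<Rightarrow> 'a set \<Rightarrow> ('a \<Rightarrow> complex) \<Rightarrow> bool" where
  "linear_character_on G H \<omega> \<longleftrightarrow>
     (\<forall>h\<in>H. \<omega> h \<noteq> 0) \<and> (\<forall>h\<in>H. \<forall>h'\<in>H. \<omega> (h \<otimes>\<^bsub>G\<^esub> h') = \<omega> h * \<omega> h')"

text \<open>The character of \<open>G\<close> induced from a character \<open>\<chi>\<close> of a subgroup \<open>H\<close> of a finite group.\<close>

definition induced_character ::
  "('a, 'b) monoid_scheme \<Rightarrow> 'a set \<Rightarrow> ('a \<Rightarrow> complex) \<Rightarrow> 'a \<Rightarrow> complex" where
  "induced_character G H \<chi> y =
     (\<Sum>g | g \<in> carrier G \<and> inv\<^bsub>G\<^esub> g \<otimes>\<^bsub>G\<^esub> y \<otimes>\<^bsub>G\<^esub> g \<in> H. \<chi> (inv\<^bsub>G\<^esub> g \<otimes>\<^bsub>G\<^esub> y \<otimes>\<^bsub>G\<^esub> g))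
       / of_nat (card H)"

section \<open>Signed cycles\<close>

text \<open>
  The signed cycle of \<open>x\<close> through \<open>a\<close> is \<open>c\<close> if \<open>c = -c\<close> and \<open>c (-c)\<close> otherwise, where \<open>c\<close> is the
  ordinary cycle of \<open>x\<close> through \<open>a\<close>. Its support is the union of the orbits of \<open>a\<close> and \<open>- a\<close>; these
  coincide exactly if the class is \<open>-1\<close>.
\<close>

definition cyc_support :: "(int \<Rightarrow> int) \<Rightarrow> int \<Rightarrow> int set" where
  "cyc_support x a = orbit x a \<union> orbit x (- a)"

definition cyc_class :: "(int \<Rightarrow> int) \<Rightarrow> int \<Rightarrow> int" where
  "cyc_class x a = (if orbit x (- a) = orbit x a then - 1 else 1)"

definition signed_cycle :: "(int \<Rightarrow> int) \<Rightarrow> int \<Rightarrow> int \<Rightarrow> int" where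
  "signed_cycle x a = perm_restrict x (cyc_support x a)"

definition cyc_negation :: "(int \<Rightarrow> int) \<Rightarrow> int \<Rightarrow> int \<Rightarrow> int" where
  "cyc_negation x a = perm_restrict uminus (cyc_support x a)"

section \<open>Higher Lie characters\<close>

text \<open>
  Inside the centralizer of \<open>x\<close>, the base group of the product of wreath products $G_{i,\varepsilon} \wr S_{a_{i,\varepsilon}}$ is the
  direct product of one factor per signed cycle: \<open>\<langle>signed_cycle x a\<rangle>\<close>, cyclic of order
  \<open>2i\<close>, for a cycle of length \<open>i\<close> and class \<open>-1\<close>, and
  \<open>\<langle>cyc_negation x a\<rangle> \<times> \<langle>signed_cycle x a\<rangle>\<close>, of type $Z_2 \times Z_i$, for
  one of length \<open>i\<close> and class \<open>+1\<close>.

  The identification with wreath products is fixed by marking one point on each signed cycle: the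
  copies of $G_{i,\varepsilon}$ are then identified by the bijections that commute with \<open>x\<close> and negation and match
  the marked points, and the complement, the product of the symmetric groups $S_{a_{i,\varepsilon}}$, consists of the
  elements of the centralizer permuting the marked points.
\<close>

definition marking :: "nat \<Rightarrow> (int \<Rightarrow> int) \<Rightarrow> int set \<Rightarrow> bool" where
  "marking n x T \<longleftrightarrow> T \<subseteq> pm n \<and> (\<forall>a\<in>pm n. \<exists>!t. t \<in> T \<and> t \<in> cyc_support x a)"

definition complement :: "nat \<Rightarrow> (int \<Rightarrow> int) \<Rightarrow> int set \<Rightarrow> (int \<Rightarrow> int) set" where
  "complement n x T = {z \<in> centralizer (B_group n) x. z ` T = T}"

text \<open>
  The linear characters \<open>\<omega>\<close> that may serve as $\omega^x$, one for each choice of the faithful characters of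
  the cyclic groups. Multiplicativity makes \<open>\<omega>\<close> a product over the factors of the base group. It
  also forces the same character on all factors belonging to one pair $(i,\varepsilon)$: these are permuted
  transitively by the complement, and conjugation does not change a linear character.
\<close>

definition is_omega :: "nat \<Rightarrow> (int \<Rightarrow> int) \<Rightarrow> ((int \<Rightarrow> int) \<Rightarrow> complex) \<Rightarrow> bool" where
  "is_omega n x \<omega> \<longleftrightarrow>
     linear_character_on (B_group n) (centralizer (B_group n) x) \<omega> \<and>
     (\<forall>a\<in>pm n. inj_on \<omega> (generate (B_group n) {signed_cycle x a})) \<and>
     (\<forall>a\<in>pm n. cyc_class x a = 1 \<longrightarrow> \<omega> (cyc_negation x a) = 1) \<and>
     (\<exists>T. marking n x T \<and> (\<forall>z\<in>complement n x T. \<omega> z = 1))"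

text \<open>The higher Lie character $\psi^C$, as a function on \<open>B_group n\<close>, obtained from some representative
  \<open>x\<close> of \<open>C\<close> and some choice of $\omega^x$.\<close>

definition is_higher_Lie_character ::
  "nat \<Rightarrow> (int \<Rightarrow> int) set \<Rightarrow> ((int \<Rightarrow> int) \<Rightarrow> complex) \<Rightarrow> bool" where
  "is_higher_Lie_character n C \<psi> \<longleftrightarrow>
     (\<exists>x\<in>C. \<exists>\<omega>. is_omega n x \<omega> \<and>
       (\<forall>y\<in>carrier (B_group n).
          \<psi> y = induced_character (B_group n) (centralizer (B_group n) x) \<omega> y))"

end

(*
  Summing over a whole class turns psi^C(y) into a sum over the x in C commuting with y, so the left-hand
  side is a sum over the x commuting with y and satisfying x^k = 1 or x^k = w_0. The weight of x is a product
  over the orbits of <x, y, -1>: if y permutes cyclically the a signed x-cycles of an orbit, y^a acts on one of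
  them as an element of <x, -1>, whose value under omega is the local weight.
  On the other side 2 [h in D_n] = 1 + (-1)^neg(h), and the sums over the h with h^k = y of 1 and of (-1)^neg(h) are
  sums over the h commuting with y of products over the same kind of orbits; they match the two conditions x^k = 1
  and x^k = w_0.
  On one orbit x is determined by its first return x^d = (-1)^s y^r to a signed y-cycle, and multiplying x by
  elements of <y, -1> on a single signed y-cycle makes (s, r) run through all values. Both local sums are
  evaluated explicitly: the weight is a bijection from the residues r killed by k/d to the roots of unity of order
  gcd(k/d, N), so that its sum vanishes unless k/d is invertible modulo N, in which case there is exactly
  one solution of r k/d = 1.
*)

theory Submission
  imports Defs "HOL-Number_Theory.Cong" "HOL-Algebra.Multiplicative_Group"
begin

section \<open>Weights of residues\<close>

text \<open>The two sides do not match element by element: even the two local factors at an orbit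
  agree only after averaging over \<open>(s, r)\<close>. This averaging is compatible with products
  because the modified \<open>x\<close> has the same orbits, so that factors can be altered one at a
  time. A second obstacle is that \<open>\<omega>\<close> is not unique, since each class may come
  with its own faithful characters and its own marking. Changing \<open>x\<close> inside its class
  turns every choice into the standard roots of unity; the weight then depends on \<open>x\<close>
  and \<open>y\<close> alone, and sums over different classes can be merged. The recurring
  multiplier 2 has one source. The class of a signed \<open>x\<close>-cycle in an orbit need not be
  that of the signed \<open>y\<close>-cycles there. Exactly when they differ, the period of
  \<open>x\<close> doubles or the first return of \<open>y\<close> comes at half the expected step,
  and the exponent of the weight acquires an inverse of 2 modulo an odd number.\<close>

definition zeta :: "nat \<Rightarrow> nat \<Rightarrow> complex" where
  "zeta L u = cis (2 * pi * real u / real L)"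

lemma zeta_0 [simp]: "zeta L 0 = 1"
  by (simp add: zeta_def)

lemma zeta_add: "zeta L (u + v) = zeta L u * zeta L v"
  by (simp add: zeta_def cis_mult add_divide_distrib distrib_left)

lemma zeta_power: "zeta L u ^ v = zeta L (u * v)"
  by (simp add: zeta_def Complex.DeMoivre mult_ac)

lemma zeta_scale: "c > 0 \<Longrightarrow> zeta (L * c) (u * c) = zeta L u"
  by (simp add: zeta_def mult.assoc[symmetric])

lemma zeta_self: "L > 0 \<Longrightarrow> zeta L (L * u) = 1"
  using cis_multiple_2pi[of "real u"] by (simp add: zeta_def mult.assoc)

lemma zeta_mod: "L > 0 \<Longrightarrow> zeta L (u mod L) = zeta L u"
  by (metis div_mult_mod_eq mult.commute mult_1 zeta_add zeta_self)

lemma zeta_eq_iff: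
  assumes "L > 0"
  shows "zeta L u = zeta L v \<longleftrightarrow> [u = v] (mod L)"
proof -
  have inj: "inj_on (\<lambda>k. zeta L k) {..<L}"
    using bij_betw_roots_unity[OF assms] by (simp add: bij_betw_def zeta_def)
  have "zeta L u = zeta L v \<longleftrightarrow> zeta L (u mod L) = zeta L (v mod L)"
    using assms by (simp add: zeta_mod)
  also have "\<dots> \<longleftrightarrow> u mod L = v mod L"
    using inj_on_eq_iff[OF inj, of "u mod L" "v mod L"] assms by simp
  finally show ?thesis by (simp add: cong_def)
qed

lemma zeta_eq_1_iff: "L > 0 \<Longrightarrow> zeta L u = 1 \<longleftrightarrow> L dvd u"
  using zeta_eq_iff[of L u 0] by (simp add: cong_0_iff)

lemma root_of_unity_is_zeta:
  assumes "L > 0" "z ^ L = 1"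
  obtains u where "z = zeta L u"
proof -
  have "z \<in> (\<lambda>k. cis (2 * pi * real k / real L)) ` {..<L}"
    using bij_betw_roots_unity[OF assms(1)] assms(2) by (auto simp: bij_betw_def)
  then show ?thesis using that by (auto simp: zeta_def)
qed

section \<open>Reduced fractions and sums of roots of unity over residues\<close>

lemma cong_mult_1_imp_coprime:
  fixes a b n :: nat
  assumes "[a * b = 1] (mod n)"
  shows "coprime a n" "coprime b n"
  using assms by (auto simp: coprime_iff_invertible_nat mult.commute)

text \<open>Both values are reduced fractions of a full turn, so each denominator is the order of
  the root of unity. Over the common denominator \<open>E * E'\<close> the numerators are congruent,
  and cancelling the units \<open>v\<close> and \<open>v'\<close> makes each denominator divide the
  other.\<close>

lemma zeta_eq_coprime_denominators:
  assumes "E > 0" "E' > 0" "coprime v E" "coprime v' E'" "zeta E v = zeta E' v'"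
  shows "E = E'"
proof -
  have "zeta (E * E') (v * E') = zeta E v" "zeta (E' * E) (v' * E) = zeta E' v'"
    using assms zeta_scale by auto
  then have c: "[v * E' = v' * E] (mod (E * E'))"
    using assms by (simp add: mult.commute zeta_eq_iff[symmetric])
  have "[v * E' = v' * E] (mod E)"
    using c by (rule cong_dvd_modulus_nat) simp
  then have "[v * E' = 0] (mod E)"
    by (metis cong_0_iff cong_trans dvd_triv_right)
  then have 1: "E dvd E'"
    using assms by (simp add: cong_0_iff coprime_commute coprime_dvd_mult_right_iff)
  have "[v * E' = v' * E] (mod E')"
    using c by (rule cong_dvd_modulus_nat) simp
  then have "[v' * E = 0] (mod E')"
    by (metis cong_0_iff cong_sym cong_trans dvd_triv_right)
  then have 2: "E' dvd E"
    using assms by (simp add: cong_0_iff coprime_commute coprime_dvd_mult_right_iff)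
  show ?thesis using 1 2 by (rule dvd_antisym)
qed

text \<open>With \<open>g = gcd K N\<close> and \<open>M = N div g\<close>, the quotient of
  \<open>K\<close> by \<open>g\<close> is a unit modulo \<open>M\<close>, so the residues killed by
  \<open>K\<close> are the \<open>g\<close> multiples of \<open>M\<close> below
  \<open>N\<close>.\<close>

lemma card_annihilated_residues:
  fixes N K :: nat
  assumes "N > 0"
  shows "card {r. r < N \<and> N dvd r * K} = gcd K N"
proof -
  define g where "g = gcd K N"
  define M where "M = N div g"
  have g: "g > 0" "N = M * g" "M > 0"
    using assms unfolding g_def M_def by (auto intro: Nat.gr0I simp: dvd_div_eq_0_iff)
  obtain K' where K': "K = K' * g" "coprime K' M"
    using assms unfolding g_def M_def
    by (metis div_gcd_coprime dvd_div_mult_self gcd_dvd1 gcd_eq_0_iff less_numeral_extra(3))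
  have "{r. r < N \<and> N dvd r * K} = (\<lambda>i. i * M) ` {..<g}"
  proof (intro equalityI subsetI)
    fix r assume r: "r \<in> {r. r < N \<and> N dvd r * K}"
    then have "M * g dvd r * K' * g" using g K' by (simp add: mult.assoc)
    then have "M dvd r * K'" using g by simp
    then have "M dvd r" using K' by (simp add: coprime_commute coprime_dvd_mult_left_iff)
    then obtain i where "r = i * M" by (metis dvdE mult.commute)
    then show "r \<in> (\<lambda>i. i * M) ` {..<g}" using r g by (auto simp: mult.commute)
  next
    fix r assume "r \<in> (\<lambda>i. i * M) ` {..<g}"
    then show "r \<in> {r. r < N \<and> N dvd r * K}" using g K' by auto
  qed
  also have "card \<dots> = g"
    using g by (subst card_image) (auto simp: inj_on_def)
  finally show ?thesis by (simp add: g_def)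
qed

text \<open>
  The weight of \<open>r\<close> is the primitive root of unity whose order \<open>E\<close> is the additive order of \<open>r\<close> modulo
  \<open>N\<close> and whose exponent is, up to a unit depending on \<open>E\<close> only, the inverse of \<open>r / gcd(r, N)\<close>.
  So \<open>\<xi>\<close> is a bijection from the residues killed by \<open>K\<close> to all roots of unity of order \<open>gcd(K, N)\<close>.
\<close>

lemma cyclic_weight_sum:
  fixes N K :: nat and \<xi> :: "nat \<Rightarrow> complex" and \<kappa> :: "nat \<Rightarrow> nat"
  assumes N: "N > 0"
    and \<xi>: "\<And>r. r < N \<Longrightarrow> \<exists>v. \<xi> r = zeta (N div gcd r N) v \<and>
              [v * \<kappa> (N div gcd r N) * (r div gcd r N) = 1] (mod (N div gcd r N))"
  shows "(\<Sum>r | r < N \<and> N dvd r * K. \<xi> r) = (if coprime K N then 1 else 0)"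
proof -
  define g where "g = gcd K N"
  have g: "g > 0" "g dvd N" using N by (auto simp: g_def)
  define U where "U = {r. r < N \<and> N dvd r * K}"
  define E where "E r = N div gcd r N" for r
  define R where "R r = r div gcd r N" for r
  have decomp: "N = E r * gcd r N" "r = R r * gcd r N" "gcd r N > 0" "E r > 0" for r
    using N by (auto intro: Nat.gr0I simp: E_def R_def dvd_div_eq_0_iff)
  obtain V where V: "\<xi> r = zeta (E r) (V r)" "[V r * \<kappa> (E r) * R r = 1] (mod (E r))" if "r < N" for r
    using \<xi> unfolding E_def R_def by metis
  have cop: "coprime (V r) (E r)" "coprime (R r) (E r)" if "r < N" for r
    using cong_mult_1_imp_coprime[OF V(2)[OF that]] by (simp_all add: coprime_mult_left_iff)
  have inj: "inj_on \<xi> U"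
  proof (rule inj_onI)
    fix r r' assume r: "r \<in> U" "r' \<in> U" and eq: "\<xi> r = \<xi> r'"
    then have rN: "r < N" "r' < N" by (auto simp: U_def)
    \<comment> \<open>The order of the common value is \<open>E\<close>, so \<open>gcd r N\<close>
      and the multiplier \<open>\<kappa>\<close> are the same for both residues; this is why
      \<open>\<kappa>\<close> is allowed to depend on \<open>E\<close> only.\<close>
    have E: "E r = E r'"
      by (rule zeta_eq_coprime_denominators[of _ _ "V r" "V r'"]) (use eq V rN cop decomp in auto)
    have gc: "gcd r N = gcd r' N"
      using decomp(1,4)[of r] decomp(1)[of r'] E by (metis mult_cancel1 less_numeral_extra(3))
    have VV: "[V r = V r'] (mod (E r))"
      using eq V rN E decomp(4)[of r] by (simp add: zeta_eq_iff)
    \<comment> \<open>\<open>V * \<kappa>\<close> inverts \<open>R\<close> modulo \<open>E\<close>.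
      One product, evaluated in two ways, shows that equal inverses come from equal
      \<open>R\<close>.\<close>
    have "[R r * (V r' * \<kappa> (E r) * R r') = R r * 1] (mod (E r))"
      using V(2)[OF rN(2)] E by (intro cong_mult) (auto)
    moreover have "[R r * (V r' * \<kappa> (E r) * R r') = R r * (V r * \<kappa> (E r) * R r')] (mod (E r))"
      using VV by (intro cong_mult) (auto simp: cong_sym)
    moreover have "[(V r * \<kappa> (E r) * R r) * R r' = 1 * R r'] (mod (E r))"
      using V(2)[OF rN(1)] by (intro cong_mult) auto
    ultimately have RR: "[R r = R r'] (mod (E r))"
      by (simp add: mult_ac) (metis cong_sym cong_trans)
    have "R r < E r" "R r' < E r"
      using rN decomp[of r] decomp[of r'] E gc by (metis mult_less_cancel2)+
    then have "R r = R r'" using RR by (simp add: cong_less_modulus_unique_nat)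
    then show "r = r'" using decomp(2) gc by metis
  qed
  have "\<xi> ` U \<subseteq> {z. z ^ g = 1}"
  proof
    fix z assume "z \<in> \<xi> ` U"
    then obtain r where r: "r < N" "N dvd r * K" "z = \<xi> r" by (auto simp: U_def)
    have "E r * gcd r N dvd (R r * K) * gcd r N"
      using r(2) decomp[of r] by (metis mult.assoc mult.commute)
    then have "E r dvd R r * K" using decomp(3)[of r] N by simp
    then have "E r dvd K" using cop[OF r(1)] by (simp add: coprime_commute coprime_dvd_mult_right_iff)
    moreover have "E r dvd N" using decomp(1) by (metis dvd_triv_left)
    ultimately have "E r dvd g" by (simp add: g_def)
    then show "z \<in> {z. z ^ g = 1}"
      using r V[OF r(1)] decomp(4)[of r] by (simp add: zeta_power zeta_eq_1_iff)
  qed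
  moreover have "card (\<xi> ` U) = card {z::complex. z ^ g = 1}"
    using inj card_annihilated_residues[OF N, of K] card_roots_unity_eq[OF g(1)]
    by (simp add: card_image U_def g_def)
  ultimately have "\<xi> ` U = {z. z ^ g = 1}"
    using g by (intro card_subset_eq finite_roots_unity) auto
  then have "(\<Sum>r\<in>U. \<xi> r) = \<Sum>{z. z ^ g = 1}"
    using sum.reindex[OF inj, of id] by simp
  also have "\<dots> = (if coprime K N then 1 else 0)"
  proof (cases "g = 1")
    case True
    then show ?thesis by (simp add: g_def coprime_iff_gcd_eq_1)
  next
    case False
    then have "g > 1" using g by simp
    then show ?thesis using sum_roots_unity[of g] by (simp add: g_def coprime_iff_gcd_eq_1)
  qed
  finally show ?thesis by (simp add: U_def)
qed

lemma sum_inverse_residue: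
  fixes N K :: nat and c :: complex
  assumes "N > 0"
  shows "(\<Sum>r | r < N \<and> [r * K = 1] (mod N). c) = (if coprime K N then c else 0)"
proof (cases "coprime K N")
  case True
  then obtain r0 where r0: "[r0 * K = 1] (mod N)"
    by (metis coprime_iff_invertible_nat mult.commute One_nat_def)
  have "{r. r < N \<and> [r * K = 1] (mod N)} = {r0 mod N}"
  proof (intro equalityI subsetI)
    fix r assume r: "r \<in> {r. r < N \<and> [r * K = 1] (mod N)}"
    then have "[r * K = r0 * K] (mod N)" using r0 by (auto intro: cong_trans cong_sym)
    then have "[r = r0] (mod N)" using True by (simp add: cong_mult_rcancel_nat coprime_commute)
    then show "r \<in> {r0 mod N}" using r by (simp add: cong_def)
  next
    fix r assume "r \<in> {r0 mod N}"
    then show "r \<in> {r. r < N \<and> [r * K = 1] (mod N)}"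
      using r0 assms by (simp add: cong_def mod_mult_left_eq)
  qed
  then show ?thesis using True by simp
next
  case False
  then have "{r. r < N \<and> [r * K = 1] (mod N)} = {}"
    using cong_mult_1_imp_coprime(2) by blast
  then show ?thesis using False by simp
qed

text \<open>Division with remainder: by \<open>shift\<close>, moving by a member of \<open>Q\<close>
  does not affect membership, so only remainders modulo \<open>d\<close> matter. Periods, first
  returns and returns up to sign are all instances.\<close>

lemma least_positive_dvd:
  fixes Q :: "nat \<Rightarrow> bool"
  assumes "Q d" "d > 0" "\<And>i. 0 < i \<Longrightarrow> i < d \<Longrightarrow> \<not> Q i"
    and shift: "\<And>i j. Q i \<Longrightarrow> Q (i + j) \<longleftrightarrow> Q j"
  shows "Q i \<longleftrightarrow> d dvd i"
proof -
  have Q0: "Q 0" using shift[OF assms(1), of 0] assms(1) by simp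
  have mult: "Q (d * j)" for j
    by (induction j) (use Q0 shift assms(1) in auto)
  have "Q i \<longleftrightarrow> Q (i mod d)"
    using shift[OF mult, of "i div d" "i mod d"] by simp
  also have "\<dots> \<longleftrightarrow> i mod d = 0"
    using assms(2,3) Q0 by (metis mod_less_divisor neq0_conv)
  finally show ?thesis by (simp add: dvd_eq_mod_eq_0)
qed

section \<open>Signed permutations and local weights\<close>

lemma B_simps [simp]:
  "mult (B_group n) = (\<circ>)" "one (B_group n) = id"
  by (simp_all add: B_group_def)

lemma finite_pm [simp]: "finite (pm n)"
  by (simp add: pm_def)

lemma minus_mem_pm [simp]: "- v \<in> pm n \<longleftrightarrow> v \<in> pm n"
  by (auto simp: pm_def)

lemma B_carrier_iff:
  "w \<in> carrier (B_group n) \<longleftrightarrow> w permutes pm n \<and> (\<forall>i. w (- i) = - w i)"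
proof -
  have "w (- i) = - w i" if "w permutes pm n" "\<forall>i\<in>pm n. w (- i) = - w i" for i
    using that by (cases "i \<in> pm n") (auto simp: permutes_def)
  then show ?thesis by (auto simp: B_group_def)
qed

lemma B_neg: "w \<in> carrier (B_group n) \<Longrightarrow> w (- i) = - w i"
  by (simp add: B_carrier_iff)

lemma B_sign: "w \<in> carrier (B_group n) \<Longrightarrow> e \<in> {1, - 1} \<Longrightarrow> w (e * i) = e * w i"
  by (auto simp: B_neg)

lemma B_bij: "w \<in> carrier (B_group n) \<Longrightarrow> bij w"
  by (auto simp: B_carrier_iff permutes_bij)

lemma B_mem_pm: "w \<in> carrier (B_group n) \<Longrightarrow> w v \<in> pm n \<longleftrightarrow> v \<in> pm n"
  by (auto simp: B_carrier_iff permutes_in_image)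

lemma B_fixes: "w \<in> carrier (B_group n) \<Longrightarrow> v \<notin> pm n \<Longrightarrow> w v = v"
  by (auto simp: B_carrier_iff permutes_def)

lemma B_permutation: "w \<in> carrier (B_group n) \<Longrightarrow> permutation w"
  by (auto simp: B_carrier_iff permutation_permutes intro: exI[of _ "pm n"])

lemma B_comp: "v \<in> carrier (B_group n) \<Longrightarrow> w \<in> carrier (B_group n) \<Longrightarrow> v \<circ> w \<in> carrier (B_group n)"
  by (auto simp: B_carrier_iff permutes_compose)

lemma B_inv_mem: "w \<in> carrier (B_group n) \<Longrightarrow> Hilbert_Choice.inv w \<in> carrier (B_group n)"
  by (auto simp: B_carrier_iff permutes_inv) (metis minus_minus permutes_inv_eq)

lemma B_group: "group (B_group n)"
proof (rule groupI)
  fix x assume "x \<in> carrier (B_group n)"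
  then show "\<exists>y\<in>carrier (B_group n). y \<otimes>\<^bsub>B_group n\<^esub> x = \<one>\<^bsub>B_group n\<^esub>"
    using B_inv_mem B_bij by (auto intro!: bexI[of _ "Hilbert_Choice.inv x"] simp: bij_is_inj)
qed (auto simp: B_comp comp_assoc, auto simp: B_carrier_iff permutes_id)

lemma B_id [simp]: "id \<in> carrier (B_group n)"
  by (simp add: B_carrier_iff permutes_id)

lemma B_inv: "w \<in> carrier (B_group n) \<Longrightarrow> inv\<^bsub>B_group n\<^esub> w = Hilbert_Choice.inv w"
  by (rule group.inv_equality[OF B_group]) (auto simp: B_inv_mem bij_is_inj B_bij)

lemma finite_B: "finite (carrier (B_group n))"
  by (rule finite_subset[of _ "{w. w permutes pm n}"]) (auto simp: B_carrier_iff finite_permutations)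

lemma B_pow: "x [^]\<^bsub>B_group n\<^esub> (i::nat) = x ^^ i"
  by (induction i) (auto simp: nat_pow_def funpow_swap1)

lemma B_funpow: "x \<in> carrier (B_group n) \<Longrightarrow> x ^^ i \<in> carrier (B_group n)"
  by (induction i) (auto simp: B_comp id_def[symmetric])

text \<open>The group order serves as a common exponent: the inverse of \<open>x ^^ i\<close>
  becomes the power with exponent \<open>i * (expo n - 1)\<close>, so orbit arguments need only
  \<open>funpow\<close>.\<close>

definition expo :: "nat \<Rightarrow> nat" where
  "expo n = card (carrier (B_group n))"

lemma expo_pos: "expo n > 0"
  unfolding expo_def using finite_B B_id by (metis card_gt_0_iff empty_iff)

lemma funpow_expo: "x \<in> carrier (B_group n) \<Longrightarrow> x ^^ (expo n) = id"
  using group.pow_order_eq_1[OF B_group, of x n] by (simp add: B_pow order_def expo_def)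

lemma funpow_expo_mult: "x \<in> carrier (B_group n) \<Longrightarrow> x ^^ (i * expo n) = id"
  using funpow_expo[of x n] by (metis funpow_mult id_funpow mult.commute)

lemma funpow_inverse:
  assumes "x \<in> carrier (B_group n)"
  shows "(x ^^ (i * (expo n - 1))) ((x ^^ i) v) = v"
proof -
  have "i * (expo n - 1) + i = i * expo n"
    using expo_pos[of n] by (cases "expo n") auto
  then show ?thesis using funpow_expo_mult[OF assms, of i] by (metis comp_apply funpow_add id_apply)
qed

section \<open>Signed cycles as equivalence classes\<close>

lemma mem_orbit_iff: "x \<in> carrier (B_group n) \<Longrightarrow> q \<in> orbit x p \<longleftrightarrow> (\<exists>i. q = (x ^^ i) p)"
  by (auto simp: orbit_altdef_permutation B_permutation)

lemma mem_cyc_support_iff: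
  assumes "x \<in> carrier (B_group n)"
  shows "q \<in> cyc_support x p \<longleftrightarrow> (\<exists>e\<in>{1,-1}. \<exists>i. q = e * (x ^^ i) p)"
  using assms by (auto simp: cyc_support_def mem_orbit_iff B_neg[OF B_funpow])

lemma mem_cyc_supportE:
  assumes "x \<in> carrier (B_group n)" "q \<in> cyc_support x p"
  obtains e i where "e \<in> {1,-1}" "q = e * (x ^^ i) p"
  using assms(2) unfolding mem_cyc_support_iff[OF assms(1)] by (elim bexE exE) (rule that)

lemma cyc_support_refl: "x \<in> carrier (B_group n) \<Longrightarrow> p \<in> cyc_support x p"
  by (auto simp: mem_cyc_support_iff intro: exI[of _ 0])

lemma cyc_supportI:
  "x \<in> carrier (B_group n) \<Longrightarrow> e \<in> {1,-1} \<Longrightarrow> e * (x ^^ i) p \<in> cyc_support x p"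
  by (auto simp: mem_cyc_support_iff)

lemma cyc_support_trans:
  assumes x: "x \<in> carrier (B_group n)" and "q \<in> cyc_support x p" "r \<in> cyc_support x q"
  shows "r \<in> cyc_support x p"
proof -
  obtain e i e' j where *: "e \<in> {1,-1}" "q = e * (x ^^ i) p" "e' \<in> {1,-1}" "r = e' * (x ^^ j) q"
    using mem_cyc_supportE[OF x assms(2)] mem_cyc_supportE[OF x assms(3)] by metis
  then have "r = (e' * e) * (x ^^ (j + i)) p"
    by (simp only: B_sign[OF B_funpow[OF x]] funpow_add comp_apply mult.assoc)
  then show ?thesis using * unfolding mem_cyc_support_iff[OF x] by (intro bexI[of _ "e' * e"]) auto
qed

lemma cyc_support_sym:
  assumes x: "x \<in> carrier (B_group n)" and "q \<in> cyc_support x p"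
  shows "p \<in> cyc_support x q"
proof -
  obtain e i where *: "e \<in> {1,-1}" "q = e * (x ^^ i) p"
    by (rule mem_cyc_supportE[OF assms])
  then have "p = e * (x ^^ (i * (expo n - 1))) q"
    by (simp only: B_sign[OF B_funpow[OF x]] funpow_inverse[OF x]) auto
  then show ?thesis using * unfolding mem_cyc_support_iff[OF x] by auto
qed

lemma cyc_support_eq:
  assumes "x \<in> carrier (B_group n)" "q \<in> cyc_support x p"
  shows "cyc_support x q = cyc_support x p"
  using assms by (meson cyc_support_sym cyc_support_trans subsetI subset_antisym)

lemma cyc_support_step: "x \<in> carrier (B_group n) \<Longrightarrow> x p \<in> cyc_support x p"
  using cyc_supportI[of x n 1 1 p] by simp

lemma cyc_support_minus: "x \<in> carrier (B_group n) \<Longrightarrow> - p \<in> cyc_support x p"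
  using cyc_supportI[of x n "-1" 0 p] by simp

lemma cyc_support_subset_pm: "x \<in> carrier (B_group n) \<Longrightarrow> p \<in> pm n \<Longrightarrow> cyc_support x p \<subseteq> pm n"
  by (auto simp: mem_cyc_support_iff B_mem_pm[OF B_funpow])

lemma cyc_support_invariant:
  assumes "x \<in> carrier (B_group n)"
  shows "x v \<in> cyc_support x p \<longleftrightarrow> v \<in> cyc_support x p"
    and "- v \<in> cyc_support x p \<longleftrightarrow> v \<in> cyc_support x p"
  using assms cyc_support_step cyc_support_minus cyc_support_trans cyc_support_sym by meson+

lemma funpow_commute:
  assumes "x \<circ> y = y \<circ> x"
  shows "(x ^^ i) ((y ^^ j) v) = (y ^^ j) ((x ^^ i) v)"
proof -
  have *: "(y ^^ j) (x w) = x ((y ^^ j) w)" for w j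
    by (induction j) (use assms in \<open>auto simp: fun_eq_iff\<close>)
  show ?thesis by (induction i) (use * in auto)
qed

text \<open>A power of \<open>y\<close> commutes with \<open>x\<close> and with negation and
  therefore permutes the signed cycles of \<open>x\<close>. The converse is the same argument for
  its inverse, written as a nonnegative power of \<open>y\<close>.\<close>

lemma cyc_support_image:
  assumes "x \<in> carrier (B_group n)" "y \<in> carrier (B_group n)" "x \<circ> y = y \<circ> x"
  shows "(y ^^ j) q \<in> cyc_support x ((y ^^ j) p) \<longleftrightarrow> q \<in> cyc_support x p"
proof -
  have 1: "(y ^^ j) q \<in> cyc_support x ((y ^^ j) p)" if "q \<in> cyc_support x p" for j q p
  proof -
    obtain e i where *: "e \<in> {1,-1}" "q = e * (x ^^ i) p"
      by (rule mem_cyc_supportE[OF assms(1) \<open>q \<in> cyc_support x p\<close>])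
    then have "(y ^^ j) q = e * (x ^^ i) ((y ^^ j) p)"
      by (simp only: B_sign[OF B_funpow[OF assms(2)]] funpow_commute[OF assms(3)])
    then show ?thesis using * by (auto simp only: mem_cyc_support_iff[OF assms(1)])
  qed
  show ?thesis
    using 1[where j = j] 1[where q = "(y ^^ j) q" and p = "(y ^^ j) p" and j = "j * (expo n - 1)"]
    by (metis funpow_inverse[OF assms(2)])
qed

section \<open>Assembling signed permutations from their action on signed cycles\<close>

lemma B_restrict:
  assumes g: "g \<in> carrier (B_group n)" and A: "\<And>v. v \<in> A \<Longrightarrow> g v \<in> A" "\<And>v. v \<in> A \<Longrightarrow> - v \<in> A"
  shows "perm_restrict g A \<in> carrier (B_group n)"
proof -
  have "(g ^^ i) v \<in> A" if "v \<in> A" for v i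
    \<comment> \<open>Closure under \<open>g\<close> is assumed in one direction only. Closure under
      its powers gives the other direction, because the inverse of \<open>g\<close> is one of
      them.\<close>
    by (induction i) (use A that in auto)
  then have A': "g v \<in> A \<longleftrightarrow> v \<in> A" for v
    using A funpow_inverse[OF g, of 1 v] by simp metis
  have "perm_restrict g A permutes pm n"
  proof (rule bij_imp_permutes)
    have "inj_on (perm_restrict g A) (pm n)"
    proof (rule inj_onI)
      fix v w assume "perm_restrict g A v = perm_restrict g A w"
      then show "v = w"
        using A'[of v] A'[of w] inj_eq[OF bij_is_inj[OF B_bij[OF g]], of v w]
        by (cases "v \<in> A"; cases "w \<in> A") (simp_all add: perm_restrict_def)
    qed
    moreover have "perm_restrict g A ` pm n \<subseteq> pm n"
      by (auto simp: perm_restrict_def B_mem_pm[OF g])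
    ultimately show "bij_betw (perm_restrict g A) (pm n) (pm n)"
      by (simp add: bij_betw_def endo_inj_surj)
  qed (auto simp: perm_restrict_def B_fixes[OF g])
  moreover have "perm_restrict g A (- v) = - perm_restrict g A v" for v
    using A(2)[of v] A(2)[of "- v"] by (cases "v \<in> A"; cases "- v \<in> A") (simp_all add: perm_restrict_def B_neg[OF g])
  ultimately show ?thesis by (simp add: B_carrier_iff)
qed

text \<open>When the sign \<open>E\<close> and the exponent \<open>I\<close> are constant on the
  signed cycles of \<open>x\<close>, this acts on each of them as an element of
  \<open><x, -1>\<close>. Changes of marking, changes of generators and twists are all of this
  kind.\<close>

definition piecewise :: "nat \<Rightarrow> (int \<Rightarrow> int) \<Rightarrow> (int \<Rightarrow> int) \<Rightarrow> (int \<Rightarrow> nat) \<Rightarrow> int \<Rightarrow> int" where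
  "piecewise n x E I v = (if v \<in> pm n then E v * (x ^^ I v) v else v)"

lemma piecewise_mem_cyc_support:
  assumes "x \<in> carrier (B_group n)" "\<And>v. v \<in> pm n \<Longrightarrow> E v \<in> {1, -1}"
  shows "piecewise n x E I v \<in> cyc_support x v"
  using assms by (auto simp: piecewise_def cyc_support_refl simp del: insert_iff intro!: cyc_supportI)

text \<open>Points with the same image lie on one signed cycle, where the map is a single injective
  signed power of \<open>x\<close>; finiteness of \<open>pm n\<close> does the rest.\<close>

lemma piecewise_mem_B:
  assumes x: "x \<in> carrier (B_group n)" and E: "\<And>v. v \<in> pm n \<Longrightarrow> E v \<in> {1, -1}"
    and const: "\<And>v w. v \<in> pm n \<Longrightarrow> w \<in> cyc_support x v \<Longrightarrow> E w = E v \<and> I w = I v"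
  shows "piecewise n x E I \<in> carrier (B_group n)"
proof -
  let ?f = "piecewise n x E I"
  have mem: "?f v \<in> cyc_support x v" for v
    by (rule piecewise_mem_cyc_support[OF x E])
  have "inj_on ?f (pm n)"
  proof (rule inj_onI)
    fix v w assume vw: "v \<in> pm n" "w \<in> pm n" "?f v = ?f w"
    then have "w \<in> cyc_support x v"
      using mem x cyc_support_eq cyc_support_refl by metis
    then have "E w = E v \<and> I w = I v" using const vw by simp
    then have "(x ^^ I v) w = (x ^^ I v) v"
      using vw E[OF vw(1)] by (auto simp: piecewise_def)
    then show "v = w"
      using B_bij[OF B_funpow[OF x, of "I v"]] by (auto simp: bij_def inj_def)
  qed
  moreover have "?f ` pm n \<subseteq> pm n"
    using mem cyc_support_subset_pm[OF x] by blast
  ultimately have "bij_betw ?f (pm n) (pm n)"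
    by (simp add: bij_betw_def endo_inj_surj)
  then have "?f permutes pm n"
    by (rule bij_imp_permutes) (simp add: piecewise_def)
  moreover have "?f (- v) = - ?f v" for v
    using const[of v "- v"] cyc_support_minus[OF x] by (auto simp: piecewise_def B_neg[OF B_funpow[OF x]])
  ultimately show ?thesis by (simp add: B_carrier_iff)
qed

lemma piecewise_commute:
  assumes x: "x \<in> carrier (B_group n)" and g: "g \<in> carrier (B_group n)" "g \<circ> x = x \<circ> g"
    and E: "\<And>v. v \<in> pm n \<Longrightarrow> E v \<in> {1, -1}"
    and const: "\<And>v. v \<in> pm n \<Longrightarrow> E (g v) = E v \<and> I (g v) = I v"
  shows "piecewise n x E I \<circ> g = g \<circ> piecewise n x E I"
proof
  fix v
  show "(piecewise n x E I \<circ> g) v = (g \<circ> piecewise n x E I) v"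
  proof (cases "v \<in> pm n")
    case True
    then show ?thesis
      using const[OF True] funpow_commute[OF g(2), of 1] E[OF True]
      by (simp only: comp_apply piecewise_def B_mem_pm[OF g(1)] if_True B_sign[OF g(1)]) simp
  qed (simp add: piecewise_def B_mem_pm[OF g(1)])
qed

text \<open>For commuting \<open>x\<close> and \<open>y\<close> in the group this is the orbit of
  \<open>p\<close> under \<open><x, y, -1>\<close>; nonnegative exponents suffice because the group
  is finite.\<close>

definition blk :: "(int \<Rightarrow> int) \<Rightarrow> (int \<Rightarrow> int) \<Rightarrow> int \<Rightarrow> int set" where
  "blk x y p = {e * (x ^^ i) ((y ^^ j) p) | e i j. e \<in> {1, -1}}"

section \<open>Periods, and the value of a character on a single signed cycle\<close>

definition per :: "(int \<Rightarrow> int) \<Rightarrow> int \<Rightarrow> nat" where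
  "per x p = (LEAST i. 0 < i \<and> (x ^^ i) p = p)"

lemma per_pos: "x \<in> carrier (B_group n) \<Longrightarrow> per x p > 0"
  and funpow_per: "x \<in> carrier (B_group n) \<Longrightarrow> (x ^^ per x p) p = p"
proof -
  assume x: "x \<in> carrier (B_group n)"
  have "0 < expo n \<and> (x ^^ expo n) p = p" using expo_pos funpow_expo[OF x] by simp
  then have "0 < per x p \<and> (x ^^ per x p) p = p" unfolding per_def by (rule LeastI)
  then show "per x p > 0" "(x ^^ per x p) p = p" by auto
qed

lemma funpow_eq_iff_dvd:
  assumes "x \<in> carrier (B_group n)"
  shows "(x ^^ i) p = p \<longleftrightarrow> per x p dvd i"
proof (rule least_positive_dvd)
  show "\<not> (x ^^ i) p = p" if "0 < i" "i < per x p" for i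
    using that not_less_Least unfolding per_def by blast
  show "((x ^^ (i + j)) p = p) \<longleftrightarrow> ((x ^^ j) p = p)" if "(x ^^ i) p = p" for i j
    using that by (metis add.commute comp_apply funpow_add)
qed (use per_pos[OF assms] funpow_per[OF assms] in auto)

lemma funpow_eq_iff_cong:
  assumes x: "x \<in> carrier (B_group n)"
  shows "(x ^^ i) p = (x ^^ j) p \<longleftrightarrow> [i = j] (mod per x p)"
proof -
  have *: "(x ^^ i) p = (x ^^ j) p \<longleftrightarrow> [i = j] (mod per x p)" if "i \<le> j" for i j
  proof -
    have "(x ^^ j) p = (x ^^ i) ((x ^^ (j - i)) p)"
      using that by (metis add_diff_inverse_nat comp_apply funpow_add not_le)
    then have "(x ^^ i) p = (x ^^ j) p \<longleftrightarrow> (x ^^ (j - i)) p = p"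
      using B_bij[OF B_funpow[OF x, of i]] by (auto simp: bij_def inj_eq)
    also have "\<dots> \<longleftrightarrow> [i = j] (mod per x p)"
      using that by (simp add: funpow_eq_iff_dvd[OF x] cong_sym_eq[of i j] cong_altdef_nat)
    finally show ?thesis .
  qed
  show ?thesis using *[of i j] *[of j i] by (cases "i \<le> j") (auto simp: cong_sym_eq)
qed

lemma zeta_per_eq_iff:
  "x \<in> carrier (B_group n) \<Longrightarrow> zeta (per x p) i = zeta (per x p) j \<longleftrightarrow> (x ^^ i) p = (x ^^ j) p"
  by (simp add: funpow_eq_iff_cong zeta_eq_iff per_pos)

lemma pm_nonzero: "p \<in> pm n \<Longrightarrow> - p \<noteq> p"
  by (auto simp: pm_def)

text \<open>If \<open>x^h p = - p\<close>, then \<open>x^(2h)\<close> fixes \<open>p\<close> but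
  \<open>x^h\<close> does not, so the root of unity attached to \<open>h\<close> squares to 1
  without being 1. Expressing the half period as multiplication by -1 avoids halving
  \<open>per x p\<close>.\<close>

lemma funpow_eq_minus_funpow_iff:
  assumes x: "x \<in> carrier (B_group n)" and p: "p \<in> pm n"
  shows "(x ^^ i) p = - (x ^^ j) p \<longleftrightarrow> - p \<in> orbit x p \<and> zeta (per x p) i = - zeta (per x p) j"
proof -
  have opp: "- p \<in> orbit x p \<and> zeta (per x p) i = - zeta (per x p) j" if "(x ^^ i) p = - (x ^^ j) p" for i j
  proof -
    \<comment> \<open>This is \<open>i - j\<close> modulo the group order, made nonnegative.\<close>
    let ?h = "j * (expo n - 1) + i"
    have h: "(x ^^ ?h) p = - p"
      by (simp only: funpow_add comp_apply that B_neg[OF B_funpow[OF x]] funpow_inverse[OF x])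
    then have "(x ^^ (?h + ?h)) p = p"
      by (subst funpow_add) (simp only: comp_apply B_neg[OF B_funpow[OF x]] minus_minus)
    then have "zeta (per x p) (?h + ?h) = zeta (per x p) 0"
      by (subst zeta_per_eq_iff[OF x]) simp
    then have "zeta (per x p) ?h * zeta (per x p) ?h = 1"
      by (simp only: zeta_add zeta_0)
    moreover have "zeta (per x p) ?h \<noteq> zeta (per x p) 0"
      using h pm_nonzero[OF p] by (subst zeta_per_eq_iff[OF x]) simp
    ultimately have z: "zeta (per x p) ?h = - 1" by (simp add: square_eq_1_iff)
    have "(x ^^ (j + ?h)) p = (x ^^ i) p"
      by (subst funpow_add) (simp only: comp_apply h B_neg[OF B_funpow[OF x]] that)
    then have "zeta (per x p) (j + ?h) = zeta (per x p) i"
      by (simp only: zeta_per_eq_iff[OF x])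
    then have "zeta (per x p) j * zeta (per x p) ?h = zeta (per x p) i"
      by (simp only: zeta_add)
    then show ?thesis using z h by (auto simp: mem_orbit_iff[OF x]) (metis h)
  qed
  have "(x ^^ i) p = - (x ^^ j) p" if "- p \<in> orbit x p" "zeta (per x p) i = - zeta (per x p) j"
  proof -
    obtain h where h: "(x ^^ h) p = - p" using \<open>- p \<in> orbit x p\<close> unfolding mem_orbit_iff[OF x] by metis
    then have "(x ^^ h) p = - (x ^^ 0) p" by simp
    from opp[OF this] have "zeta (per x p) (j + h) = zeta (per x p) i"
      by (simp add: zeta_add that(2))
    then have "(x ^^ i) p = (x ^^ (j + h)) p" by (simp only: zeta_per_eq_iff[OF x])
    then show ?thesis by (simp only: funpow_add comp_apply h B_neg[OF B_funpow[OF x]])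
  qed
  then show ?thesis using opp by blast
qed

text \<open>
  The value at an element of \<open>\<langle>x, -1\<rangle>\<close>, encoded by the image \<open>q\<close> of \<open>p\<close>, of the character of this group
  acting on the signed cycle of \<open>p\<close>: it sends \<open>x\<close> to the standard root of unity, and \<open>-1\<close> to \<open>1\<close> for class
  +1 but necessarily to \<open>-1\<close> for class -1.
\<close>

definition lam :: "(int \<Rightarrow> int) \<Rightarrow> int \<Rightarrow> int \<Rightarrow> complex" where
  "lam x p q = (SOME z. \<exists>e\<in>{1,-1}. \<exists>u. q = e * (x ^^ u) p \<and>
     z = (if - p \<in> orbit x p then of_int e else 1) * zeta (per x p) u)"

text \<open>The choice in \<open>lam\<close> has only one candidate. Two presentations of the same
  point with equal signs have equal roots of unity; opposite signs occur only in class -1, where the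
  sign and the root of unity both change by -1.\<close>

lemma lam_eq:
  assumes x: "x \<in> carrier (B_group n)" and p: "p \<in> pm n" and e: "e \<in> {1,-1}"
  shows "lam x p (e * (x ^^ u) p) = (if - p \<in> orbit x p then of_int e else 1) * zeta (per x p) u"
proof -
  define Q where "Q z \<longleftrightarrow> (\<exists>e'\<in>{1,-1}. \<exists>v. e * (x ^^ u) p = e' * (x ^^ v) p \<and>
      z = (if - p \<in> orbit x p then of_int e' else 1) * zeta (per x p) v)" for z :: complex
  define a where "a = (if - p \<in> orbit x p then of_int e else 1) * zeta (per x p) u"
  have "Q a" unfolding Q_def a_def using e by blast
  moreover have "z = a" if "Q z" for z
  proof -
    obtain e' v where e': "e' \<in> {1,-1}" and eq: "e * (x ^^ u) p = e' * (x ^^ v) p"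
      and z: "z = (if - p \<in> orbit x p then of_int e' else 1) * zeta (per x p) v"
      using \<open>Q z\<close> unfolding Q_def by (elim bexE exE conjE) (rule that)
    show "z = a"
    proof (cases "e = e'")
      case True
      then have "(x ^^ u) p = (x ^^ v) p" using eq e by auto
      then show ?thesis using True z by (simp add: a_def zeta_per_eq_iff[OF x, symmetric])
    next
      case False
      then have "(x ^^ u) p = - (x ^^ v) p" using eq e e' by auto
      then show ?thesis using z e e' False by (auto simp: a_def funpow_eq_minus_funpow_iff[OF x p])
    qed
  qed
  ultimately have "(SOME z. Q z) = a" by (rule some_equality)
  then show ?thesis unfolding lam_def Q_def a_def .
qed

text \<open>For commuting \<open>x\<close> and \<open>y\<close> the minimal \<open>a\<close> is the
  number of signed \<open>x\<close>-cycles in the orbit of \<open>p\<close>. No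
  \<open>\<omega>\<close> enters, so weights of elements from different conjugacy classes can be
  added up.\<close>

definition wt :: "(int \<Rightarrow> int) \<Rightarrow> (int \<Rightarrow> int) \<Rightarrow> int \<Rightarrow> complex" where
  "wt x y p = lam x p ((y ^^ (LEAST a. 0 < a \<and> (y ^^ a) p \<in> cyc_support x p)) p)"

lemma wt_eqI:
  assumes "x \<in> carrier (B_group n)" "p \<in> pm n" "e \<in> {1,-1}" "a > 0" "(y ^^ a) p = e * (x ^^ u) p"
    and least: "\<And>i. 0 < i \<Longrightarrow> i < a \<Longrightarrow> (y ^^ i) p \<notin> cyc_support x p"
  shows "wt x y p = (if - p \<in> orbit x p then of_int e else 1) * zeta (per x p) u"
proof -
  have "(LEAST a. 0 < a \<and> (y ^^ a) p \<in> cyc_support x p) = a"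
  proof (rule Least_equality)
    show "0 < a \<and> (y ^^ a) p \<in> cyc_support x p"
      using assms cyc_supportI by metis
    show "a \<le> i" if "0 < i \<and> (y ^^ i) p \<in> cyc_support x p" for i
      using that least[of i] by (meson not_le)
  qed
  then show ?thesis unfolding wt_def by (simp only: assms(5) lam_eq[OF assms(1-3)])
qed

text \<open>Every ingredient of the weight is read off from the powers of \<open>x\<close> and
  \<open>y\<close> at \<open>p\<close>, and a signed permutation \<open>g\<close> carries these
  along. Asking only for the powers at \<open>p\<close>, not for conjugate maps, also yields
  locality, with \<open>g = id\<close>.\<close>

lemma wt_transport:
  assumes B: "x \<in> carrier (B_group n)" "x' \<in> carrier (B_group n)" and g: "g \<in> carrier (B_group n)"
    and x': "\<And>i. (x' ^^ i) (g p) = g ((x ^^ i) p)" and y': "\<And>i. (y' ^^ i) (g p) = g ((y ^^ i) p)"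
  shows "wt x' y' (g p) = wt x y p"
proof -
  have inj: "g v = g w \<longleftrightarrow> v = w" for v w
    using B_bij[OF g] by (simp add: bij_def inj_eq)
  have 1: "g v \<in> cyc_support x' (g p) \<longleftrightarrow> v \<in> cyc_support x p" for v
  proof -
    have "g v = e * (x' ^^ i) (g p) \<longleftrightarrow> v = e * (x ^^ i) p" if "e \<in> {1,-1}" for e i
      using that by (simp only: x' B_sign[OF g, symmetric] inj)
    then show ?thesis unfolding mem_cyc_support_iff[OF B(1)] mem_cyc_support_iff[OF B(2)] by blast
  qed
  have 2: "- g p \<in> orbit x' (g p) \<longleftrightarrow> - p \<in> orbit x p"
    by (simp add: mem_orbit_iff[OF B(1)] mem_orbit_iff[OF B(2)] x' B_neg[OF g, symmetric] inj)
  have 3: "per x' (g p) = per x p" by (simp add: per_def x' inj)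
  have 4: "lam x' (g p) (g q) = lam x p q" for q
  proof -
    have "g q = e * (x' ^^ u) (g p) \<longleftrightarrow> q = e * (x ^^ u) p" if "e \<in> {1,-1}" for e u
      using that by (simp only: x' B_sign[OF g, symmetric] inj)
    then have "(\<exists>e\<in>{1,-1}. \<exists>u. g q = e * (x' ^^ u) (g p) \<and> z = (if - g p \<in> orbit x' (g p) then of_int e else 1) * zeta (per x' (g p)) u)
      \<longleftrightarrow> (\<exists>e\<in>{1,-1}. \<exists>u. q = e * (x ^^ u) p \<and> z = (if - p \<in> orbit x p then of_int e else 1) * zeta (per x p) u)" for z :: complex
      unfolding 2 3 by blast
    then show ?thesis unfolding lam_def by presburger
  qed
  show ?thesis unfolding wt_def by (simp only: y' 1 4)
qed

lemma wt_cong: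
  assumes "x \<in> carrier (B_group n)" "x' \<in> carrier (B_group n)" "\<And>i. (x' ^^ i) p = (x ^^ i) p"
  shows "wt x' y p = wt x y p"
  using wt_transport[of x n x' id p y y] assms by simp

section \<open>Evaluation of \<omega>\<close>

lemma blk_refl: "p \<in> blk x y p"
proof -
  have "p = 1 * (x ^^ 0) ((y ^^ 0) p)" by simp
  then show ?thesis unfolding blk_def by blast
qed

lemma blkE:
  assumes "q \<in> blk x y p"
  obtains e i j where "e \<in> {1,-1}" "q = e * (x ^^ i) ((y ^^ j) p)"
  using assms unfolding blk_def mem_Collect_eq by (elim exE conjE) (rule that)

lemma blk_least:
  assumes "p \<in> A" "\<And>v. v \<in> A \<Longrightarrow> x v \<in> A" "\<And>v. v \<in> A \<Longrightarrow> y v \<in> A" "\<And>v. v \<in> A \<Longrightarrow> - v \<in> A"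
  shows "blk x y p \<subseteq> A"
proof
  fix q assume "q \<in> blk x y p"
  then obtain e i j where *: "e \<in> {1,-1}" "q = e * (x ^^ i) ((y ^^ j) p)" by (rule blkE)
  have "(y ^^ j) p \<in> A" by (induction j) (use assms in auto)
  then have "(x ^^ i) ((y ^^ j) p) \<in> A" by (induction i) (use assms in auto)
  then show "q \<in> A" using * assms(4) by auto
qed

locale commuting_pair =
  fixes n x y
  assumes x: "x \<in> carrier (B_group n)" and y: "y \<in> carrier (B_group n)" and xy: "x \<circ> y = y \<circ> x"
begin

lemma blk_closed:
  assumes "v \<in> blk x y p"
  shows "x v \<in> blk x y p" "y v \<in> blk x y p" "- v \<in> blk x y p"
proof -
  obtain e i j where *: "e \<in> {1,-1}" "v = e * (x ^^ i) ((y ^^ j) p)" using assms by (rule blkE)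
  have "x v = e * (x ^^ Suc i) ((y ^^ j) p)"
    using * by (simp only: B_sign[OF x] funpow.simps comp_apply)
  then show "x v \<in> blk x y p" using * unfolding blk_def by blast
  have "y v = e * (x ^^ i) ((y ^^ Suc j) p)"
    using * funpow_commute[OF xy, of i 1] by (simp only: B_sign[OF y] funpow.simps comp_apply) simp
  then show "y v \<in> blk x y p" using * unfolding blk_def by blast
  have "- v = (- e) * (x ^^ i) ((y ^^ j) p)" "- e \<in> {1,-1}"
    using * by auto
  then show "- v \<in> blk x y p" unfolding blk_def by blast
qed

lemma blk_funpow:
  assumes "v \<in> blk x y p"
  shows "(x ^^ i) v \<in> blk x y p" "(y ^^ i) v \<in> blk x y p"
  by (induction i) (use assms blk_closed in auto)

lemma blk_trans: "q \<in> blk x y p \<Longrightarrow> blk x y q \<subseteq> blk x y p"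
  by (rule blk_least) (auto simp: blk_closed)

lemma blk_sym:
  assumes "q \<in> blk x y p"
  shows "p \<in> blk x y q"
proof -
  obtain e i j where *: "e \<in> {1,-1}" "q = e * (x ^^ i) ((y ^^ j) p)" using assms by (rule blkE)
  have "e * (x ^^ i) ((y ^^ j) p) \<in> blk x y q" using * blk_refl by metis
  then have "(x ^^ i) ((y ^^ j) p) \<in> blk x y q" using * blk_closed(3) by fastforce
  then show ?thesis
    using blk_funpow(1)[of "(x ^^ i) ((y ^^ j) p)" q "i * (expo n - 1)"]
      blk_funpow(2)[of "(y ^^ j) p" q "j * (expo n - 1)"] by (simp only: funpow_inverse[OF x] funpow_inverse[OF y])
qed

lemma blk_eq: "q \<in> blk x y p \<Longrightarrow> blk x y q = blk x y p"
  using blk_trans blk_sym by blast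

lemma blk_subset_pm: "p \<in> pm n \<Longrightarrow> blk x y p \<subseteq> pm n"
  by (rule blk_least) (auto simp: B_mem_pm[OF x] B_mem_pm[OF y])

lemma cyc_support_subset_blk: "cyc_support x p \<subseteq> blk x y p" "cyc_support y p \<subseteq> blk x y p"
proof -
  have *: "e * v \<in> blk x y p" if "e \<in> {1,-1}" "v \<in> blk x y p" for e v
    using that blk_closed(3) by auto
  show "cyc_support x p \<subseteq> blk x y p"
  proof
    fix q assume "q \<in> cyc_support x p"
    then obtain e i where "e \<in> {1,-1}" "q = e * (x ^^ i) p" by (rule mem_cyc_supportE[OF x])
    then show "q \<in> blk x y p" using * blk_funpow(1)[OF blk_refl] by metis
  qed
  show "cyc_support y p \<subseteq> blk x y p"
  proof
    fix q assume "q \<in> cyc_support y p"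
    then obtain e i where "e \<in> {1,-1}" "q = e * (y ^^ i) p" by (rule mem_cyc_supportE[OF y])
    then show "q \<in> blk x y p" using * blk_funpow(2)[OF blk_refl] by metis
  qed
qed

lemma restrict_blk_commute:
  "perm_restrict y (blk x y p) \<in> carrier (B_group n)"
  "perm_restrict y (blk x y p) \<circ> x = x \<circ> perm_restrict y (blk x y p)"
proof -
  show "perm_restrict y (blk x y p) \<in> carrier (B_group n)"
    by (rule B_restrict[OF y]) (auto simp: blk_closed)
  have "x v \<in> blk x y p \<longleftrightarrow> v \<in> blk x y p" for v
    using blk_closed(1)[of v p] blk_funpow(1)[of "x v" p "expo n - 1"] funpow_inverse[OF x, of 1 v] by auto
  then show "perm_restrict y (blk x y p) \<circ> x = x \<circ> perm_restrict y (blk x y p)"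
    using xy by (auto simp: perm_restrict_def fun_eq_iff)
qed

end

section \<open>Centralizers and their linear characters\<close>

lemma mem_centralizer:
  "g \<in> centralizer (B_group n) x \<longleftrightarrow> g \<in> carrier (B_group n) \<and> g \<circ> x = x \<circ> g"
  by (simp add: centralizer_def)

lemma centralizer_comp:
  assumes "g \<in> centralizer (B_group n) x" "h \<in> centralizer (B_group n) x"
  shows "g \<circ> h \<in> centralizer (B_group n) x"
  using assms by (auto simp: mem_centralizer B_comp fun_eq_iff)

lemma centralizer_funpow:
  assumes "g \<in> centralizer (B_group n) x"
  shows "g ^^ i \<in> centralizer (B_group n) x"
  using assms funpow_commute[of g x i 1] by (auto simp: mem_centralizer B_funpow fun_eq_iff)

lemma centralizer_inv:
  assumes "g \<in> centralizer (B_group n) x"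
  shows "Hilbert_Choice.inv g \<in> centralizer (B_group n) x"
proof -
  have g: "g \<in> carrier (B_group n)" "bij g" and c: "g (x v) = x (g v)" for v
    using assms B_bij by (auto simp: mem_centralizer fun_eq_iff)
  have "Hilbert_Choice.inv g (x v) = x (Hilbert_Choice.inv g v)" for v
    using g(2) c by (metis bij_inv_eq_iff)
  then show ?thesis using g by (auto simp: mem_centralizer B_inv_mem)
qed

lemma centralizer_self: "x \<in> carrier (B_group n) \<Longrightarrow> x \<in> centralizer (B_group n) x"
  by (simp add: mem_centralizer)

lemma centralizer_restrict_cyc_support:
  assumes x: "x \<in> carrier (B_group n)" and g: "g \<in> centralizer (B_group n) x" and gp: "g p \<in> cyc_support x p"
  shows "perm_restrict g (cyc_support x p) \<in> centralizer (B_group n) x"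
proof -
  have gB: "g \<in> carrier (B_group n)" and c: "x \<circ> g = g \<circ> x" using g by (auto simp: mem_centralizer)
  have "g v \<in> cyc_support x p" if "v \<in> cyc_support x p" for v
    using cyc_support_image[OF x gB c, of 1 v p] that cyc_support_eq[OF x gp] by simp
  then have "perm_restrict g (cyc_support x p) \<in> carrier (B_group n)"
    by (intro B_restrict[OF gB]) (auto simp: cyc_support_invariant[OF x])
  then show ?thesis using c
    by (auto simp: mem_centralizer perm_restrict_def cyc_support_invariant[OF x] fun_eq_iff)
qed

lemma cyc_class_eq_1_iff:
  assumes "x \<in> carrier (B_group n)"
  shows "cyc_class x a = 1 \<longleftrightarrow> - a \<notin> orbit x a"
proof -
  have self: "v \<in> orbit x v" for v
    using B_permutation[OF assms] by (rule permutation_self_in_orbit)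
  have "orbit x (- a) = orbit x a" if "- a \<in> orbit x a"
    using that orbit_swap[OF self that] orbit_trans[of _ x] by blast
  then have "orbit x (- a) = orbit x a \<longleftrightarrow> - a \<in> orbit x a"
    using self[of "- a"] by auto
  then show ?thesis by (simp add: cyc_class_def)
qed

locale omega =
  fixes n x \<omega>
  assumes xB: "x \<in> carrier (B_group n)"
    and chi: "linear_character_on (B_group n) (centralizer (B_group n) x) \<omega>"
begin

lemma mult: "g \<in> centralizer (B_group n) x \<Longrightarrow> h \<in> centralizer (B_group n) x \<Longrightarrow> \<omega> (g \<circ> h) = \<omega> g * \<omega> h"
  and nonzero: "g \<in> centralizer (B_group n) x \<Longrightarrow> \<omega> g \<noteq> 0"
  using chi by (auto simp: linear_character_on_def)

lemma one: "\<omega> id = 1"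
proof -
  have id: "id \<in> centralizer (B_group n) x" by (simp add: mem_centralizer)
  show ?thesis using mult[OF id id] nonzero[OF id] by simp
qed

lemma power: "g \<in> centralizer (B_group n) x \<Longrightarrow> \<omega> (g ^^ i) = \<omega> g ^ i"
  by (induction i) (auto simp: mult centralizer_funpow one id_def[symmetric])

lemma conj:
  assumes "z \<in> centralizer (B_group n) x" "g \<in> centralizer (B_group n) x" "h \<in> centralizer (B_group n) x"
    and "z \<circ> g = h \<circ> z"
  shows "\<omega> g = \<omega> h"
  using mult[OF assms(1,2)] mult[OF assms(3,1)] nonzero[OF assms(1)] assms(4) by simp

lemma signed_cycle_mem: "signed_cycle x p \<in> centralizer (B_group n) x"
  unfolding signed_cycle_def
  by (rule centralizer_restrict_cyc_support[OF xB centralizer_self[OF xB] cyc_support_step[OF xB]])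

lemma funpow_signed_cycle:
  "(signed_cycle x p ^^ i) v = (if v \<in> cyc_support x p then (x ^^ i) v else v)"
proof (cases "v \<in> cyc_support x p")
  case True
  then have m: "(x ^^ i) v \<in> cyc_support x p" for i
    by (induction i) (auto simp: cyc_support_invariant[OF xB])
  have "(signed_cycle x p ^^ i) v = (x ^^ i) v"
    by (induction i) (use m in \<open>auto simp: signed_cycle_def perm_restrict_simps\<close>)
  then show ?thesis using True by simp
next
  case False
  then have "(signed_cycle x p ^^ i) v = v"
    by (induction i) (auto simp: signed_cycle_def perm_restrict_simps)
  then show ?thesis using False by simp
qed

lemma cyc_negation_mem:
  assumes "p \<in> pm n"
  shows "cyc_negation x p \<in> centralizer (B_group n) x"
proof -
  have "cyc_negation x p = piecewise n x (\<lambda>v. if v \<in> cyc_support x p then - 1 else 1) (\<lambda>_. 0)"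
    using cyc_support_subset_pm[OF xB assms] by (auto simp: cyc_negation_def piecewise_def perm_restrict_def fun_eq_iff)
  also have "\<dots> \<in> carrier (B_group n)"
  proof (rule piecewise_mem_B[OF xB])
    fix v w assume "w \<in> cyc_support x v"
    then have "w \<in> cyc_support x p \<longleftrightarrow> v \<in> cyc_support x p"
      using cyc_support_trans[OF xB] cyc_support_sym[OF xB] by meson
    then show "(if w \<in> cyc_support x p then - 1 else 1) = (if v \<in> cyc_support x p then - 1 else (1::int)) \<and> 0 = (0::nat)"
      by simp
  qed simp
  finally show ?thesis
    by (auto simp: mem_centralizer cyc_negation_def perm_restrict_def cyc_support_invariant[OF xB] B_neg[OF xB])
qed

text \<open>An element of the base group carries one marking to the other, so the two complements
  are conjugate in the centralizer, and a linear character does not see conjugation. Only some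
  marking is given with \<open>\<omega>\<close>, whereas evaluating at \<open>y\<close> needs a
  marking adapted to \<open>y\<close>.\<close>

lemma complement_trivial_change:
  assumes T: "marking n x T" "\<forall>z\<in>complement n x T. \<omega> z = 1" and T': "marking n x T'"
    and c: "c \<in> complement n x T'"
  shows "\<omega> c = 1"
proof -
  \<comment> \<open>Sign and exponent are chosen for each signed cycle as a set, which makes them
    constant along it.\<close>
  have "\<exists>e i. e \<in> {1,-1} \<and> (\<forall>t\<in>T. \<forall>t'\<in>T'. t \<in> C \<and> t' \<in> C \<longrightarrow> t' = e * (x ^^ i) t)"
    if "C \<in> cyc_support x ` pm n" for C
  proof -
    obtain v where v: "v \<in> pm n" "C = cyc_support x v" using \<open>C \<in> _\<close> by blast
    obtain t where t: "t \<in> T" "t \<in> C" "\<And>s. s \<in> T \<Longrightarrow> s \<in> C \<Longrightarrow> s = t"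
      using T(1) v unfolding marking_def by metis
    obtain t' where t': "t' \<in> T'" "t' \<in> C" "\<And>s. s \<in> T' \<Longrightarrow> s \<in> C \<Longrightarrow> s = t'"
      using T' v unfolding marking_def by metis
    have "t' \<in> cyc_support x t"
      using t(2) t'(2) v(2) cyc_support_trans[OF xB] cyc_support_sym[OF xB] by metis
    then obtain e i where "e \<in> {1,-1}" "t' = e * (x ^^ i) t" by (rule mem_cyc_supportE[OF xB])
    then show ?thesis using t(3) t'(3) by blast
  qed
  then obtain E I where EI: "\<And>C. C \<in> cyc_support x ` pm n \<Longrightarrow> E C \<in> {1,-1} \<and>
      (\<forall>t\<in>T. \<forall>t'\<in>T'. t \<in> C \<and> t' \<in> C \<longrightarrow> t' = E C * (x ^^ I C) t)"
    by metis
  define z where "z = piecewise n x (\<lambda>v. E (cyc_support x v)) (\<lambda>v. I (cyc_support x v))"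
  have E: "E (cyc_support x v) \<in> {1,-1}" if "v \<in> pm n" for v using EI that by blast
  have zZ: "z \<in> centralizer (B_group n) x"
    unfolding mem_centralizer z_def
  proof
    show "piecewise n x (\<lambda>v. E (cyc_support x v)) (\<lambda>v. I (cyc_support x v)) \<in> carrier (B_group n)"
      by (rule piecewise_mem_B[OF xB E]) (auto simp: cyc_support_eq[OF xB])
    show "piecewise n x (\<lambda>v. E (cyc_support x v)) (\<lambda>v. I (cyc_support x v)) \<circ> x =
          x \<circ> piecewise n x (\<lambda>v. E (cyc_support x v)) (\<lambda>v. I (cyc_support x v))"
      using cyc_support_eq[OF xB cyc_support_step[OF xB]]
      by (intro piecewise_commute[OF xB xB refl E]) metis+
  qed
  have zt: "z t = t'" if t: "t \<in> T" and t': "t' \<in> T'" "t' \<in> cyc_support x t" for t t'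
  proof -
    have "t \<in> pm n" using T(1) t by (auto simp: marking_def)
    then show ?thesis
      using EI[of "cyc_support x t"] t t' cyc_support_refl[OF xB] by (auto simp: z_def piecewise_def)
  qed
  have zT: "z ` T = T'"
  proof (intro equalityI subsetI)
    fix v assume "v \<in> z ` T"
    then obtain t where t: "t \<in> T" "v = z t" by blast
    then have "t \<in> pm n" using T(1) by (auto simp: marking_def)
    then obtain t' where "t' \<in> T'" "t' \<in> cyc_support x t" using T' unfolding marking_def by metis
    then show "v \<in> T'" using zt t by metis
  next
    fix t' assume t': "t' \<in> T'"
    then have "t' \<in> pm n" using T' by (auto simp: marking_def)
    then obtain t where t: "t \<in> T" "t \<in> cyc_support x t'" using T(1) unfolding marking_def by metis
    then have "t' \<in> cyc_support x t" using cyc_support_sym[OF xB] by blast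
    then show "t' \<in> z ` T" using zt t t' by blast
  qed
  define c' where "c' = Hilbert_Choice.inv z \<circ> c \<circ> z"
  have bz: "bij z" using zZ B_bij by (auto simp: mem_centralizer)
  have cZ: "c \<in> centralizer (B_group n) x" "c ` T' = T'" using c by (auto simp: complement_def)
  have c'Z: "c' \<in> centralizer (B_group n) x"
    unfolding c'_def by (intro centralizer_comp centralizer_inv zZ cZ)
  have "c' ` T = Hilbert_Choice.inv z ` z ` T"
    unfolding c'_def by (simp only: image_comp[symmetric] zT cZ)
  also have "\<dots> = T" using bz by (simp add: bij_is_inj image_inv_f_f)
  finally have "\<omega> c' = 1" using T(2) c'Z by (simp add: complement_def)
  moreover have "z \<circ> c' = c \<circ> z"
    using bz unfolding c'_def by (auto simp: fun_eq_iff bij_is_surj surj_f_inv_f)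
  ultimately show ?thesis using conj[OF zZ c'Z cZ(1)] by simp
qed

end

text \<open>\<open>per x a\<close> is the order of \<open>signed_cycle x a\<close>, namely
  \<open>i\<close> in class +1 and \<open>2i\<close> in class -1 for a cycle of length
  \<open>i\<close>. A faithful character takes some primitive root of unity of this order there; the
  normalization asks for the standard one.\<close>

locale normalized_omega = omega +
  assumes neg: "\<And>a. a \<in> pm n \<Longrightarrow> - a \<notin> orbit x a \<Longrightarrow> \<omega> (cyc_negation x a) = 1"
    and cyc: "\<And>a. a \<in> pm n \<Longrightarrow> \<omega> (signed_cycle x a) = zeta (per x a) 1"
    and compl: "\<exists>T. marking n x T \<and> (\<forall>z\<in>complement n x T. \<omega> z = 1)"
begin

text \<open>A centralizing element that preserves a signed cycle is determined there by the image of
  one point, hence agrees on it with a signed power of \<open>x\<close>.\<close>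

lemma omega_restrict_cyc_support:
  assumes p: "p \<in> pm n" and g: "g \<in> centralizer (B_group n) x" and gp: "g p \<in> cyc_support x p"
  shows "\<omega> (perm_restrict g (cyc_support x p)) = lam x p (g p)"
proof -
  obtain e0 u0 where e0: "e0 \<in> {1,-1}" "g p = e0 * (x ^^ u0) p" using gp by (rule mem_cyc_supportE[OF xB])
  \<comment> \<open>In class -1 negation is itself a power of \<open>x\<close> on the cycle, so the
    sign is absorbed in the exponent. Only class +1 calls for \<open>cyc_negation\<close>, and there
    its value is 1.\<close>
  obtain e u where e: "e \<in> {1,-1}" "g p = e * (x ^^ u) p" "e = 1 \<or> - p \<notin> orbit x p"
  proof (cases "e0 = 1 \<or> - p \<notin> orbit x p")
    case True
    then show ?thesis using e0 that by blast
  next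
    case False
    then obtain h where "- p = (x ^^ h) p" by (auto simp: mem_orbit_iff[OF xB])
    then have "(x ^^ (u0 + h)) p = - (x ^^ u0) p"
      by (simp add: funpow_add B_neg[OF B_funpow[OF xB]] flip: \<open>- p = _\<close>)
    then show ?thesis using that[of 1 "u0 + h"] e0 False by auto
  qed
  have gB: "g \<in> carrier (B_group n)" "x \<circ> g = g \<circ> x" using g by (auto simp: mem_centralizer)
  have gv: "g v = e * (x ^^ u) v" if v: "v \<in> cyc_support x p" for v
  proof -
    obtain d i where d: "d \<in> {1,-1}" "v = d * (x ^^ i) p" using v by (rule mem_cyc_supportE[OF xB])
    have "g ((x ^^ i) p) = (x ^^ i) (g p)" using funpow_commute[OF gB(2), of i 1] by simp
    then have "g v = d * (e * (x ^^ (i + u)) p)"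
      using d e(1,2) by (simp only: B_sign[OF gB(1)] B_sign[OF B_funpow[OF xB]] funpow_add comp_apply)
    also have "\<dots> = e * (x ^^ u) v"
      using d by (simp only: B_sign[OF B_funpow[OF xB]] add.commute[of i] funpow_add comp_apply mult.left_commute)
    finally show ?thesis .
  qed
  have s: "\<omega> (signed_cycle x p ^^ u) = zeta (per x p) u"
    by (simp add: power[OF signed_cycle_mem] cyc[OF p] zeta_power)
  have lam: "lam x p (g p) = zeta (per x p) u"
    using e by (auto simp: lam_eq[OF xB p e(1)] simp del: insert_iff)
  show ?thesis
  proof (cases "e = 1")
    case True
    then have "perm_restrict g (cyc_support x p) = signed_cycle x p ^^ u"
      using gv by (auto simp: perm_restrict_def funpow_signed_cycle)
    then show ?thesis using s lam by simp
  next
    case False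
    then have e1: "e = - 1" "- p \<notin> orbit x p" using e by auto
    have "(x ^^ u) v \<in> cyc_support x p \<longleftrightarrow> v \<in> cyc_support x p" for v
      by (induction u) (auto simp: cyc_support_invariant[OF xB])
    then have "perm_restrict g (cyc_support x p) = cyc_negation x p \<circ> (signed_cycle x p ^^ u)"
      using gv e1 by (auto simp: perm_restrict_def funpow_signed_cycle cyc_negation_def)
    then show ?thesis using s lam e1 neg[OF p]
      by (simp add: mult cyc_negation_mem[OF p] centralizer_funpow[OF signed_cycle_mem])
  qed
qed

text \<open>On the orbit, \<open>y\<close> factors as \<open>b \<circ> \<sigma>\<close>:
  \<open>b\<close> is \<open>y^a\<close> on the single signed cycle of \<open>p\<close>, and
  \<open>\<sigma>\<close> permutes the points \<open>p, y p, ..., y^(a-1) p\<close>. With these as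
  marked points \<open>\<sigma>\<close> lies in the complement, so only \<open>b\<close>
  contributes.\<close>

lemma omega_restrict_blk:
  assumes p: "p \<in> pm n" and y: "y \<in> centralizer (B_group n) x"
  shows "\<omega> (perm_restrict y (blk x y p)) = wt x y p"
proof -
  have yB: "y \<in> carrier (B_group n)" and xy: "x \<circ> y = y \<circ> x" using y by (auto simp: mem_centralizer)
  interpret pr: commuting_pair n x y by unfold_locales (use xB yB xy in auto)
  define a where "a = (LEAST a. 0 < a \<and> (y ^^ a) p \<in> cyc_support x p)"
  have "0 < expo n \<and> (y ^^ expo n) p \<in> cyc_support x p"
    by (simp add: expo_pos funpow_expo[OF yB] cyc_support_refl[OF xB])
  then have a: "0 < a \<and> (y ^^ a) p \<in> cyc_support x p" unfolding a_def by (rule LeastI)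
  have least: "(y ^^ i) p \<notin> cyc_support x p" if "0 < i" "i < a" for i
    using that not_less_Least unfolding a_def by blast
  have img: "cyc_support x ((y ^^ j) v) = cyc_support x ((y ^^ j) w)" if "v \<in> cyc_support x w" for v w j
    using cyc_support_eq[OF xB] cyc_support_image[OF xB yB xy] that by blast
  have dvd: "(y ^^ i) p \<in> cyc_support x p \<longleftrightarrow> a dvd i" for i
  proof (rule least_positive_dvd)
    fix i j assume "(y ^^ i) p \<in> cyc_support x p"
    then have "cyc_support x ((y ^^ (i + j)) p) = cyc_support x ((y ^^ j) p)"
      using img[of "(y ^^ i) p" p j] by (simp add: funpow_add add.commute[of i])
    then show "((y ^^ (i + j)) p \<in> cyc_support x p) \<longleftrightarrow> ((y ^^ j) p \<in> cyc_support x p)"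
      using cyc_support_sym[OF xB] cyc_support_refl[OF xB] cyc_support_eq[OF xB] by metis
  qed (use a least in auto)
  have distinct: "i = j" if "i < a" "j < a" "(y ^^ i) p \<in> cyc_support x ((y ^^ j) p)" for i j
  proof -
    have *: "i = j" if "i \<le> j" "j < a" "(y ^^ j) p \<in> cyc_support x ((y ^^ i) p)" for i j
    proof -
      have "(y ^^ i) ((y ^^ (j - i)) p) \<in> cyc_support x ((y ^^ i) p)"
        using that by (metis add_diff_inverse_nat comp_apply funpow_add not_le)
      then have "a dvd j - i" by (simp only: cyc_support_image[OF xB yB xy] dvd)
      then show ?thesis using that by (auto dest: dvd_imp_le)
    qed
    show ?thesis
      using *[of i j] *[of j i] that cyc_support_sym[OF xB that(3)] by (cases "i \<le> j") auto
  qed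
  have reduce: "cyc_support x ((y ^^ j) p) = cyc_support x ((y ^^ (j mod a)) p)" for j
  proof -
    have "(y ^^ (a * (j div a))) p \<in> cyc_support x p" by (simp add: dvd)
    from img[OF this, of "j mod a"] show ?thesis
      by (metis comp_apply funpow_add mod_mult_div_eq mult.commute add.commute)
  qed
  let ?O = "blk x y p"
  obtain T where T: "marking n x T" "\<forall>z\<in>complement n x T. \<omega> z = 1" using compl by blast
  \<comment> \<open>Inside the orbit the marked points are successive images of \<open>p\<close>
    under \<open>y\<close>, one on each of its \<open>a\<close> signed cycles; outside, the given
    marking is kept.\<close>
  define T' where "T' = (T - ?O) \<union> (\<lambda>i. (y ^^ i) p) ` {..<a}"
  have Opm: "?O \<subseteq> pm n" by (rule pr.blk_subset_pm[OF p])
  have yO: "(y ^^ i) p \<in> ?O" for i by (rule pr.blk_funpow(2)[OF blk_refl])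
  have mT': "marking n x T'"
    unfolding marking_def
  proof (intro conjI ballI)
    show "T' \<subseteq> pm n" using T(1) yO Opm by (auto simp: T'_def marking_def)
    fix v assume v: "v \<in> pm n"
    show "\<exists>!t. t \<in> T' \<and> t \<in> cyc_support x v"
    proof (cases "v \<in> ?O")
      case True
      then have S: "cyc_support x v \<subseteq> ?O" using pr.cyc_support_subset_blk(1) pr.blk_eq by blast
      obtain e i j where eij: "e \<in> {1,-1}" "v = e * (x ^^ i) ((y ^^ j) p)" using True by (rule blkE)
      have "v \<in> cyc_support x ((y ^^ j) p)" using eij cyc_supportI[OF xB] by metis
      then have vj: "cyc_support x v = cyc_support x ((y ^^ (j mod a)) p)"
        using reduce cyc_support_eq[OF xB] by metis
      have ja: "j mod a < a" using a by simp
      show ?thesis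
      proof (rule ex1I[of _ "(y ^^ (j mod a)) p"])
        show "(y ^^ (j mod a)) p \<in> T' \<and> (y ^^ (j mod a)) p \<in> cyc_support x v"
          using ja cyc_support_refl[OF xB] by (auto simp: T'_def vj)
        fix t assume t: "t \<in> T' \<and> t \<in> cyc_support x v"
        then obtain i where "i < a" "t = (y ^^ i) p" using S by (auto simp: T'_def)
        then show "t = (y ^^ (j mod a)) p" using distinct[OF _ ja] t by (auto simp: vj)
      qed
    next
      case False
      then have "cyc_support x v \<inter> ?O = {}"
        using pr.cyc_support_subset_blk(1)[of v] pr.blk_eq pr.blk_sym blk_refl by blast
      then have "t \<in> T' \<and> t \<in> cyc_support x v \<longleftrightarrow> t \<in> T \<and> t \<in> cyc_support x v" for t
        using yO by (auto simp: T'_def)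
      then show ?thesis using T(1) v by (simp add: marking_def)
    qed
  qed
  define b where "b = perm_restrict (y ^^ a) (cyc_support x p)"
  define yO where "yO = perm_restrict y ?O"
  define \<sigma> where "\<sigma> = Hilbert_Choice.inv b \<circ> yO"
  have bZ: "b \<in> centralizer (B_group n) x"
    unfolding b_def by (rule centralizer_restrict_cyc_support[OF xB centralizer_funpow[OF y]]) (use a in simp)
  have yOZ: "yO \<in> centralizer (B_group n) x"
    unfolding yO_def by (simp add: mem_centralizer pr.restrict_blk_commute)
  have bb: "bij b" using bZ B_bij by (auto simp: mem_centralizer)
  have invb: "Hilbert_Choice.inv b v = w" if "b w = v" for v w
    using bb that by (auto simp: bij_is_inj)
  have \<sigma>Z: "\<sigma> \<in> centralizer (B_group n) x"
    unfolding \<sigma>_def by (intro centralizer_comp centralizer_inv bZ yOZ)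
  have "\<sigma> t \<in> T'" if t: "t \<in> T'" for t
  proof (cases "t \<in> ?O")
    case False
    then have "yO t = t" "b t = t"
      using pr.cyc_support_subset_blk(1)[of p] by (auto simp: yO_def b_def perm_restrict_def)
    then show ?thesis using t invb[of t t] by (simp add: \<sigma>_def)
  next
    case True
    then obtain i where i: "i < a" "t = (y ^^ i) p" using t by (auto simp: T'_def)
    then have yt: "yO t = (y ^^ Suc i) p" using True by (simp add: yO_def perm_restrict_def)
    show ?thesis
    proof (cases "Suc i = a")
      case True
      \<comment> \<open>The last marked point is the only one that \<open>y\<close> moves out of the
        marking: it goes to \<open>y^a p = b p\<close>, and the inverse of \<open>b\<close> brings
        it back to \<open>p\<close>.\<close>
      then have "b p = yO t" using yt cyc_support_refl[OF xB] by (simp add: b_def perm_restrict_def)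
      from invb[OF this] have "\<sigma> t = p" by (simp add: \<sigma>_def)
      then show ?thesis using a by (auto simp: T'_def intro!: image_eqI[of _ _ 0])
    next
      case False
      then have "b (yO t) = yO t" using yt least[of "Suc i"] i by (simp add: b_def perm_restrict_def)
      from invb[OF this] have "\<sigma> t = (y ^^ Suc i) p" using yt by (simp add: \<sigma>_def)
      then show ?thesis using False i by (auto simp: T'_def intro!: image_eqI[of _ _ "Suc i"])
    qed
  qed
  moreover have "finite T'" using mT' finite_subset[OF _ finite_pm] by (auto simp: marking_def)
  moreover have "inj \<sigma>" using \<sigma>Z B_bij by (auto simp: mem_centralizer bij_is_inj)
  ultimately have "\<sigma> ` T' = T'"
    by (intro endo_inj_surj) (auto intro: inj_on_subset)
  then have "\<omega> \<sigma> = 1"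
    using complement_trivial_change[OF T mT'] \<sigma>Z by (simp add: complement_def)
  moreover have "yO = b \<circ> \<sigma>" using bb by (auto simp: \<sigma>_def fun_eq_iff bij_is_surj surj_f_inv_f)
  ultimately have "\<omega> yO = \<omega> b" using mult[OF bZ \<sigma>Z] by simp
  also have "\<dots> = lam x p ((y ^^ a) p)"
    unfolding b_def by (rule omega_restrict_cyc_support[OF p centralizer_funpow[OF y]]) (use a in simp)
  finally show ?thesis by (simp add: yO_def wt_def a_def)
qed

text \<open>Here \<open>P\<close> is any set of representatives of the orbits of \<open>\<langle>x, y, -1\<rangle>\<close>.\<close>

lemma omega_eq_prod_wt:
  assumes y: "y \<in> centralizer (B_group n) x"
    and P: "P \<subseteq> pm n" "\<And>v. v \<in> pm n \<Longrightarrow> \<exists>!p. p \<in> P \<and> p \<in> blk x y v"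
  shows "\<omega> y = (\<Prod>p\<in>P. wt x y p)"
proof -
  have yB: "y \<in> carrier (B_group n)" and xy: "x \<circ> y = y \<circ> x" using y by (auto simp: mem_centralizer)
  interpret pr: commuting_pair n x y by unfold_locales (use xB yB xy in auto)
  have fin: "finite P" using P(1) finite_subset[OF _ finite_pm] by blast
  have "perm_restrict y (\<Union>p\<in>Q. blk x y p) \<in> centralizer (B_group n) x \<and>
        \<omega> (perm_restrict y (\<Union>p\<in>Q. blk x y p)) = (\<Prod>p\<in>Q. wt x y p)" if "finite Q" "Q \<subseteq> P" for Q
    using that
  proof (induction Q)
    case empty
    have "perm_restrict y {} = id" by (auto simp: perm_restrict_def)
    then show ?case using one B_id by (simp only: UN_empty prod.empty mem_centralizer id_comp comp_id simp_thms)
  next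
    case (insert p Q)
    let ?R = "\<Union>p\<in>Q. blk x y p"
    have p: "p \<in> pm n" using insert P by auto
    have "q \<in> Q \<Longrightarrow> blk x y p \<inter> blk x y q = {}" for q
    proof (rule ccontr)
      assume q: "q \<in> Q" "blk x y p \<inter> blk x y q \<noteq> {}"
      then have "q \<in> blk x y p" using pr.blk_eq blk_refl by blast
      then show False using P(2)[OF p] q insert blk_refl by (metis insert_subset subsetD)
    qed
    then have disj: "blk x y p \<inter> ?R = {}" by blast
    have "perm_restrict y (\<Union>p\<in>insert p Q. blk x y p) = perm_restrict y (blk x y p) \<circ> perm_restrict y ?R"
    proof
      fix v
      have "y v \<in> ?R" if "v \<in> ?R" using that pr.blk_closed(2) by blast
      then show "perm_restrict y (\<Union>p\<in>insert p Q. blk x y p) v = (perm_restrict y (blk x y p) \<circ> perm_restrict y ?R) v"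
        using disj by (auto simp: perm_restrict_def)
    qed
    moreover have m: "perm_restrict y (blk x y p) \<in> centralizer (B_group n) x"
      by (simp add: mem_centralizer pr.restrict_blk_commute)
    moreover have R: "perm_restrict y ?R \<in> centralizer (B_group n) x" "\<omega> (perm_restrict y ?R) = (\<Prod>p\<in>Q. wt x y p)"
      using insert by auto
    ultimately show ?case
      using mult[OF m R(1)] centralizer_comp[OF m R(1)] omega_restrict_blk[OF p y] prod.insert[OF insert(1,2)] by metis
  qed
  from this[OF fin order.refl] have "\<omega> (perm_restrict y (\<Union>p\<in>P. blk x y p)) = (\<Prod>p\<in>P. wt x y p)" by simp
  moreover have "perm_restrict y (\<Union>p\<in>P. blk x y p) = y"
  proof
    fix v
    show "perm_restrict y (\<Union>p\<in>P. blk x y p) v = y v"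
    proof (cases "v \<in> pm n")
      case True
      then obtain p where "p \<in> P" "p \<in> blk x y v" using P(2) by blast
      then show ?thesis using pr.blk_sym by (auto simp: perm_restrict_def)
    qed (auto simp: perm_restrict_def B_fixes[OF yB])
  qed
  ultimately show ?thesis by simp
qed

end

section \<open>Independence of the choice of faithful characters\<close>

text \<open>It makes the period a function of the orbit, so elements with the same orbits have the
  same periods.\<close>

lemma per_eq_card_orbit:
  assumes x: "x \<in> carrier (B_group n)"
  shows "per x p = card (orbit x p)"
proof -
  have "orbit x p = (\<lambda>m. (x ^^ m) p) ` {..<per x p}"
    using orbit_altdef_bounded[OF funpow_per[OF x] per_pos[OF x], of p] by auto
  moreover have "inj_on (\<lambda>m. (x ^^ m) p) {..<per x p}"
    by (rule inj_onI) (auto simp: funpow_eq_iff_cong[OF x] cong_def)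
  ultimately show ?thesis by (simp add: card_image)
qed

lemma signed_funpow_eq_iff:
  assumes x: "x \<in> carrier (B_group n)" and p: "p \<in> pm n" and e: "e \<in> {1,-1}" "d \<in> {1,-1}"
  shows "e * (x ^^ i) p = d * (x ^^ j) p \<longleftrightarrow>
    (e = d \<and> zeta (per x p) i = zeta (per x p) j \<or>
     e \<noteq> d \<and> - p \<in> orbit x p \<and> zeta (per x p) i = - zeta (per x p) j)"
proof (cases "e = d")
  case True
  then show ?thesis using e by (auto simp: zeta_per_eq_iff[OF x])
next
  case False
  then have "e * (x ^^ i) p = d * (x ^^ j) p \<longleftrightarrow> (x ^^ i) p = - (x ^^ j) p" using e by auto
  then show ?thesis using False by (simp add: funpow_eq_minus_funpow_iff[OF x p])
qed

lemma cyc_support_eq_of_orbit_eq: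
  assumes "\<And>v. v \<in> pm n \<Longrightarrow> orbit x' v = orbit x v" "a \<in> pm n"
  shows "cyc_support x' a = cyc_support x a"
  using assms by (simp add: cyc_support_def)

text \<open>The conjugating element sends \<open>\<plusminus>x^j t\<close> to \<open>\<plusminus>x'^j t\<close> for each marked point \<open>t\<close>.\<close>

lemma conjugate_of_orbit_eq:
  assumes x: "x \<in> carrier (B_group n)" and x': "x' \<in> carrier (B_group n)"
    and orb: "\<And>v. v \<in> pm n \<Longrightarrow> orbit x' v = orbit x v"
    and T: "marking n x T"
  shows "\<exists>g\<in>carrier (B_group n). g \<circ> x = x' \<circ> g"
proof -
  have Tpm: "t \<in> pm n" if "t \<in> T" for t using T that by (auto simp: marking_def)
  \<comment> \<open>The relation is stated for both orders of the two maps: its uniqueness from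
    \<open>x\<close> to \<open>x'\<close> makes \<open>g\<close> well defined, and from
    \<open>x'\<close> to \<open>x\<close> it makes \<open>g\<close> injective.\<close>
  define R where "R a b v w \<longleftrightarrow> (\<exists>e j t. e \<in> {1,-1} \<and> t \<in> T \<and> v = e * (a ^^ j) t \<and> w = e * (b ^^ j) t)"
    for a b :: "int \<Rightarrow> int" and v w
  have ex: "\<exists>w. R x x' v w" if v: "v \<in> pm n" for v
  proof -
    obtain t where t: "t \<in> T" "t \<in> cyc_support x v" using T v unfolding marking_def by metis
    then have "v \<in> cyc_support x t" using cyc_support_sym[OF x] by blast
    then obtain e j where "e \<in> {1,-1}" "v = e * (x ^^ j) t" by (rule mem_cyc_supportE[OF x])
    then show ?thesis using t(1) unfolding R_def by blast
  qed
  have unique: "w = w'" if a: "a \<in> carrier (B_group n)" and b: "b \<in> carrier (B_group n)"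
      and ab: "\<And>v. v \<in> pm n \<Longrightarrow> orbit b v = orbit a v" and Ta: "marking n a T"
      and R: "R a b v w" "R a b v w'" for a b v w w'
  proof -
    obtain e j t where 1: "e \<in> {1,-1}" "t \<in> T" "v = e * (a ^^ j) t" "w = e * (b ^^ j) t"
      using R(1) unfolding R_def by (elim exE conjE) (rule that)
    obtain d i s where 2: "d \<in> {1,-1}" "s \<in> T" "v = d * (a ^^ i) s" "w' = d * (b ^^ i) s"
      using R(2) unfolding R_def by (elim exE conjE) (rule that)
    have "v \<in> cyc_support a t" "v \<in> cyc_support a s" using 1 2 cyc_supportI[OF a] by metis+
    then have "s \<in> cyc_support a t" "t \<in> cyc_support a t"
      using cyc_support_sym[OF a] cyc_support_trans[OF a] cyc_support_refl[OF a] by meson+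
    then have st: "s = t" using Ta Tpm[OF 1(2)] 1(2) 2(2) unfolding marking_def by metis
    have t: "t \<in> pm n" using Tpm 1(2) by blast
    have "per b t = per a t" using ab[OF t] by (simp add: per_eq_card_orbit[OF a] per_eq_card_orbit[OF b])
    moreover have "e * (a ^^ j) t = d * (a ^^ i) t" using 1 2 st by simp
    ultimately have "e * (b ^^ j) t = d * (b ^^ i) t"
      unfolding signed_funpow_eq_iff[OF a t 1(1) 2(1)] signed_funpow_eq_iff[OF b t 1(1) 2(1)] ab[OF t] by simp
    then show ?thesis using 1 2 st by simp
  qed
  have cs: "cyc_support x' v = cyc_support x v" if "v \<in> pm n" for v
    using cyc_support_eq_of_orbit_eq[OF orb that] .
  have T': "marking n x' T" using T by (simp add: marking_def cs)
  obtain g0 where g0: "\<And>v. v \<in> pm n \<Longrightarrow> R x x' v (g0 v)" using ex by metis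
  define g where "g v = (if v \<in> pm n then g0 v else v)" for v
  have R: "R x x' v (g v)" if "v \<in> pm n" for v using g0 that by (simp add: g_def)
  have mem: "g v \<in> pm n" if v: "v \<in> pm n" for v
  proof -
    obtain e j t where 1: "e \<in> {1,-1}" "t \<in> T" "g v = e * (x' ^^ j) t"
      using R[OF v] unfolding R_def by (elim exE conjE) (rule that)
    then show ?thesis using Tpm[of t] by (auto simp: B_mem_pm[OF B_funpow[OF x']])
  qed
  have "inj_on g (pm n)"
  proof (rule inj_onI)
    fix v w assume vw: "v \<in> pm n" "w \<in> pm n" "g v = g w"
    then have "R x' x (g v) v" "R x' x (g v) w"
      using R[OF vw(1)] R[OF vw(2)] unfolding R_def by (simp_all only:) blast+
    then show "v = w" using unique[OF x' x orb[symmetric] T'] by blast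
  qed
  moreover have "g ` pm n \<subseteq> pm n" using mem by blast
  ultimately have "bij_betw g (pm n) (pm n)" by (simp add: bij_betw_def endo_inj_surj)
  then have "g permutes pm n" by (rule bij_imp_permutes) (simp add: g_def)
  moreover have "g (- v) = - g v" for v
  proof (cases "v \<in> pm n")
    case True
    obtain e j t where 1: "e \<in> {1,-1}" "t \<in> T" "v = e * (x ^^ j) t" "g v = e * (x' ^^ j) t"
      using R[OF True] unfolding R_def by (elim exE conjE) (rule that)
    have "- e \<in> {1,-1}" "- v = (- e) * (x ^^ j) t" "- g v = (- e) * (x' ^^ j) t" using 1 by auto
    then have "R x x' (- v) (- g v)" unfolding R_def using 1(2) by blast
    moreover have "R x x' (- v) (g (- v))" using R True by simp
    ultimately show ?thesis using unique[OF x x' orb T] by blast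
  qed (simp add: g_def)
  ultimately have gB: "g \<in> carrier (B_group n)" by (simp add: B_carrier_iff)
  have "g (x v) = x' (g v)" for v
  proof (cases "v \<in> pm n")
    case True
    obtain e j t where 1: "e \<in> {1,-1}" "t \<in> T" "v = e * (x ^^ j) t" "g v = e * (x' ^^ j) t"
      using R[OF True] unfolding R_def by (elim exE conjE) (rule that)
    have "x v = e * (x ^^ Suc j) t" "x' (g v) = e * (x' ^^ Suc j) t"
      using 1 by (simp_all only: B_sign[OF x] B_sign[OF x'] funpow.simps comp_apply)
    then have "R x x' (x v) (x' (g v))" unfolding R_def using 1 by blast
    moreover have "R x x' (x v) (g (x v))" using R True by (simp add: B_mem_pm[OF x])
    ultimately show ?thesis using unique[OF x x' orb T] by blast
  next
    case False
    then show ?thesis using B_fixes[OF x] B_fixes[OF x'] by (simp add: g_def)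
  qed
  then show ?thesis using gB by (intro bexI[of _ g]) auto
qed

text \<open>It turns an inclusion between the centralizers of two conjugate elements into an
  equality.\<close>

lemma card_centralizer_conj:
  assumes g: "g \<in> carrier (B_group n)" "g \<circ> x = x' \<circ> g"
  shows "card (centralizer (B_group n) x) = card (centralizer (B_group n) x')"
proof (rule bij_betw_same_card)
  let ?h = "Hilbert_Choice.inv g"
  have bg: "bij g" by (rule B_bij[OF g(1)])
  have gh: "g (?h v) = v" "?h (g v) = v" for v
    using bg by (simp_all add: bij_is_surj surj_f_inv_f bij_is_inj)
  have gx: "g (x v) = x' (g v)" "?h (x' v) = x (?h v)" for v
    using g(2) gh by (metis comp_apply)+
  show "bij_betw (\<lambda>z. g \<circ> z \<circ> ?h) (centralizer (B_group n) x) (centralizer (B_group n) x')"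
  proof (rule bij_betw_byWitness[where f' = "\<lambda>z. ?h \<circ> z \<circ> g"])
    show "(\<lambda>z. g \<circ> z \<circ> ?h) ` centralizer (B_group n) x \<subseteq> centralizer (B_group n) x'"
      by (auto simp: mem_centralizer B_comp g B_inv_mem fun_eq_iff gx(2)) (simp add: gx(1))
    show "(\<lambda>z. ?h \<circ> z \<circ> g) ` centralizer (B_group n) x' \<subseteq> centralizer (B_group n) x"
      by (auto simp: mem_centralizer B_comp g B_inv_mem fun_eq_iff gx(1)) (simp add: gx(2))
  qed (auto simp: fun_eq_iff gh)
qed

lemma per_cyc_support:
  assumes x: "x \<in> carrier (B_group n)" and w: "w \<in> cyc_support x v"
  shows "per x w = per x v"
proof -
  obtain e i where e: "e \<in> {1,-1}" "w = e * (x ^^ i) v" using w by (rule mem_cyc_supportE[OF x])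
  have "(x ^^ j) w = e * (x ^^ i) ((x ^^ j) v)" for j
    using e funpow_commute[of x x j i] by (simp only: B_sign[OF B_funpow[OF x]])
  then have "(x ^^ j) w = w \<longleftrightarrow> (x ^^ j) v = v" for j
    using e inj_eq[OF bij_is_inj[OF B_bij[OF B_funpow[OF x]]]] by auto
  then show ?thesis by (simp add: per_def)
qed

text \<open>
  The choice of faithful characters is absorbed by replacing \<open>x\<close> by a suitable power of \<open>x\<close> on each signed cycle,
  which changes neither the conjugacy class nor the centralizer.
\<close>

lemma is_omega_normalize:
  assumes x: "x \<in> carrier (B_group n)" and om: "is_omega n x \<omega>"
  obtains x' g where "normalized_omega n x' \<omega>" "centralizer (B_group n) x' = centralizer (B_group n) x"
    "g \<in> carrier (B_group n)" "g \<circ> x = x' \<circ> g"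
proof -
  interpret om: omega n x \<omega>
    by unfold_locales (use x om in \<open>auto simp: is_omega_def\<close>)
  obtain T where T: "marking n x T" "\<forall>z\<in>complement n x T. \<omega> z = 1" using om by (auto simp: is_omega_def)
  define \<theta> where "\<theta> a = \<omega> (signed_cycle x a)" for a
  \<comment> \<open>The exponent is a function of the value and of the period alone. Points related
    by the centralizer of \<open>x\<close> share both and get the same exponent, which makes the
    modified element commute with the whole centralizer.\<close>
  define V where "V z L = (SOME v. coprime v L \<and> z ^ v = zeta L 1)" for z L
  have V: "coprime (V (\<theta> a) (per x a)) (per x a) \<and> \<theta> a ^ V (\<theta> a) (per x a) = zeta (per x a) 1"
    if a: "a \<in> pm n" for a
  proof -
    let ?L = "per x a"
    have L: "?L > 0" by (rule per_pos[OF x])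
    have gen: "signed_cycle x a ^^ i \<in> generate (B_group n) {signed_cycle x a}" for i
    proof (induction i)
      case 0
      show ?case using generate.one[of "B_group n" "{signed_cycle x a}"] by (simp only: funpow.simps B_simps)
    next
      case (Suc i)
      have "signed_cycle x a \<in> generate (B_group n) {signed_cycle x a}" by (rule generate.incl) simp
      from generate.eng[OF this Suc] show ?case by (simp only: funpow.simps B_simps)
    qed
    \<comment> \<open>Faithfulness makes \<open>\<theta> a\<close> a primitive root of unity of
      order \<open>?L\<close>, so its exponent \<open>w\<close> is a unit modulo \<open>?L\<close>
      and some coprime power of it is the standard root.\<close>
    have prim: "\<theta> a ^ i = 1 \<longleftrightarrow> ?L dvd i" for i
    proof
      assume "\<theta> a ^ i = 1"
      then have "\<omega> (signed_cycle x a ^^ i) = \<omega> (signed_cycle x a ^^ 0)"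
        by (simp only: om.power[OF om.signed_cycle_mem] \<theta>_def power_0)
      then have "signed_cycle x a ^^ i = signed_cycle x a ^^ 0"
        using om a gen unfolding is_omega_def inj_on_def by metis
      then have "(signed_cycle x a ^^ i) a = a" by simp
      then show "?L dvd i"
        by (simp add: om.funpow_signed_cycle cyc_support_refl[OF x] funpow_eq_iff_dvd[OF x])
    next
      assume L: "?L dvd i"
      have "signed_cycle x a ^^ i = id"
        using L by (auto simp: fun_eq_iff om.funpow_signed_cycle funpow_eq_iff_dvd[OF x] per_cyc_support[OF x])
      then show "\<theta> a ^ i = 1"
        using om.power[OF om.signed_cycle_mem[of a], of i] om.one by (simp add: \<theta>_def)
    qed
    obtain w where w: "\<theta> a = zeta ?L w" using root_of_unity_is_zeta[OF L] prim[of ?L] by auto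
    define g where "g = gcd w ?L"
    have g: "g > 0" "?L div g * g = ?L" "w div g * g = w" using L by (auto simp: g_def)
    have "?L dvd w * (?L div g)"
      using g by (metis dvd_triv_right mult.assoc mult.commute)
    then have "\<theta> a ^ (?L div g) = 1" using L by (simp add: w zeta_power zeta_eq_1_iff)
    then have "?L dvd ?L div g" using prim by simp
    then have "g = 1" using g L by (metis dvd_imp_le div_by_1 div_less_dividend dvd_mult_div_cancel
      gcd_dvd2 g_def le_neq_implies_less less_one linorder_not_le nat_neq_iff dvd_div_eq_0_iff neq0_conv)
    then have "coprime w ?L" by (simp add: g_def coprime_iff_gcd_eq_1)
    then obtain v where v: "[w * v = 1] (mod ?L)" by (metis coprime_iff_invertible_nat One_nat_def)
    have "coprime v ?L \<and> \<theta> a ^ v = zeta ?L 1"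
      using cong_mult_1_imp_coprime[OF v] v L by (simp add: w zeta_power zeta_eq_iff)
    then show ?thesis unfolding V_def by (rule someI)
  qed
  define I where "I v = V (\<theta> v) (per x v)" for v
  define x' where "x' = piecewise n x (\<lambda>_. 1) I"
  have I: "I w = I v" if "w \<in> cyc_support x v" for v w
    using cyc_support_eq[OF x that] per_cyc_support[OF x that] by (simp add: I_def \<theta>_def signed_cycle_def)
  have x'B: "x' \<in> carrier (B_group n)"
    unfolding x'_def by (rule piecewise_mem_B[OF x]) (use I in auto)
  have pow: "(x' ^^ i) v = (x ^^ (i * I v)) v" if v: "v \<in> pm n" for i v
  proof (induction i)
    case (Suc i)
    let ?w = "(x ^^ (i * I v)) v"
    have "?w \<in> cyc_support x v" using cyc_supportI[OF x, of 1 "i * I v" v] by simp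
    moreover have "?w \<in> pm n" using v by (simp add: B_mem_pm[OF B_funpow[OF x]])
    ultimately have "x' ?w = (x ^^ I v) ?w" using I by (simp add: x'_def piecewise_def)
    then show ?case using Suc by (simp add: funpow_add)
  qed simp
  \<comment> \<open>The exponent is a unit modulo the period, so along the cycle \<open>x\<close> is
    in turn a power of \<open>x'\<close>.\<close>
  have orb: "orbit x' v = orbit x v" if v: "v \<in> pm n" for v
  proof -
    have "coprime (I v) (per x v)" using V[OF v] by (simp add: I_def)
    then obtain u where u: "[I v * u = 1] (mod per x v)" by (metis coprime_iff_invertible_nat One_nat_def)
    have "(x ^^ i) v = (x' ^^ (i * u)) v" for i
    proof -
      have "[i * (I v * u) = i * 1] (mod per x v)" using u by (rule cong_scalar_left)
      then have "(x ^^ (i * (I v * u))) v = (x ^^ i) v" by (simp add: funpow_eq_iff_cong[OF x])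
      then show ?thesis using pow[OF v, of "i * u"] by (simp add: mult_ac)
    qed
    then show ?thesis using pow[OF v] unfolding set_eq_iff mem_orbit_iff[OF x] mem_orbit_iff[OF x'B] by metis
  qed
  obtain g where g: "g \<in> carrier (B_group n)" "g \<circ> x = x' \<circ> g"
    using conjugate_of_orbit_eq[OF x x'B orb T(1)] by blast
  have "centralizer (B_group n) x \<subseteq> centralizer (B_group n) x'"
  proof
    fix z assume z: "z \<in> centralizer (B_group n) x"
    then have zB: "z \<in> carrier (B_group n)" "z \<circ> x = x \<circ> z" by (auto simp: mem_centralizer)
    have supp: "z w \<in> cyc_support x (z v) \<longleftrightarrow> w \<in> cyc_support x v" for v w
      using cyc_support_image[OF x zB(1) zB(2)[symmetric], of 1] by simp
    have "z \<circ> signed_cycle x v = signed_cycle x (z v) \<circ> z" for v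
    proof
      fix w
      have "z (x w) = x (z w)" using zB(2) by (metis comp_apply)
      then show "(z \<circ> signed_cycle x v) w = (signed_cycle x (z v) \<circ> z) w"
        by (simp add: signed_cycle_def perm_restrict_def supp)
    qed
    then have 1: "\<theta> (z v) = \<theta> v" for v
      using om.conj[OF z om.signed_cycle_mem om.signed_cycle_mem] unfolding \<theta>_def by metis
    have "(x ^^ j) (z v) = z v \<longleftrightarrow> (x ^^ j) v = v" for j v
    proof -
      have "(x ^^ j) (z v) = z ((x ^^ j) v)" using funpow_commute[OF zB(2), of 1 j v] by simp
      then show ?thesis by (simp only: inj_eq[OF bij_is_inj[OF B_bij[OF zB(1)]]])
    qed
    then have "per x (z v) = per x v" for v by (simp add: per_def)
    then have "I (z v) = I v" for v using 1 by (simp add: I_def)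
    then have "x' \<circ> z = z \<circ> x'"
      unfolding x'_def by (intro piecewise_commute[OF x zB]) auto
    then show "z \<in> centralizer (B_group n) x'" using zB by (simp add: mem_centralizer)
  qed
  moreover have "finite (centralizer (B_group n) x')"
    using finite_B by (simp add: centralizer_def)
  ultimately have Z: "centralizer (B_group n) x' = centralizer (B_group n) x"
    using card_centralizer_conj[OF g] card_subset_eq by metis
  have cs: "cyc_support x' v = cyc_support x v" if "v \<in> pm n" for v
    using cyc_support_eq_of_orbit_eq[OF orb that] .
  have "normalized_omega n x' \<omega>"
  proof unfold_locales
    show "linear_character_on (B_group n) (centralizer (B_group n) x') \<omega>" using om.chi Z by simp
    fix a assume a: "a \<in> pm n"
    show "\<omega> (cyc_negation x' a) = 1" if "- a \<notin> orbit x' a"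
    proof -
      have "cyc_class x a = 1" using that orb[OF a] by (simp add: cyc_class_eq_1_iff[OF x])
      then have "\<omega> (cyc_negation x a) = 1" using om a by (auto simp: is_omega_def)
      then show ?thesis by (simp add: cyc_negation_def cs[OF a])
    qed
    have "signed_cycle x' a = signed_cycle x a ^^ I a"
    proof
      fix v
      have "x' v = (x ^^ I a) v" if "v \<in> cyc_support x a"
        using that I[OF that] cyc_support_subset_pm[OF x a] by (auto simp: x'_def piecewise_def)
      then show "signed_cycle x' a v = (signed_cycle x a ^^ I a) v"
        unfolding om.funpow_signed_cycle unfolding signed_cycle_def perm_restrict_def cs[OF a] by simp
    qed
    moreover have "per x' a = per x a"
      by (simp add: per_eq_card_orbit[OF x] per_eq_card_orbit[OF x'B] orb[OF a])
    ultimately show "\<omega> (signed_cycle x' a) = zeta (per x' a) 1"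
      using V[OF a] by (simp add: om.power[OF om.signed_cycle_mem] \<theta>_def[symmetric] I_def)
  next
    show "\<exists>T. marking n x' T \<and> (\<forall>z\<in>complement n x' T. \<omega> z = 1)"
      using T by (auto simp: marking_def complement_def cs Z)
  qed (rule x'B)
  then show ?thesis using that Z g by blast
qed

section \<open>Exchanging local factors\<close>

text \<open>The maximum depends on the orbit alone, so modifying \<open>x\<close> without changing
  the orbits keeps the same representatives.\<close>

definition reps :: "nat \<Rightarrow> (int \<Rightarrow> int) \<Rightarrow> (int \<Rightarrow> int) \<Rightarrow> int set" where
  "reps n x y = {p \<in> pm n. p = Max (blk x y p)}"

lemma (in commuting_pair) reps_transversal:
  assumes v: "v \<in> pm n"
  shows "\<exists>!p. p \<in> reps n x y \<and> p \<in> blk x y v"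
proof (rule ex1I[of _ "Max (blk x y v)"])
  have "finite (blk x y v)" using blk_subset_pm[OF v] finite_subset finite_pm by blast
  then have M: "Max (blk x y v) \<in> blk x y v" using blk_refl[of v x y] by (intro Max_in) auto
  then show "Max (blk x y v) \<in> reps n x y \<and> Max (blk x y v) \<in> blk x y v"
    using blk_eq[OF M] blk_subset_pm[OF v] by (auto simp: reps_def)
  fix p assume "p \<in> reps n x y \<and> p \<in> blk x y v"
  then show "p = Max (blk x y v)" using blk_eq[of p v] by (auto simp: reps_def)
qed

lemma finite_reps [simp]: "finite (reps n x y)"
  by (simp add: reps_def)

text \<open>The pairs with \<open>s < 2\<close> and \<open>r < per y p\<close> list the elements of
  \<open><y, -1>\<close> on this signed cycle, once each in class +1 and twice each in class -1; a
  uniform multiplicity does not disturb averages.\<close>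

definition twist :: "nat \<Rightarrow> (int \<Rightarrow> int) \<Rightarrow> int \<Rightarrow> nat \<Rightarrow> nat \<Rightarrow> int \<Rightarrow> int" where
  "twist n y p s r = piecewise n y (\<lambda>v. if v \<in> cyc_support y p then (- 1) ^ s else 1)
     (\<lambda>v. if v \<in> cyc_support y p then r else 0)"

lemma sign_power_mem: "(- 1 :: int) ^ s \<in> {1, - 1}"
  by (cases "even s") auto

lemma twist_sign: "(if P then (- 1) ^ s else (1::int)) \<in> {1, - 1}"
  using sign_power_mem by auto

lemma twist_mem:
  assumes y: "y \<in> carrier (B_group n)"
  shows "twist n y p s r \<in> centralizer (B_group n) y"
proof -
  have c: "w \<in> cyc_support y p \<longleftrightarrow> v \<in> cyc_support y p" if "w \<in> cyc_support y v" for v w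
    using that cyc_support_trans[OF y] cyc_support_sym[OF y] by meson
  show ?thesis
    unfolding mem_centralizer twist_def
  proof
    show "piecewise n y (\<lambda>v. if v \<in> cyc_support y p then (- 1) ^ s else 1)
      (\<lambda>v. if v \<in> cyc_support y p then r else 0) \<in> carrier (B_group n)"
      by (rule piecewise_mem_B[OF y twist_sign]) (use c in auto)
    show "piecewise n y (\<lambda>v. if v \<in> cyc_support y p then (- 1) ^ s else 1)
        (\<lambda>v. if v \<in> cyc_support y p then r else 0) \<circ> y =
      y \<circ> piecewise n y (\<lambda>v. if v \<in> cyc_support y p then (- 1) ^ s else 1)
        (\<lambda>v. if v \<in> cyc_support y p then r else 0)"
      by (rule piecewise_commute[OF y y refl twist_sign]) (use c[OF cyc_support_step[OF y]] in auto)
  qed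
qed

lemma twist_mem_cyc_support:
  "y \<in> carrier (B_group n) \<Longrightarrow> twist n y p s r v \<in> cyc_support y v"
  unfolding twist_def by (rule piecewise_mem_cyc_support[OF _ twist_sign])

lemma twist_apply:
  assumes "y \<in> carrier (B_group n)" "p \<in> pm n"
  shows "twist n y p s r v = (if v \<in> cyc_support y p then (- 1) ^ s * (y ^^ r) v else v)"
  using cyc_support_subset_pm[OF assms] by (auto simp: twist_def piecewise_def)

text \<open>The twist moves points only within signed \<open>y\<close>-cycles, which lie inside the
  orbits of \<open><x, y, -1>\<close>; the reverse inclusion recovers \<open>x\<close> by undoing
  the twist.\<close>

lemma (in commuting_pair) twist_comp:
  shows "commuting_pair n (x \<circ> twist n y p s r) y"
    and "blk (x \<circ> twist n y p s r) y q = blk x y q"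
proof -
  let ?t = "twist n y p s r"
  let ?x' = "x \<circ> ?t"
  have t: "?t \<in> carrier (B_group n)" "?t \<circ> y = y \<circ> ?t"
    using twist_mem[OF y] by (auto simp: mem_centralizer)
  have "?x' \<circ> y = y \<circ> ?x'" using t(2) xy by (metis comp_assoc)
  then show pr: "commuting_pair n ?x' y"
    by unfold_locales (use x y t B_comp in auto)
  interpret x': commuting_pair n ?x' y by (rule pr)
  have tb: "?t v \<in> blk a y v" if "commuting_pair n a y" for v a
    using twist_mem_cyc_support[OF y] commuting_pair.cyc_support_subset_blk(2)[OF that] by blast
  show "blk ?x' y q = blk x y q"
  proof (rule subset_antisym; rule blk_least)
    fix v assume v: "v \<in> blk x y q"
    then have "?t v \<in> blk x y q" using tb[OF commuting_pair_axioms, of v] blk_eq by blast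
    then show "?x' v \<in> blk x y q" using blk_closed(1) by simp
  next
    fix v assume v: "v \<in> blk ?x' y q"
    let ?w = "Hilbert_Choice.inv ?t v"
    have w: "?t ?w = v" using B_bij[OF t(1)] by (simp add: bij_is_surj surj_f_inv_f)
    then have "v \<in> blk ?x' y ?w" using tb[OF pr, of ?w] by simp
    then have "blk ?x' y ?w = blk ?x' y q" using x'.blk_eq v by blast
    then have "?w \<in> blk ?x' y q" using blk_refl by blast
    from x'.blk_closed(1)[OF this] show "x v \<in> blk ?x' y q" using w by simp
  qed (auto simp: blk_refl blk_closed x'.blk_closed)
qed

text \<open>
  An averaging argument: right multiplication of \<open>x\<close> by the elements of \<open>\<langle>y, -1\<rangle>\<close> restricted to the signed
  \<open>y\<close>-cycle of \<open>p\<close> permutes the centralizer of \<open>y\<close> and affects only the orbit of \<open>p\<close>, so the local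
  factors can be exchanged one orbit at a time.
\<close>

lemma sum_prod_reps_exchange:
  fixes \<phi> \<psi> :: "(int \<Rightarrow> int) \<Rightarrow> int \<Rightarrow> complex"
  assumes y: "y \<in> carrier (B_group n)"
    and loc\<phi>: "\<And>x x' p. x \<in> carrier (B_group n) \<Longrightarrow> x' \<in> carrier (B_group n) \<Longrightarrow>
      (\<And>i. (x' ^^ i) p = (x ^^ i) p) \<Longrightarrow> \<phi> x' p = \<phi> x p"
    and loc\<psi>: "\<And>x x' p. x \<in> carrier (B_group n) \<Longrightarrow> x' \<in> carrier (B_group n) \<Longrightarrow>
      (\<And>i. (x' ^^ i) p = (x ^^ i) p) \<Longrightarrow> \<psi> x' p = \<psi> x p"
    and avg: "\<And>x p. x \<in> centralizer (B_group n) y \<Longrightarrow> p \<in> pm n \<Longrightarrow>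
      (\<Sum>s<2. \<Sum>r<per y p. \<phi> (x \<circ> twist n y p s r) p) = (\<Sum>s<2. \<Sum>r<per y p. \<psi> (x \<circ> twist n y p s r) p)"
  shows "(\<Sum>x\<in>centralizer (B_group n) y. \<Prod>p\<in>reps n x y. \<phi> x p) =
         (\<Sum>x\<in>centralizer (B_group n) y. \<Prod>p\<in>reps n x y. \<psi> x p)"
proof -
  define Z where "Z = centralizer (B_group n) y"
  have finZ: "finite Z" using finite_B by (simp add: Z_def centralizer_def)
  \<comment> \<open>An interpolation between the two products: representatives in \<open>Q\<close>
    already carry \<open>\<psi>\<close>, the others still \<open>\<phi>\<close>. Each step enlarges
    \<open>Q\<close> by one point and changes at most one factor.\<close>
  define h where "h Q x p = (if p \<in> Q then \<psi> x p else \<phi> x p)" for Q x p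
  have step: "(\<Sum>x\<in>Z. \<Prod>q\<in>reps n x y. h Q x q) = (\<Sum>x\<in>Z. \<Prod>q\<in>reps n x y. h (insert p Q) x q)"
    if p: "p \<in> pm n" "p \<notin> Q" for p Q
  proof -
    define t where "t i = twist n y p (fst i) (snd i)" for i
    define I where "I = {..<2::nat} \<times> {..<per y p}"
    have tZ: "t i \<in> Z" for i using twist_mem[OF y] by (simp add: t_def Z_def)
    have shift: "(\<Sum>x\<in>Z. F x) = (\<Sum>x\<in>Z. F (x \<circ> t i))" for F :: "_ \<Rightarrow> complex" and i
    proof -
      have "inj_on (\<lambda>x. x \<circ> t i) Z"
      proof (rule inj_onI)
        fix a b assume "a \<circ> t i = b \<circ> t i"
        moreover have "surj (t i)" using tZ[of i] B_bij by (auto simp: Z_def mem_centralizer bij_is_surj)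
        ultimately show "a = b" by (metis fun.map_comp o_inv_distrib comp_assoc surj_iff comp_id)
      qed
      moreover have "(\<lambda>x. x \<circ> t i) ` Z \<subseteq> Z"
        using centralizer_comp[OF _ tZ[of i, unfolded Z_def]] by (auto simp: Z_def)
      ultimately have "bij_betw (\<lambda>x. x \<circ> t i) Z Z"
        using finZ by (simp add: bij_betw_def endo_inj_surj)
      then show ?thesis by (simp add: sum.reindex_bij_betw[of _ Z Z F, symmetric])
    qed
    have local_step: "(\<Sum>i\<in>I. \<Prod>q\<in>reps n (x \<circ> t i) y. h Q (x \<circ> t i) q) =
        (\<Sum>i\<in>I. \<Prod>q\<in>reps n (x \<circ> t i) y. h (insert p Q) (x \<circ> t i) q)" if x: "x \<in> Z" for x
    proof -
      interpret pr: commuting_pair n x y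
        by unfold_locales (use x y in \<open>auto simp: Z_def mem_centralizer\<close>)
      have reps: "reps n (x \<circ> t i) y = reps n x y" for i
        by (simp add: reps_def t_def pr.twist_comp(2))
      show ?thesis
      proof (cases "p \<in> reps n x y")
        case False
        then have "h (insert p Q) (x \<circ> t i) q = h Q (x \<circ> t i) q" if "q \<in> reps n x y" for i q
          using that by (auto simp: h_def)
        then show ?thesis by (simp add: reps)
      next
        case True
        let ?R = "reps n x y - {p}"
        have other: "h Q' (x \<circ> t i) q = h Q' x q" if q: "q \<in> ?R" for i q Q'
        proof -
          have "cyc_support y p \<inter> blk x y q = {}"
          proof (rule ccontr)
            assume "cyc_support y p \<inter> blk x y q \<noteq> {}"
            then have "blk x y p = blk x y q"
              using pr.cyc_support_subset_blk(2)[of p] pr.blk_eq by blast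
            then have "p = q" using True q by (auto simp: reps_def)
            then show False using q by simp
          qed
          then have tfix: "t i v = v" if "v \<in> blk x y q" for v
            using that by (auto simp: t_def twist_apply[OF y p(1)])
          have "((x \<circ> t i) ^^ j) q = (x ^^ j) q" for j
          proof (induction j)
            case (Suc j)
            then show ?case using tfix[OF pr.blk_funpow(1)[OF blk_refl]] by simp
          qed simp
          moreover have "x \<circ> t i \<in> carrier (B_group n)"
            using pr.twist_comp(1) by (simp add: t_def commuting_pair_def)
          ultimately show ?thesis unfolding h_def using loc\<phi>[OF pr.x] loc\<psi>[OF pr.x] by simp
        qed
        have split: "(\<Prod>q\<in>reps n (x \<circ> t i) y. h Q' (x \<circ> t i) q) = h Q' (x \<circ> t i) p * (\<Prod>q\<in>?R. h Q' x q)" for i Q'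
          using prod.remove[OF finite_reps True, of "h Q' (x \<circ> t i)"] other by (simp add: reps)
        have R: "(\<Prod>q\<in>?R. h (insert p Q) x q) = (\<Prod>q\<in>?R. h Q x q)"
          by (rule prod.cong) (auto simp: h_def)
        have "(\<Sum>i\<in>I. \<phi> (x \<circ> t i) p) = (\<Sum>i\<in>I. \<psi> (x \<circ> t i) p)"
          using avg[of x p] x p(1) by (simp add: I_def t_def Z_def sum.cartesian_product case_prod_beta)
        then show ?thesis
          unfolding split R sum_distrib_right[symmetric] using p(2) by (simp add: h_def)
      qed
    qed
    \<comment> \<open>Every right translate of the sum over \<open>Z\<close> is the same sum, so
      multiplying it by \<open>card I\<close> amounts to summing over all twists at
      \<open>p\<close>.\<close>
    have "of_nat (card I) * (\<Sum>x\<in>Z. \<Prod>q\<in>reps n x y. h Q x q)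
        = of_nat (card I) * (\<Sum>x\<in>Z. \<Prod>q\<in>reps n x y. h (insert p Q) x q)"
    proof -
      have *: "of_nat (card I) * (\<Sum>x\<in>Z. F x) = (\<Sum>x\<in>Z. \<Sum>i\<in>I. F (x \<circ> t i))" for F :: "_ \<Rightarrow> complex"
      proof -
        have "of_nat (card I) * (\<Sum>x\<in>Z. F x) = (\<Sum>i\<in>I. \<Sum>x\<in>Z. F x)" by simp
        also have "\<dots> = (\<Sum>i\<in>I. \<Sum>x\<in>Z. F (x \<circ> t i))" by (rule sum.cong[OF refl]) (rule shift)
        finally show ?thesis by (simp add: sum.swap[of _ I])
      qed
      show ?thesis unfolding * by (rule sum.cong[OF refl]) (rule local_step)
    qed
    moreover have "card I \<noteq> 0" using per_pos[OF y, of p] by (simp add: I_def card_cartesian_product)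
    ultimately show ?thesis by simp
  qed
  have "(\<Sum>x\<in>Z. \<Prod>q\<in>reps n x y. h {} x q) = (\<Sum>x\<in>Z. \<Prod>q\<in>reps n x y. h Q x q)"
    if "finite Q" "Q \<subseteq> pm n" for Q
    using that by (induction Q) (use step in auto)
  from this[of "pm n"] have "(\<Sum>x\<in>Z. \<Prod>q\<in>reps n x y. h {} x q) = (\<Sum>x\<in>Z. \<Prod>q\<in>reps n x y. h (pm n) x q)" by simp
  moreover have "(\<Prod>q\<in>reps n x y. h (pm n) x q) = (\<Prod>q\<in>reps n x y. \<psi> x q)" for x
    by (rule prod.cong) (auto simp: h_def reps_def)
  ultimately show ?thesis by (simp add: h_def Z_def)
qed

text \<open>
  The first return of \<open>p\<close> under \<open>x\<close> to its signed \<open>y\<close>-cycle, after \<open>d\<close> steps; it determines the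
  action of \<open>\<langle>x, y, -1\<rangle>\<close> on the orbit of \<open>p\<close>.
\<close>

locale first_return = commuting_pair +
  fixes p d s r
  assumes p: "p \<in> pm n" and d: "d > 0"
    and ret: "(x ^^ d) p = (- 1) ^ s * (y ^^ r) p"
    and not_before: "\<And>i. 0 < i \<Longrightarrow> i < d \<Longrightarrow> (x ^^ i) p \<notin> cyc_support y p"
begin

lemma funpow_ret: "(x ^^ (d * j)) p = (- 1) ^ (s * j) * (y ^^ (r * j)) p"
proof (induction j)
  case (Suc j)
  have "(x ^^ (d * Suc j)) p = (x ^^ d) ((x ^^ (d * j)) p)" by (simp add: funpow_add)
  also have "\<dots> = (- 1) ^ (s * j) * (y ^^ (r * j)) ((x ^^ d) p)"
    by (simp only: Suc.IH B_sign[OF B_funpow[OF x] sign_power_mem] funpow_commute[OF xy])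
  also have "\<dots> = (- 1) ^ (s * j) * ((- 1) ^ s * (y ^^ (r * j)) ((y ^^ r) p))"
    by (simp only: ret B_sign[OF B_funpow[OF y] sign_power_mem])
  also have "\<dots> = (- 1) ^ (s * Suc j) * (y ^^ (r * Suc j)) p"
    by (simp add: funpow_add power_add add.commute[of r])
  finally show ?case .
qed simp

lemma funpow_mem_iff: "(x ^^ i) p \<in> cyc_support y p \<longleftrightarrow> d dvd i"
proof (rule least_positive_dvd)
  show "(x ^^ d) p \<in> cyc_support y p" using cyc_supportI[OF y sign_power_mem] ret by metis
  fix i j assume *: "(x ^^ i) p \<in> cyc_support y p"
  have "(x ^^ (i + j)) p \<in> cyc_support y ((x ^^ j) p)"
    using cyc_support_image[OF y x xy[symmetric], of j "(x ^^ i) p" p] * by (simp add: funpow_add add.commute[of i])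
  then show "((x ^^ (i + j)) p \<in> cyc_support y p) \<longleftrightarrow> ((x ^^ j) p \<in> cyc_support y p)"
    using cyc_support_trans[OF y] cyc_support_sym[OF y] by meson
qed (use d not_before in auto)

lemma mem_cyc_support_y_iff:
  assumes "v \<in> cyc_support y p" "e \<in> {1,-1}"
  shows "v = e * (x ^^ i) p \<longleftrightarrow> d dvd i \<and> v = e * ((- 1) ^ (s * (i div d)) * (y ^^ (r * (i div d))) p)"
proof
  assume v: "v = e * (x ^^ i) p"
  then have "(x ^^ i) p \<in> cyc_support y p" using assms cyc_support_invariant(2)[OF y] by auto
  then have "d dvd i" by (simp add: funpow_mem_iff)
  then show "d dvd i \<and> v = e * ((- 1) ^ (s * (i div d)) * (y ^^ (r * (i div d))) p)"
    using funpow_ret[of "i div d"] v by simp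
next
  assume "d dvd i \<and> v = e * ((- 1) ^ (s * (i div d)) * (y ^^ (r * (i div d))) p)"
  then show "v = e * (x ^^ i) p" using funpow_ret[of "i div d"] by simp
qed

text \<open>Strictly between departure and return the points avoid the signed \<open>y\<close>-cycle
  of \<open>p\<close>, where alone the twist acts. It is felt exactly once, on leaving
  \<open>p\<close>, and adds \<open>(s', r')\<close> to the return data.\<close>

lemma twist_first_return:
  "first_return n (x \<circ> twist n y p s' r') y p d (s + s') (r + r')"
proof -
  let ?t = "twist n y p s' r'"
  interpret x': commuting_pair n "x \<circ> ?t" y by (rule twist_comp)
  have tp: "?t v = (if v \<in> cyc_support y p then (- 1) ^ s' * (y ^^ r') v else v)" for v
    by (rule twist_apply[OF y p])
  \<comment> \<open>The twist is applied before \<open>x\<close>, so its factor is present from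
    exponent 1 on, and the induction starts there.\<close>
  have it: "((x \<circ> ?t) ^^ Suc i) p = (- 1) ^ s' * (y ^^ r') ((x ^^ Suc i) p)" if "Suc i \<le> d" for i
    using that
  proof (induction i)
    case 0
    show ?case
      using funpow_commute[OF xy, of 1 r' p] by (simp add: tp cyc_support_refl[OF y] B_sign[OF x sign_power_mem])
  next
    case (Suc i)
    have "(x ^^ Suc i) p \<notin> cyc_support y p" using not_before[of "Suc i"] Suc.prems by simp
    then have "(- 1) ^ s' * (y ^^ r') ((x ^^ Suc i) p) \<notin> cyc_support y p"
      using cyc_supportI[OF y sign_power_mem, of s' r' "(x ^^ Suc i) p"] cyc_support_trans[OF y] cyc_support_sym[OF y] by meson
    then have "?t ((- 1) ^ s' * (y ^^ r') ((x ^^ Suc i) p)) = (- 1) ^ s' * (y ^^ r') ((x ^^ Suc i) p)"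
      by (simp only: tp if_False)
    moreover have "((x \<circ> ?t) ^^ Suc i) p = (- 1) ^ s' * (y ^^ r') ((x ^^ Suc i) p)"
      by (rule Suc.IH) (use Suc.prems in simp)
    ultimately have "((x \<circ> ?t) ^^ Suc (Suc i)) p = x ((- 1) ^ s' * (y ^^ r') ((x ^^ Suc i) p))"
      by (simp only: funpow.simps(2)[of "Suc i"] comp_apply)
    also have "\<dots> = (- 1) ^ s' * (y ^^ r') ((x ^^ Suc (Suc i)) p)"
      using funpow_commute[OF xy, of 1 r' "(x ^^ Suc i) p"] by (simp add: B_sign[OF x sign_power_mem])
    finally show ?case .
  qed
  show ?thesis
  proof unfold_locales
    obtain d' where d': "d = Suc d'" using d by (cases d) auto
    have "((x \<circ> ?t) ^^ d) p = (- 1) ^ s' * (y ^^ r') ((x ^^ d) p)" using it[of d'] d' by simp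
    also have "\<dots> = (- 1) ^ s' * ((- 1) ^ s * (y ^^ r') ((y ^^ r) p))"
      by (simp only: ret B_sign[OF B_funpow[OF y] sign_power_mem])
    also have "\<dots> = (- 1) ^ (s + s') * (y ^^ (r + r')) p"
      by (simp add: power_add funpow_add add.commute[of r])
    finally show "((x \<circ> ?t) ^^ d) p = (- 1) ^ (s + s') * (y ^^ (r + r')) p" .
    fix i assume i: "0 < i" "i < d"
    then obtain j where j: "i = Suc j" by (cases i) auto
    have "(- 1) ^ s' * (y ^^ r') ((x ^^ i) p) \<notin> cyc_support y p"
      using not_before[OF i] cyc_supportI[OF y sign_power_mem, of s' r' "(x ^^ i) p"]
        cyc_support_trans[OF y] cyc_support_sym[OF y] by meson
    then show "((x \<circ> ?t) ^^ i) p \<notin> cyc_support y p" using it[of j] i j by simp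
  qed (use p d in auto)
qed

lemma reduce:
  assumes "s' mod 2 = s mod 2" "[r' = r] (mod per y p)"
  shows "first_return n x y p d s' r'"
proof unfold_locales
  have "(- 1 :: int) ^ s' = (- 1) ^ s" using assms(1) by (simp add: minus_one_power_iff even_iff_mod_2_eq_zero)
  moreover have "(y ^^ r') p = (y ^^ r) p" using assms(2) by (simp add: funpow_eq_iff_cong[OF y])
  ultimately show "(x ^^ d) p = (- 1) ^ s' * (y ^^ r') p" using ret by simp
qed (use p d not_before in auto)

end

lemma (in commuting_pair) first_return_exists:
  assumes p: "p \<in> pm n"
  obtains d s r where "first_return n x y p d s r"
proof -
  define d where "d = (LEAST d. 0 < d \<and> (x ^^ d) p \<in> cyc_support y p)"
  have "0 < expo n \<and> (x ^^ expo n) p \<in> cyc_support y p"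
    by (simp add: expo_pos funpow_expo[OF x] cyc_support_refl[OF y])
  then have d: "0 < d \<and> (x ^^ d) p \<in> cyc_support y p" unfolding d_def by (rule LeastI)
  obtain e r where e: "e \<in> {1,-1}" "(x ^^ d) p = e * (y ^^ r) p"
    using d mem_cyc_supportE[OF y] by metis
  have "e = (- 1) ^ (if e = 1 then 0 else 1)" using e by auto
  then have "first_return n x y p d (if e = 1 then 0 else 1) r"
    using p d e not_less_Least[of _ "\<lambda>d. 0 < d \<and> (x ^^ d) p \<in> cyc_support y p", folded d_def]
    by unfold_locales auto
  then show ?thesis by (rule that)
qed

section \<open>Local averages\<close>

lemma per_eqI:
  assumes "x \<in> carrier (B_group n)" "\<And>i. (x ^^ i) p = p \<longleftrightarrow> L dvd i"
  shows "per x p = L"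
  using assms funpow_eq_iff_dvd[OF assms(1), of _ p] by (metis dvd_antisym dvd_refl)

text \<open>A Bezout inverse in two guises: \<open>u\<close> inverts the reduced residue, and
  \<open>u\<close> steps of size \<open>r\<close> add up to the smallest attainable step
  \<open>gcd r N\<close>.\<close>

lemma gcd_quotient_inverse:
  fixes r N :: nat
  assumes "N > 0"
  obtains u where "[u * (r div gcd r N) = 1] (mod (N div gcd r N))" "[r * u = gcd r N] (mod N)"
proof -
  define g where "g = gcd r N"
  have g: "r = g * (r div g)" "N = g * (N div g)" by (simp_all add: g_def)
  have "coprime (r div g) (N div g)" using assms by (simp add: g_def div_gcd_coprime)
  then obtain u where u: "[(r div g) * u = 1] (mod (N div g))"
    by (metis coprime_iff_invertible_nat One_nat_def)
  have "[g * ((r div g) * u) = g * 1] (mod (g * (N div g)))" using u by (rule cong_cmult_leftI)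
  then have "[r * u = g] (mod N)" using g by (metis mult.assoc mult_1_right)
  then show ?thesis using that u by (simp add: g_def mult.commute)
qed

lemma dvd_mult_iff_gcd_quotient:
  fixes r N :: nat
  assumes "N > 0"
  shows "N dvd r * j \<longleftrightarrow> N div gcd r N dvd j"
proof -
  define g where "g = gcd r N"
  have g: "r = g * (r div g)" "N = g * (N div g)" "g > 0" using assms by (simp_all add: g_def)
  have "coprime (r div g) (N div g)" using assms by (simp add: g_def div_gcd_coprime)
  then have c: "coprime (N div g) (r div g)" by (rule coprime_commute[THEN iffD1])
  have "N dvd r * j \<longleftrightarrow> g * (N div g) dvd g * (r div g * j)" using g by (metis mult.assoc)
  also have "\<dots> \<longleftrightarrow> N div g dvd j" using g(3) by (simp add: coprime_dvd_mult_right_iff[OF c])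
  finally show ?thesis by (simp add: g_def)
qed

lemma sum_mod_shift:
  fixes f :: "nat \<Rightarrow> complex"
  assumes "N > 0"
  shows "(\<Sum>r<N. f ((r + c) mod N)) = (\<Sum>r<N. f r)"
proof (rule sum.reindex_bij_betw)
  have "inj_on (\<lambda>r. (r + c) mod N) {..<N}"
  proof (rule inj_onI)
    fix a b assume ab: "a \<in> {..<N}" "b \<in> {..<N}" "(a + c) mod N = (b + c) mod N"
    then have "[a = b] (mod N)" using cong_add_rcancel_nat[of a c b N] by (simp add: cong_def)
    then show "a = b" using ab by (simp add: cong_def)
  qed
  moreover have "(\<lambda>r. (r + c) mod N) ` {..<N} \<subseteq> {..<N}" using assms by auto
  ultimately show "bij_betw (\<lambda>r. (r + c) mod N) {..<N} {..<N}"
    by (simp add: bij_betw_def endo_inj_surj)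
qed

text \<open>The local factors at the orbit of \<open>p\<close> of the character side and of the root side.\<close>

definition phiX :: "nat \<Rightarrow> nat \<Rightarrow> (int \<Rightarrow> int) \<Rightarrow> (int \<Rightarrow> int) \<Rightarrow> int \<Rightarrow> complex" where
  "phiX k \<sigma> y x p = (if (x ^^ k) p = (- 1) ^ \<sigma> * p then wt x y p else 0)"

definition phiH :: "nat \<Rightarrow> nat \<Rightarrow> (int \<Rightarrow> int) \<Rightarrow> (int \<Rightarrow> int) \<Rightarrow> int \<Rightarrow> complex" where
  "phiH k \<sigma> y x p = (if (x ^^ k) p = y p then (if odd \<sigma> \<and> - p \<in> orbit x p then - 1 else 1) else 0)"

context first_return
begin

lemma not_dvd_imp_phi_0:
  assumes "\<not> d dvd k"
  shows "phiX k \<sigma> y x p = 0" "phiH k \<sigma> y x p = 0"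
proof -
  have "(x ^^ k) p \<notin> cyc_support y p" using assms by (simp add: funpow_mem_iff)
  then have "(x ^^ k) p \<noteq> (- 1) ^ \<sigma> * p" "(x ^^ k) p \<noteq> y p"
    using cyc_supportI[OF y sign_power_mem, of \<sigma> 0 p] cyc_support_step[OF y, of p] by auto
  then show "phiX k \<sigma> y x p = 0" "phiH k \<sigma> y x p = 0" by (auto simp: phiX_def phiH_def)
qed

lemma cyc_support_eq_signed_powers:
  assumes "(y ^^ i) p \<in> cyc_support x p"
  obtains e j where "e \<in> {1,-1}" "(y ^^ i) p = e * (y ^^ (r * j)) p"
proof -
  obtain e l where e: "e \<in> {1,-1}" "(y ^^ i) p = e * (x ^^ l) p"
    using assms by (rule mem_cyc_supportE[OF x])
  have "(y ^^ i) p \<in> cyc_support y p" using cyc_supportI[OF y, of 1 i p] by simp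
  then have "(y ^^ i) p = e * ((- 1) ^ (s * (l div d)) * (y ^^ (r * (l div d))) p)"
    using mem_cyc_support_y_iff[OF _ e(1)] e(2) by blast
  then have "(y ^^ i) p = (e * (- 1) ^ (s * (l div d))) * (y ^^ (r * (l div d))) p" by simp
  moreover have "e * (- 1) ^ (s * (l div d)) \<in> {1,-1}" using e sign_power_mem[of "s * (l div d)"] by auto
  ultimately show ?thesis by (rule that[rotated])
qed

subsection \<open>Cycles of class +1\<close>

text \<open>In class +1 negation is not a power of \<open>y\<close> on the cycle, so sign and
  exponent are independent coordinates and can be compared separately.\<close>

lemma funpow_eq_iff_plus:
  assumes plus: "- p \<notin> orbit y p"
  shows "(x ^^ i) p = (- 1) ^ a * (y ^^ b) p \<longleftrightarrow>
    d dvd i \<and> even (s * (i div d) + a) \<and> [r * (i div d) = b] (mod per y p)"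
proof -
  let ?v = "(- 1) ^ a * (y ^^ b) p"
  have "(x ^^ i) p = ?v \<longleftrightarrow> d dvd i \<and> (- 1) ^ a * (y ^^ b) p = (- 1) ^ (s * (i div d)) * (y ^^ (r * (i div d))) p"
    using mem_cyc_support_y_iff[OF cyc_supportI[OF y sign_power_mem], of 1 a b i] by (auto simp: eq_commute)
  also have "\<dots> \<longleftrightarrow> d dvd i \<and> (- 1 :: int) ^ a = (- 1) ^ (s * (i div d)) \<and> [b = r * (i div d)] (mod per y p)"
    using plus by (simp add: signed_funpow_eq_iff[OF y p sign_power_mem sign_power_mem] zeta_eq_iff[OF per_pos[OF y]])
  also have "(- 1 :: int) ^ a = (- 1) ^ (s * (i div d)) \<longleftrightarrow> even (s * (i div d) + a)"
    by (simp add: minus_one_power_iff)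
  finally show ?thesis by (simp add: cong_sym_eq)
qed

text \<open>Up to sign the signed \<open>x\<close>-cycle meets the \<open>y\<close>-cycle of
  \<open>p\<close> in the points \<open>y^(r j) p\<close>, so the first return under
  \<open>y\<close> is \<open>y^g p = (-1)^(s u) x^(d u) p\<close> with the Bezout exponent
  \<open>u\<close>. If \<open>s\<close> and \<open>E\<close> are odd, then
  \<open>x^(d E) p = - p\<close>: the signed \<open>x\<close>-cycle has class -1 and period
  \<open>2 d E\<close>, and sign and root of unity combine. Otherwise it has class +1 and period
  \<open>d E\<close>, and the sign has value 1.\<close>

lemma wt_plus:
  assumes plus: "- p \<notin> orbit y p"
  defines "N \<equiv> per y p"
  defines "g \<equiv> gcd r N"
  defines "E \<equiv> N div g"
  shows "\<exists>v. wt x y p = zeta E v \<and> [v * (if odd s \<and> odd E then 2 else 1) * (r div g) = 1] (mod E)"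
    and "- p \<in> orbit x p \<longleftrightarrow> odd s \<and> odd E"
proof -
  have N: "N > 0" unfolding N_def by (rule per_pos[OF y])
  have E: "E > 0" "g > 0" "N = g * E" using N by (auto simp: E_def g_def intro!: Nat.gr0I simp: dvd_div_eq_0_iff)
  have Ndvd: "N dvd r * j \<longleftrightarrow> E dvd j" for j
    unfolding E_def g_def by (rule dvd_mult_iff_gcd_quotient[OF N])
  have fix_iff: "(x ^^ i) p = (- 1) ^ a * p \<longleftrightarrow> d dvd i \<and> even (s * (i div d) + a) \<and> E dvd i div d" for i a
    using funpow_eq_iff_plus[OF plus, of i a 0] by (simp add: cong_0_iff Ndvd N_def[symmetric])
  have "- p \<in> orbit x p \<longleftrightarrow> (\<exists>i. (x ^^ i) p = (- 1) ^ 1 * p)"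
    by (auto simp: mem_orbit_iff[OF x] eq_commute)
  also have "\<dots> \<longleftrightarrow> (\<exists>i. d dvd i \<and> odd (s * (i div d)) \<and> E dvd i div d)"
    by (simp only: fix_iff) simp
  also have "\<dots> \<longleftrightarrow> odd s \<and> odd E"
  proof
    assume "odd s \<and> odd E"
    then show "\<exists>i. d dvd i \<and> odd (s * (i div d)) \<and> E dvd i div d"
      using d by (intro exI[of _ "d * E"]) auto
  qed (auto elim!: dvdE)
  finally show orb: "- p \<in> orbit x p \<longleftrightarrow> odd s \<and> odd E" .
  obtain u where u: "[u * (r div g) = 1] (mod E)" "[r * u = g] (mod N)"
    using gcd_quotient_inverse[OF N, of r] by (auto simp: g_def E_def)
  have yg: "(y ^^ g) p = (- 1) ^ (s * u) * (x ^^ (d * u)) p"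
  proof -
    have "(y ^^ (r * u)) p = (y ^^ g) p" using u(2) by (simp add: funpow_eq_iff_cong[OF y] N_def)
    then show ?thesis by (simp only: funpow_ret) (simp flip: power_add mult.assoc)
  qed
  have "(y ^^ i) p \<notin> cyc_support x p" if i: "0 < i" "i < g" for i
  proof
    assume "(y ^^ i) p \<in> cyc_support x p"
    then obtain e j where e: "e \<in> {1,-1}" "(y ^^ i) p = e * (y ^^ (r * j)) p"
      by (rule cyc_support_eq_signed_powers)
    then have "1 * (y ^^ i) p = e * (y ^^ (r * j)) p" by simp
    then have "[i = r * j] (mod N)"
      using plus e(1) signed_funpow_eq_iff[OF y p, of 1 e i "r * j"]
      by (simp add: zeta_eq_iff[OF per_pos[OF y]] N_def)
    then have "[i = r * j] (mod g)" by (rule cong_dvd_modulus_nat) (simp add: g_def)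
    moreover have "g dvd r * j" by (simp add: g_def)
    ultimately have "g dvd i" by (simp add: cong_dvd_iff)
    then show False using i by (auto dest: dvd_imp_le)
  qed
  from wt_eqI[OF x p sign_power_mem E(2) yg this]
  have wt: "wt x y p = (if odd s \<and> odd E then of_int ((- 1) ^ (s * u)) else 1) * zeta (per x p) (d * u)"
    by (simp only: orb)
  show "\<exists>v. wt x y p = zeta E v \<and> [v * (if odd s \<and> odd E then 2 else 1) * (r div g) = 1] (mod E)"
  proof (cases "odd s \<and> odd E")
    case False
    have "per x p = d * E"
    proof (rule per_eqI[OF x])
      fix i
      have "(x ^^ i) p = p \<longleftrightarrow> d dvd i \<and> even (s * (i div d)) \<and> E dvd i div d"
        using fix_iff[of i 0] by simp
      also have "\<dots> \<longleftrightarrow> d dvd i \<and> E dvd i div d" using False by (auto elim!: dvdE)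
      also have "\<dots> \<longleftrightarrow> d * E dvd i" using d by (auto elim!: dvdE)
      finally show "(x ^^ i) p = p \<longleftrightarrow> d * E dvd i" .
    qed
    then have "wt x y p = zeta E u" using False d zeta_scale[of d E u] unfolding wt by (auto simp: mult.commute)
    then show ?thesis using u False by (intro exI[of _ u]) auto
  next
    case True
    have "per x p = d * (2 * E)"
    proof (rule per_eqI[OF x])
      fix i
      have "(x ^^ i) p = p \<longleftrightarrow> d dvd i \<and> even (s * (i div d)) \<and> E dvd i div d"
        using fix_iff[of i 0] by simp
      also have "\<dots> \<longleftrightarrow> d dvd i \<and> 2 * E dvd i div d"
      proof -
        have "even j \<and> E dvd j \<longleftrightarrow> 2 * E dvd j" for j
          using True by (metis coprime_left_2_iff_odd divides_mult dvd_mult_left dvd_mult_right)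
        then show ?thesis using True by auto
      qed
      also have "\<dots> \<longleftrightarrow> d * (2 * E) dvd i" using d by (auto elim!: dvdE)
      finally show "(x ^^ i) p = p \<longleftrightarrow> d * (2 * E) dvd i" .
    qed
    then have z: "zeta (per x p) (d * u) = zeta (2 * E) u" using d zeta_scale[of d "2 * E" u] by (simp add: mult.commute)
    have "of_int ((- 1) ^ (s * u)) = (- 1 :: complex) ^ u"
      using True by (simp add: minus_one_power_iff)
    also have "(- 1 :: complex) = zeta (2 * E) E"
      using E(1) by (simp add: zeta_def)
    also have "zeta (2 * E) E ^ u = zeta (2 * E) (E * u)" by (rule zeta_power)
    finally have "wt x y p = zeta (2 * E) (E * u + u)"
      using True unfolding wt z by (simp add: zeta_add)
    \<comment> \<open>\<open>E\<close> is odd, so \<open>(E + 1) div 2\<close> is the inverse of 2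
      modulo \<open>E\<close>.\<close>
    also have "\<dots> = zeta (E * 2) ((E + 1) div 2 * u * 2)"
    proof -
      have "E * u + u = (E + 1) div 2 * u * 2" using True by (auto elim!: oddE simp: algebra_simps)
      then show ?thesis by (simp only: mult.commute[of 2])
    qed
    also have "\<dots> = zeta E ((E + 1) div 2 * u)" by (rule zeta_scale) simp
    finally have "wt x y p = zeta E ((E + 1) div 2 * u)" .
    moreover have "[(E + 1) div 2 * u * 2 * (r div g) = 1] (mod E)"
    proof -
      have "(E + 1) div 2 * u * 2 * (r div g) = E * (u * (r div g)) + u * (r div g)"
        using True by (auto elim!: oddE simp: algebra_simps)
      then show ?thesis using u(1) by (simp add: cong_def)
    qed
    ultimately show ?thesis using True by (intro exI[of _ "(E + 1) div 2 * u"]) simp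
  qed
qed

end

text \<open>For fixed \<open>s\<close> the family realises every return exponent modulo
  \<open>per y p\<close> once. The condition on the \<open>k\<close>-th power selects the residues
  killed by \<open>k div d\<close>, to which the sum of cyclic weights applies; its multiplier may
  depend on the fixed \<open>s\<close>.\<close>

lemma sum_phiX_plus:
  assumes w: "\<And>r. r < per y p \<Longrightarrow> first_return n (w r) y p d s r"
    and y: "y \<in> carrier (B_group n)" and plus: "- p \<notin> orbit y p"
  shows "(\<Sum>r<per y p. phiX k \<sigma> y (w r) p) =
    (if d dvd k \<and> even (s * (k div d) + \<sigma>) \<and> coprime (k div d) (per y p) then 1 else 0)"
proof -
  have N: "per y p > 0" by (rule per_pos[OF y])
  have "phiX k \<sigma> y (w r) p = (if d dvd k \<and> even (s * (k div d) + \<sigma>) \<and> per y p dvd r * (k div d)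
      then wt (w r) y p else 0)" if "r < per y p" for r
  proof -
    interpret first_return n "w r" y p d s r by (rule w[OF that])
    show ?thesis using funpow_eq_iff_plus[OF plus, of k \<sigma> 0] by (simp add: phiX_def cong_0_iff)
  qed
  then have "(\<Sum>r<per y p. phiX k \<sigma> y (w r) p) =
    (\<Sum>r<per y p. if d dvd k \<and> even (s * (k div d) + \<sigma>) \<and> per y p dvd r * (k div d) then wt (w r) y p else 0)"
    by simp
  also have "\<dots> = (if d dvd k \<and> even (s * (k div d) + \<sigma>)
      then \<Sum>r | r < per y p \<and> per y p dvd r * (k div d). wt (w r) y p else 0)"
    by (auto simp: sum.inter_filter[symmetric] simp flip: lessThan_def intro!: sum.cong)
  also have "(\<Sum>r | r < per y p \<and> per y p dvd r * (k div d). wt (w r) y p) = (if coprime (k div d) (per y p) then 1 else 0)"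
    by (rule cyclic_weight_sum[OF N, where \<kappa> = "\<lambda>E. if odd s \<and> odd E then 2 else 1"])
      (rule first_return.wt_plus(1)[OF w plus])
  finally show ?thesis by simp
qed

lemma sum_phiH_plus:
  assumes w: "\<And>r. r < per y p \<Longrightarrow> first_return n (w r) y p d s r"
    and y: "y \<in> carrier (B_group n)" and plus: "- p \<notin> orbit y p"
  shows "(\<Sum>r<per y p. phiH k \<sigma> y (w r) p) =
    (if d dvd k \<and> even (s * (k div d)) \<and> coprime (k div d) (per y p)
     then (if odd \<sigma> \<and> odd s \<and> odd (per y p) then - 1 else 1) else 0)"
proof -
  have N: "per y p > 0" by (rule per_pos[OF y])
  let ?c = "if odd \<sigma> \<and> odd s \<and> odd (per y p) then - 1 else (1 :: complex)"
  have "phiH k \<sigma> y (w r) p = (if d dvd k \<and> even (s * (k div d)) \<and> [r * (k div d) = 1] (mod per y p)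
      then ?c else 0)" if "r < per y p" for r
  proof -
    interpret first_return n "w r" y p d s r by (rule w[OF that])
    \<comment> \<open>A solution \<open>r\<close> is a unit, so \<open>E\<close> is the full period
      and the class of the signed \<open>x\<close>-cycle depends only on \<open>s\<close> and on
      this period.\<close>
    have "gcd r (per y p) = 1" if "[r * (k div d) = 1] (mod per y p)"
      using cong_mult_1_imp_coprime(1)[OF that] by simp
    then show ?thesis using funpow_eq_iff_plus[OF plus, of k 0 1] wt_plus(2)[OF plus] by (auto simp: phiH_def)
  qed
  then have "(\<Sum>r<per y p. phiH k \<sigma> y (w r) p) =
    (\<Sum>r<per y p. if d dvd k \<and> even (s * (k div d)) \<and> [r * (k div d) = 1] (mod per y p) then ?c else 0)"
    by simp
  also have "\<dots> = (if d dvd k \<and> even (s * (k div d))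
      then \<Sum>r | r < per y p \<and> [r * (k div d) = 1] (mod per y p). ?c else 0)"
    by (auto simp: sum.inter_filter[symmetric] simp flip: lessThan_def intro!: sum.cong)
  finally show ?thesis using sum_inverse_residue[OF N, where K = "k div d" and c = ?c] by simp
qed

subsection \<open>Cycles of class -1\<close>

lemma half_period:
  assumes y: "y \<in> carrier (B_group n)" and p: "p \<in> pm n" and minus: "- p \<in> orbit y p"
  obtains m where "per y p = 2 * m" "(y ^^ m) p = - p"
proof -
  let ?N = "per y p"
  obtain h where h: "(y ^^ h) p = - p" using minus mem_orbit_iff[OF y, of "- p" p] by metis
  have "(y ^^ (h + h)) p = p" by (simp only: funpow_add comp_apply h B_neg[OF B_funpow[OF y]] minus_minus)
  then have N2h: "?N dvd 2 * h" using funpow_eq_iff_dvd[OF y, of "h + h" p] by (simp add: mult_2)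
  have Nh: "\<not> ?N dvd h" using funpow_eq_iff_dvd[OF y, of h p] h pm_nonzero[OF p] by simp
  have "even ?N"
  proof (rule ccontr)
    assume "odd ?N"
    then have "coprime ?N 2" by simp
    then show False using N2h Nh by (simp add: coprime_dvd_mult_right_iff)
  qed
  then obtain m where m: "?N = 2 * m" by (elim evenE)
  then obtain c where c: "h = m * c" using N2h by (auto elim!: dvdE)
  have "odd c" using Nh m c by (auto elim!: evenE)
  then have "[h = m] (mod ?N)"
    using m c by (auto elim!: oddE simp: cong_def algebra_simps)
  then have "(y ^^ m) p = - p" using h by (metis funpow_eq_iff_cong[OF y])
  then show ?thesis using that m by blast
qed

text \<open>In class -1 negation is \<open>y^m\<close> on the cycle, so a return sign can be moved
  into the exponent. The data are normalised to \<open>s = 0\<close>, and only \<open>r\<close>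
  modulo \<open>2 * m\<close> remains.\<close>

locale first_return_minus = first_return n x y p d 0 r for n x y p d r +
  fixes m
  assumes N: "per y p = 2 * m" and half: "(y ^^ m) p = - p"
begin

lemma m_pos: "m > 0"
  using N per_pos[OF y, of p] by simp

lemma minus_funpow: "- (y ^^ b) p = (y ^^ (b + m)) p"
  by (simp only: funpow_add comp_apply half B_neg[OF B_funpow[OF y]])

lemma funpow_eq_iff:
  "(x ^^ i) p = (y ^^ b) p \<longleftrightarrow> d dvd i \<and> [r * (i div d) = b] (mod 2 * m)"
proof -
  have "(y ^^ b) p \<in> cyc_support y p" using cyc_supportI[OF y, of 1 b p] by simp
  from mem_cyc_support_y_iff[OF this, of 1 i]
  have "(x ^^ i) p = (y ^^ b) p \<longleftrightarrow> d dvd i \<and> (y ^^ b) p = (y ^^ (r * (i div d))) p"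
    by (auto simp: eq_commute)
  then show ?thesis by (simp add: funpow_eq_iff_cong[OF y] N cong_sym_eq)
qed

text \<open>On this cycle \<open><y, -1>\<close> is cyclic of order \<open>2 * m\<close>, and the
  first return under \<open>y\<close> is governed by the subgroup that \<open>r\<close> and
  \<open>m\<close> generate. For even \<open>E\<close> it is generated by \<open>g\<close>. For odd
  \<open>E\<close> one has \<open>g = 2 * h\<close>, and it is generated by \<open>h\<close>: the
  return comes at half the step, with a sign of value 1 since \<open>x\<close> has class +1 there,
  and the halving produces the multiplier 2.\<close>

lemma wt_minus:
  defines "g \<equiv> gcd r (2 * m)"
  defines "E \<equiv> (2 * m) div g"
  shows "\<exists>v. wt x y p = zeta E v \<and> [v * (if odd E then 2 else 1) * (r div g) = 1] (mod E)"
    and "- p \<in> orbit x p \<longleftrightarrow> even E"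
proof -
  have E: "E > 0" "g > 0" "2 * m = g * E"
    using m_pos by (auto simp: E_def g_def intro!: Nat.gr0I simp: dvd_div_eq_0_iff)
  have M: "2 * m > 0" using m_pos by simp
  have dvd: "2 * m dvd r * j \<longleftrightarrow> E dvd j" for j
    unfolding E_def g_def by (rule dvd_mult_iff_gcd_quotient[OF M])
  obtain u where u: "[u * (r div g) = 1] (mod E)" "[r * u = g] (mod 2 * m)"
    using gcd_quotient_inverse[OF M, of r] by (auto simp: g_def E_def)
  have gm: "g dvd m \<longleftrightarrow> even E"
  proof
    assume "g dvd m"
    then obtain c where "m = g * c" by (elim dvdE)
    then have "g * (2 * c) = g * E" using E(3) by (metis mult.left_commute)
    then have "2 * c = E" using nat_mult_eq_cancel1[OF E(2)] by blast
    then show "even E" by (metis dvd_triv_left)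
  next
    assume "even E"
    then obtain c where "E = 2 * c" by (elim evenE)
    then show "g dvd m" using E(3) by auto
  qed
  have "- p \<in> orbit x p \<longleftrightarrow> (\<exists>i. (x ^^ i) p = (y ^^ m) p)"
    by (auto simp: mem_orbit_iff[OF x] half eq_commute)
  also have "\<dots> \<longleftrightarrow> (\<exists>i. d dvd i \<and> [r * (i div d) = m] (mod 2 * m))" by (simp only: funpow_eq_iff)
  also have "\<dots> \<longleftrightarrow> g dvd m"
  proof
    assume "\<exists>i. d dvd i \<and> [r * (i div d) = m] (mod 2 * m)"
    then obtain j where "[r * j = m] (mod 2 * m)" by blast
    then have "[r * j = m] (mod g)" by (rule cong_dvd_modulus_nat) (simp add: g_def)
    moreover have "g dvd r * j" by (simp add: g_def)
    ultimately show "g dvd m" by (simp add: cong_dvd_iff)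
  next
    assume "g dvd m"
    then obtain c where c: "m = g * c" by (elim dvdE)
    have "[r * u * c = g * c] (mod 2 * m)" using u(2) by (rule cong_scalar_right)
    then show "\<exists>i. d dvd i \<and> [r * (i div d) = m] (mod 2 * m)"
      using d c by (intro exI[of _ "d * (u * c)"]) (simp add: mult.assoc)
  qed
  finally show orb: "- p \<in> orbit x p \<longleftrightarrow> even E" using gm by simp
  have per: "per x p = d * E"
  proof (rule per_eqI[OF x])
    fix i
    have "(x ^^ i) p = p \<longleftrightarrow> d dvd i \<and> E dvd i div d"
      using funpow_eq_iff[of i 0] by (simp add: cong_0_iff dvd)
    also have "\<dots> \<longleftrightarrow> d * E dvd i" using d by (auto elim!: dvdE)
    finally show "(x ^^ i) p = p \<longleftrightarrow> d * E dvd i" .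
  qed
  have z: "zeta (per x p) (d * u) = zeta E u" for u
    using d zeta_scale[of d E u] by (simp add: per mult.commute)
  have least: "c dvd i" if "(y ^^ i) p \<in> cyc_support x p" "c dvd r" "c dvd m" for i c
  proof -
    obtain e j where e: "e \<in> {1,-1}" "(y ^^ i) p = e * (y ^^ (r * j)) p"
      using \<open>(y ^^ i) p \<in> cyc_support x p\<close> by (rule cyc_support_eq_signed_powers)
    then have "(y ^^ i) p = (y ^^ (r * j)) p \<or> (y ^^ i) p = (y ^^ (r * j + m)) p"
      by (auto simp: minus_funpow)
    then have "[i = r * j] (mod 2 * m) \<or> [i = r * j + m] (mod 2 * m)"
      by (simp add: funpow_eq_iff_cong[OF y] N)
    then have "[i = r * j] (mod c) \<or> [i = r * j + m] (mod c)"
      using that(3) cong_dvd_modulus_nat[of i _ "2 * m" c] by auto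
    moreover have "c dvd r * j" "c dvd r * j + m" using that by auto
    ultimately show ?thesis by (auto simp: cong_dvd_iff)
  qed
  show "\<exists>v. wt x y p = zeta E v \<and> [v * (if odd E then 2 else 1) * (r div g) = 1] (mod E)"
  proof (cases "even E")
    case True
    have "(y ^^ (r * u)) p = (y ^^ g) p" using u(2) by (simp add: funpow_eq_iff_cong[OF y] N)
    then have yg: "(y ^^ g) p = 1 * (x ^^ (d * u)) p" by (simp add: funpow_ret)
    have "(y ^^ i) p \<notin> cyc_support x p" if i: "0 < i" "i < g" for i
      using nat_dvd_not_less[OF i] least[of i g] gm True by (auto simp: g_def)
    from wt_eqI[OF x p _ E(2) yg this] have "wt x y p = zeta E u" by (simp add: z)
    then show ?thesis using u(1) True by (intro exI[of _ u]) simp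
  next
    case False
    then have "even g" using E(3) by (metis dvd_triv_left even_mult_iff)
    then obtain h where h: "g = 2 * h" by (elim evenE)
    have h0: "h > 0" using h E(2) by simp
    have mh: "m = h * E" using E(3) h by simp
    have rg: "r = 2 * h * (r div g)" using h by (metis dvd_mult_div_cancel g_def gcd_dvd1)
    have "coprime (2 * (r div g)) E"
      using cong_mult_1_imp_coprime(2)[OF u(1)] False by simp
    then obtain v where v: "[2 * (r div g) * v = 1] (mod E)" by (metis coprime_iff_invertible_nat One_nat_def)
    \<comment> \<open>Adding \<open>E\<close> corrects the parity without changing the class modulo
      \<open>E\<close>. After multiplication by \<open>h\<close> it becomes the half turn
      \<open>m = h * E\<close>, the source of the sign in the return.\<close>
    have "[2 * (r div g) * v + E = 1] (mod 2 * E)"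
    proof (rule coprime_cong_mult_nat)
      show "[2 * (r div g) * v + E = 1] (mod 2)" using False by (simp add: cong_def mod2_eq_if)
      show "[2 * (r div g) * v + E = 1] (mod E)" using v by (simp add: cong_def)
      show "coprime 2 E" using False by simp
    qed
    then have "[h * (2 * (r div g) * v + E) = h * 1] (mod h * (2 * E))" by (rule cong_cmult_leftI)
    moreover have "h * (2 * (r div g) * v + E) = r * v + m" by (subst rg, simp add: mh algebra_simps)
    ultimately have "[r * v + m = h] (mod 2 * m)" by (simp add: mh mult.left_commute)
    then have "(y ^^ (r * v + m)) p = (y ^^ h) p" by (simp add: funpow_eq_iff_cong[OF y] N)
    then have yh: "(y ^^ h) p = - 1 * (x ^^ (d * v)) p" by (simp add: funpow_ret minus_funpow)
    have "(y ^^ i) p \<notin> cyc_support x p" if i: "0 < i" "i < h" for i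
      using least[of i h] i rg mh by (metis dvd_triv_left dvd_imp_le dvd_mult2 dvd_triv_right linorder_not_le)
    from wt_eqI[OF x p _ h0 yh this] have "wt x y p = zeta E v" using False orb by (simp add: z)
    then show ?thesis using v False by (intro exI[of _ v]) (simp add: mult_ac)
  qed
qed

end

text \<open>Let \<open>d\<close> divide \<open>k\<close>. For odd \<open>\<sigma>\<close> the
  condition on \<open>x\<close> is a difference of annihilator conditions for \<open>2 * K\<close>
  and for \<open>K\<close>. The first sum vanishes because \<open>2 * K\<close> is not a unit modulo
  \<open>2 * m\<close>, and the minus sign before the second matches the class -1 of the solutions
  on the root side.\<close>

lemma sum_phi_minus:
  assumes w: "\<And>r. r < 2 * m \<Longrightarrow> first_return_minus n (w r) y p d r m"
    and m: "m > 0"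
  shows "(\<Sum>r<2 * m. phiX k \<sigma> y (w r) p) = (\<Sum>r<2 * m. phiH k \<sigma> y (w r) p)"
proof (cases "d dvd k")
  case False
  have "phiX k \<sigma> y (w r) p = 0" "phiH k \<sigma> y (w r) p = 0" if "r < 2 * m" for r
  proof -
    interpret first_return_minus n "w r" y p d r m by (rule w[OF that])
    show "phiX k \<sigma> y (w r) p = 0" "phiH k \<sigma> y (w r) p = 0" by (rule not_dvd_imp_phi_0[OF False])+
  qed
  then show ?thesis by simp
next
  case True
  define K where "K = k div d"
  let ?c = "if odd \<sigma> then - 1 else (1 :: complex)"
  have M: "2 * m > 0" using m by simp
  have CL: "(\<Sum>r | r < 2 * m \<and> 2 * m dvd r * L. wt (w r) y p) = (if coprime L (2 * m) then 1 else 0)" for L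
    by (rule cyclic_weight_sum[OF M, where \<kappa> = "\<lambda>E. if odd E then 2 else 1"])
      (rule first_return_minus.wt_minus(1)[OF w])
  have "phiH k \<sigma> y (w r) p = (if [r * K = 1] (mod 2 * m) then ?c else 0)" if "r < 2 * m" for r
  proof -
    interpret first_return_minus n "w r" y p d r m by (rule w[OF that])
    have "gcd r (2 * m) = 1" if "[r * K = 1] (mod 2 * m)"
      using cong_mult_1_imp_coprime(1)[OF that] by simp
    then show ?thesis using funpow_eq_iff[of k 1] wt_minus(2) True by (auto simp: phiH_def K_def)
  qed
  then have "(\<Sum>r<2 * m. phiH k \<sigma> y (w r) p) = (\<Sum>r<2 * m. if [r * K = 1] (mod 2 * m) then ?c else 0)"
    by simp
  also have "\<dots> = (\<Sum>r | r < 2 * m \<and> [r * K = 1] (mod 2 * m). ?c)"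
    by (subst sum.inter_filter[symmetric]) (simp_all flip: lessThan_def)
  also have "\<dots> = (if coprime K (2 * m) then ?c else 0)" by (rule sum_inverse_residue[OF M])
  finally have H: "(\<Sum>r<2 * m. phiH k \<sigma> y (w r) p) = (if coprime K (2 * m) then ?c else 0)" .
  have filter: "(\<Sum>r<2 * m. if P r then wt (w r) y p else 0) = (\<Sum>r | r < 2 * m \<and> P r. wt (w r) y p)" for P
    by (subst sum.inter_filter[symmetric]) (simp_all flip: lessThan_def)
  show ?thesis
  proof (cases "odd \<sigma>")
    case even: False
    have "phiX k \<sigma> y (w r) p = (if 2 * m dvd r * K then wt (w r) y p else 0)" if "r < 2 * m" for r
    proof -
      interpret first_return_minus n "w r" y p d r m by (rule w[OF that])
      show ?thesis using funpow_eq_iff[of k 0] True even by (simp add: phiX_def K_def cong_0_iff)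
    qed
    then have "(\<Sum>r<2 * m. phiX k \<sigma> y (w r) p) = (\<Sum>r | r < 2 * m \<and> 2 * m dvd r * K. wt (w r) y p)"
      unfolding filter[symmetric] by simp
    then show ?thesis using CL H even by simp
  next
    case odd: True
    text \<open>\<open>r K = m\<close> modulo \<open>2 m\<close> means that \<open>2 K\<close> kills \<open>r\<close> and \<open>K\<close> does not.\<close>
    have annihilate: "[r * K = m] (mod 2 * m) \<longleftrightarrow> 2 * m dvd r * (2 * K) \<and> \<not> 2 * m dvd r * K" for r
    proof
      assume c: "[r * K = m] (mod 2 * m)"
      have "[2 * (r * K) = 2 * m] (mod 2 * m)" using c by (rule cong_scalar_left)
      then have "2 * m dvd r * (2 * K)" using cong_dvd_iff by (fastforce simp: mult_ac)
      moreover have "\<not> 2 * m dvd r * K"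
        using cong_dvd_iff[OF c] m by (auto dest: dvd_imp_le)
      ultimately show "2 * m dvd r * (2 * K) \<and> \<not> 2 * m dvd r * K" by simp
    next
      assume a: "2 * m dvd r * (2 * K) \<and> \<not> 2 * m dvd r * K"
      then have "2 * m dvd 2 * (r * K)" by (simp add: mult_ac)
      then obtain c where c: "r * K = m * c" using m by (auto elim!: dvdE)
      then have "odd c" using a by (auto elim!: evenE)
      then show "[r * K = m] (mod 2 * m)" using c by (auto elim!: oddE simp: cong_def algebra_simps)
    qed
    have "phiX k \<sigma> y (w r) p = (if 2 * m dvd r * (2 * K) then wt (w r) y p else 0) -
        (if 2 * m dvd r * K then wt (w r) y p else 0)" if "r < 2 * m" for r
    proof -
      interpret first_return_minus n "w r" y p d r m by (rule w[OF that])
      have "(w r ^^ k) p = (- 1) ^ \<sigma> * p \<longleftrightarrow> [r * K = m] (mod 2 * m)"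
        using funpow_eq_iff[of k m] True odd by (simp add: K_def half)
      moreover have "2 * m dvd r * K \<Longrightarrow> 2 * m dvd r * (2 * K)" by (metis dvd_mult mult.left_commute)
      ultimately show ?thesis using annihilate[of r] by (auto simp: phiX_def)
    qed
    then have "(\<Sum>r<2 * m. phiX k \<sigma> y (w r) p) =
      (\<Sum>r | r < 2 * m \<and> 2 * m dvd r * (2 * K). wt (w r) y p) - (\<Sum>r | r < 2 * m \<and> 2 * m dvd r * K. wt (w r) y p)"
      unfolding filter[symmetric] by (simp add: sum_subtractf)
    also have "\<not> coprime (2 * K) (2 * m)" by simp
    ultimately show ?thesis unfolding CL using H odd by simp
  qed
qed

text \<open>In class +1 the two sides agree only after summing over both signs: for odd
  \<open>\<sigma>\<close> and odd \<open>k div d\<close> the character side can be nonzero only at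
  \<open>s = 1\<close> and the root side only at \<open>s = 0\<close>. In class -1 they agree for
  each \<open>s\<close>.\<close>

lemma local_averages_eq:
  assumes x: "x \<in> centralizer (B_group n) y" and y: "y \<in> carrier (B_group n)" and p: "p \<in> pm n"
  shows "(\<Sum>s<2. \<Sum>r<per y p. phiX k \<sigma> y (x \<circ> twist n y p s r) p) =
         (\<Sum>s<2. \<Sum>r<per y p. phiH k \<sigma> y (x \<circ> twist n y p s r) p)"
proof -
  interpret commuting_pair n x y by unfold_locales (use x y in \<open>auto simp: mem_centralizer\<close>)
  let ?N = "per y p"
  have N: "?N > 0" by (rule per_pos[OF y])
  obtain d s0 r0 where fr: "first_return n x y p d s0 r0" using first_return_exists[OF p] .
  \<comment> \<open>The twists are shifted by the return data of \<open>x\<close>, so that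
    \<open>w s r\<close> has return data exactly \<open>(s, r)\<close>.\<close>
  define w where "w s r = x \<circ> twist n y p ((s + s0) mod 2) ((r + (?N - r0 mod ?N)) mod ?N)" for s r
  have w: "first_return n (w s r) y p d s r" for s r
  proof -
    have "s mod 2 = (s0 + (s + s0) mod 2) mod 2" by presburger
    moreover have "[r = r0 + (r + (?N - r0 mod ?N)) mod ?N] (mod ?N)"
    proof -
      have "(r0 + (r + (?N - r0 mod ?N)) mod ?N) mod ?N = (r0 mod ?N + (r + (?N - r0 mod ?N))) mod ?N"
        by (metis mod_add_left_eq mod_add_right_eq)
      also have "r0 mod ?N + (r + (?N - r0 mod ?N)) = r + ?N"
        using mod_less_divisor[OF N, of r0] by simp
      finally show ?thesis by (simp add: cong_def)
    qed
    ultimately show ?thesis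
      unfolding w_def using first_return.reduce[OF first_return.twist_first_return[OF fr]] by blast
  qed
  have reindex: "(\<Sum>s<2. \<Sum>r<?N. F (x \<circ> twist n y p s r)) = (\<Sum>s<2. \<Sum>r<?N. F (w s r))" for F :: "_ \<Rightarrow> complex"
  proof -
    have inner: "(\<Sum>r<?N. F (x \<circ> twist n y p s ((r + c) mod ?N))) = (\<Sum>r<?N. F (x \<circ> twist n y p s r))" for s c
      by (rule sum_mod_shift[OF N, of "\<lambda>r. F (x \<circ> twist n y p s r)"])
    show ?thesis
      unfolding w_def inner
      by (rule sum_mod_shift[of 2 "\<lambda>s. \<Sum>r<?N. F (x \<circ> twist n y p s r)" s0, symmetric]) simp
  qed
  have two: "(\<Sum>s<2::nat. f s) = f 0 + f 1" for f :: "nat \<Rightarrow> complex"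
    by (simp add: numeral_2_eq_2)
  show ?thesis
  proof (cases "- p \<in> orbit y p")
    case False
    let ?K = "k div d"
    \<comment> \<open>If \<open>d\<close> divides \<open>k\<close>, \<open>\<sigma>\<close> is odd
      and \<open>?K\<close> is even and invertible, the root side contributes 1 at
      \<open>s = 0\<close> and, because \<open>?N\<close> is odd, -1 at \<open>s = 1\<close>; the
      character side contributes nothing.\<close>
    have odd: "odd ?N" if "coprime ?K ?N" "even ?K"
      using that by (metis coprime_common_divisor_nat dvd_refl numeral_eq_one_iff semiring_norm(85) coprime_common_divisor odd_one)
    show ?thesis
      unfolding reindex[of "\<lambda>z. phiX k \<sigma> y z p"] reindex[of "\<lambda>z. phiH k \<sigma> y z p"] two sum_phiX_plus[OF w y False] sum_phiH_plus[OF w y False]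
      using odd by (cases "d dvd k \<and> coprime ?K ?N"; cases "even ?K"; cases "even \<sigma>") auto
  next
    case True
    obtain m where m: "?N = 2 * m" "(y ^^ m) p = - p" using half_period[OF y p True] .
    have m0: "m > 0" using m N by simp
    have "(\<Sum>r<?N. phiX k \<sigma> y (w s r) p) = (\<Sum>r<?N. phiH k \<sigma> y (w s r) p)" for s
    proof -
      \<comment> \<open>Shifting \<open>r\<close> by \<open>m * s\<close> multiplies the return by
        \<open>(-1)^s\<close> and thus removes the return sign.\<close>
      define w' where "w' r = w s ((r + m * s) mod ?N)" for r
      have "first_return_minus n (w' r) y p d r m" for r
      proof -
        interpret fr: first_return n "w' r" y p d s "(r + m * s) mod ?N" unfolding w'_def by (rule w)
        have ms: "(y ^^ (m * s)) p = (- 1) ^ s * p"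
        proof (induction s)
          case (Suc s)
          then show ?case by (simp add: funpow_add m(2) B_sign[OF B_funpow[OF y] sign_power_mem])
        qed simp
        have "(y ^^ ((r + m * s) mod ?N)) p = (y ^^ (r + m * s)) p"
          by (simp add: funpow_eq_iff_cong[OF y])
        also have "\<dots> = (- 1) ^ s * (y ^^ r) p"
          by (simp add: funpow_add ms B_sign[OF B_funpow[OF y] sign_power_mem])
        finally have "(w' r ^^ d) p = (y ^^ r) p"
          using fr.ret by (simp flip: power_add mult.assoc)
        then show ?thesis
          using fr.d fr.p fr.not_before m by unfold_locales auto
      qed
      from sum_phi_minus[of m n w' y p d k \<sigma>, OF this m0]
      have "(\<Sum>r<?N. phiX k \<sigma> y (w' r) p) = (\<Sum>r<?N. phiH k \<sigma> y (w' r) p)" by (simp add: m(1))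
      then show ?thesis
        unfolding w'_def using sum_mod_shift[OF N, of "\<lambda>r. phiX k \<sigma> y (w s r) p" "m * s"]
          sum_mod_shift[OF N, of "\<lambda>r. phiH k \<sigma> y (w s r) p" "m * s"] by simp
    qed
    then show ?thesis unfolding reindex[of "\<lambda>z. phiX k \<sigma> y z p"] reindex[of "\<lambda>z. phiH k \<sigma> y z p"] by simp
  qed
qed

section \<open>Signs and products over orbits\<close>

definition neg_sign :: "nat \<Rightarrow> (int \<Rightarrow> int) \<Rightarrow> int" where
  "neg_sign n w = (- 1) ^ card {i \<in> {1..int n}. w i < 0}"

lemma neg_sign_eq_prod:
  assumes "w \<in> carrier (B_group n)"
  shows "neg_sign n w = (\<Prod>i\<in>{1..int n}. sgn (w i))"
proof -
  have "w i \<noteq> 0" if "i \<in> {1..int n}" for i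
    using B_mem_pm[OF assms, of i] that by (auto simp: pm_def)
  then have "(\<Prod>i\<in>{1..int n}. sgn (w i)) = (\<Prod>i\<in>{1..int n}. if w i < 0 then - 1 else 1)"
    by (intro prod.cong) (auto simp: sgn_if)
  also have "\<dots> = (\<Prod>i\<in>{i \<in> {1..int n}. w i < 0}. - 1)"
    by (rule prod.inter_filter[symmetric]) simp
  finally show ?thesis by (simp add: neg_sign_def)
qed

lemma B_sgn_abs: "w \<in> carrier (B_group n) \<Longrightarrow> sgn (w \<bar>v\<bar>) = sgn v * sgn (w v)" if "v \<noteq> 0" for v
  using that B_neg[of w n v] by (cases "v > 0") (auto simp: abs_if)

text \<open>Oddness of \<open>g\<close> splits the sign of \<open>g (h i)\<close> into those of
  \<open>h i\<close> and of \<open>g\<close> at the absolute value of \<open>h i\<close>; these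
  absolute values run over \<open>{1..int n}\<close> once more.\<close>

lemma neg_sign_comp:
  assumes g: "g \<in> carrier (B_group n)" and h: "h \<in> carrier (B_group n)"
  shows "neg_sign n (g \<circ> h) = neg_sign n g * neg_sign n h"
proof -
  let ?A = "{1..int n}"
  have mem: "i \<in> pm n" if "i \<in> ?A" for i using that by (auto simp: pm_def)
  have nz: "h i \<noteq> 0" if "i \<in> ?A" for i using B_mem_pm[OF h, of i] mem[OF that] by (auto simp: pm_def)
  have "inj_on (\<lambda>i. \<bar>h i\<bar>) ?A"
  proof (rule inj_onI)
    fix i j assume ij: "i \<in> ?A" "j \<in> ?A" "\<bar>h i\<bar> = \<bar>h j\<bar>"
    then have "h i = h j \<or> h i = h (- j)" by (auto simp: abs_if B_neg[OF h] split: if_splits)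
    then have "i = j \<or> i = - j" using B_bij[OF h] by (auto simp: bij_def inj_eq)
    then show "i = j" using ij by auto
  qed
  moreover have "(\<lambda>i. \<bar>h i\<bar>) ` ?A \<subseteq> ?A"
  proof
    fix v assume "v \<in> (\<lambda>i. \<bar>h i\<bar>) ` ?A"
    then obtain i where i: "i \<in> ?A" "v = \<bar>h i\<bar>" by blast
    then show "v \<in> ?A" using B_mem_pm[OF h, of i] mem[of i] by (auto simp: pm_def)
  qed
  ultimately have bij: "bij_betw (\<lambda>i. \<bar>h i\<bar>) ?A ?A" by (simp add: bij_betw_def endo_inj_surj)
  have "neg_sign n g * neg_sign n h = (\<Prod>i\<in>?A. sgn (g \<bar>h i\<bar>)) * (\<Prod>i\<in>?A. sgn (h i))"
    using prod.reindex_bij_betw[OF bij, of "\<lambda>i. sgn (g i)"] by (simp add: neg_sign_eq_prod g h)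
  also have "\<dots> = (\<Prod>i\<in>?A. sgn (g \<bar>h i\<bar>) * sgn (h i))" by (simp add: prod.distrib)
  also have "\<dots> = (\<Prod>i\<in>?A. sgn ((g \<circ> h) i))"
  proof (rule prod.cong[OF refl])
    fix i assume "i \<in> ?A"
    then have "sgn (g \<bar>h i\<bar>) * sgn (h i) = sgn (g (h i)) * (sgn (h i) * sgn (h i))"
      using B_sgn_abs[OF nz g] by simp
    moreover have "sgn (h i) * sgn (h i) = 1" using nz[OF \<open>i \<in> ?A\<close>] by (simp add: sgn_if)
    ultimately show "sgn (g \<bar>h i\<bar>) * sgn (h i) = sgn ((g \<circ> h) i)" by simp
  qed
  also have "\<dots> = neg_sign n (g \<circ> h)" by (simp add: neg_sign_eq_prod B_comp g h)
  finally show ?thesis by simp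
qed

lemma D_carrier: "carrier (D_group n) = {w \<in> carrier (B_group n). neg_sign n w = 1}"
  by (auto simp: D_group_def neg_sign_def minus_one_power_iff split: if_splits)

lemma D_subgroup: "subgroup (carrier (D_group n)) (B_group n)"
proof (rule group.subgroupI[OF B_group])
  have id: "neg_sign n id = 1"
    using neg_sign_comp[OF B_id B_id, of n] by (simp add: neg_sign_def)
  then show "carrier (D_group n) \<noteq> {}" by (auto simp: D_carrier intro!: exI[of _ id])
  fix a assume a: "a \<in> carrier (D_group n)"
  then have aB: "a \<in> carrier (B_group n)" by (simp add: D_carrier)
  have "neg_sign n (Hilbert_Choice.inv a \<circ> a) = 1" using B_bij[OF aB] id by (simp add: bij_is_inj)
  then show "inv\<^bsub>B_group n\<^esub> a \<in> carrier (D_group n)"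
    using a neg_sign_comp[OF B_inv_mem[OF aB] aB] by (simp add: D_carrier B_inv B_inv_mem)
  fix b assume "b \<in> carrier (D_group n)"
  then show "a \<otimes>\<^bsub>B_group n\<^esub> b \<in> carrier (D_group n)"
    using a by (simp add: D_carrier B_comp neg_sign_comp)
qed (auto simp: D_carrier)

lemma D_group_eq: "D_group n = (B_group n)\<lparr>carrier := carrier (D_group n)\<rparr>"
  by (simp add: D_group_def)

text \<open>On a signed cycle the signs \<open>sgn (x^i p) sgn (x^(i+1) p)\<close> telescope.\<close>

lemma prod_sgn_cyc_support:
  assumes x: "x \<in> carrier (B_group n)" and p: "p \<in> pm n"
  shows "(\<Prod>i\<in>{v \<in> cyc_support x p. v > 0}. sgn (x i)) = (if - p \<in> orbit x p then - 1 else 1)"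
proof -
  \<comment> \<open>Returns up to sign: the least one, \<open>l\<close>, is the length of the signed
    cycle in both classes, so the absolute values of the first \<open>l\<close> iterates list its
    positive points once each.\<close>
  define Q where "Q i \<longleftrightarrow> (x ^^ i) p = p \<or> (x ^^ i) p = - p" for i
  define l where "l = (LEAST l. 0 < l \<and> Q l)"
  have "0 < expo n \<and> Q (expo n)" using expo_pos funpow_expo[OF x] by (simp add: Q_def)
  then have l: "0 < l \<and> Q l" unfolding l_def by (rule LeastI)
  have Q: "Q i \<longleftrightarrow> l dvd i" for i
  proof (rule least_positive_dvd)
    show "\<not> Q i" if "0 < i" "i < l" for i using that not_less_Least unfolding l_def by blast
    show "Q (i + j) \<longleftrightarrow> Q j" if "Q i" for i j
    proof -
      have "(x ^^ (i + j)) p = (x ^^ j) ((x ^^ i) p)" by (simp add: funpow_add add.commute[of i])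
      then show ?thesis using that by (auto simp: Q_def B_neg[OF B_funpow[OF x]])
    qed
  qed (use l in auto)
  have nz: "(x ^^ i) p \<noteq> 0" for i
    using B_mem_pm[OF B_funpow[OF x], of i p] p by (auto simp: pm_def)
  have inj: "inj_on (\<lambda>i. \<bar>(x ^^ i) p\<bar>) {..<l}"
  proof -
    have *: "i = j" if "i \<le> j" "j < l" "\<bar>(x ^^ i) p\<bar> = \<bar>(x ^^ j) p\<bar>" for i j
    proof -
      have "(x ^^ j) p = (x ^^ i) ((x ^^ (j - i)) p)"
        using that(1) by (metis add_diff_inverse_nat comp_apply funpow_add not_le)
      then have "(x ^^ i) ((x ^^ (j - i)) p) = (x ^^ i) p \<or> (x ^^ i) ((x ^^ (j - i)) p) = (x ^^ i) (- p)"
        using that(3) by (auto simp: abs_if B_neg[OF B_funpow[OF x]] split: if_splits)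
      then have "Q (j - i)"
        unfolding Q_def using inj_eq[OF bij_is_inj[OF B_bij[OF B_funpow[OF x, of i]]]] by simp
      then show ?thesis using Q that by (auto dest: dvd_imp_le)
    qed
    show ?thesis
    proof (rule inj_onI)
      fix i j assume "i \<in> {..<l}" "j \<in> {..<l}" "\<bar>(x ^^ i) p\<bar> = \<bar>(x ^^ j) p\<bar>"
      then show "i = j" using *[of i j] *[of j i] by (cases "i \<le> j") auto
    qed
  qed
  have img: "{v \<in> cyc_support x p. v > 0} = (\<lambda>i. \<bar>(x ^^ i) p\<bar>) ` {..<l}"
  proof (intro equalityI subsetI)
    fix v assume v: "v \<in> {v \<in> cyc_support x p. v > 0}"
    then have "v \<in> cyc_support x p" by simp
    then obtain e i where e: "e \<in> {1,-1}" "v = e * (x ^^ i) p" by (rule mem_cyc_supportE[OF x])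
    have "(x ^^ i) p = (x ^^ (i mod l)) ((x ^^ (l * (i div l))) p)"
      by (metis comp_apply funpow_add mod_mult_div_eq)
    moreover have "Q (l * (i div l))" by (simp add: Q)
    ultimately have "\<bar>(x ^^ i) p\<bar> = \<bar>(x ^^ (i mod l)) p\<bar>" by (auto simp: Q_def B_neg[OF B_funpow[OF x]])
    moreover have "v = \<bar>(x ^^ i) p\<bar>" using v e by auto
    ultimately show "v \<in> (\<lambda>i. \<bar>(x ^^ i) p\<bar>) ` {..<l}" using l by auto
  next
    fix v assume "v \<in> (\<lambda>i. \<bar>(x ^^ i) p\<bar>) ` {..<l}"
    then obtain i where i: "v = \<bar>(x ^^ i) p\<bar>" by blast
    have "v = 1 * (x ^^ i) p \<or> v = - 1 * (x ^^ i) p" using i by (auto simp: abs_if)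
    then have "v \<in> cyc_support x p" using cyc_supportI[OF x, of 1 i p] cyc_supportI[OF x, of "- 1" i p] by auto
    then show "v \<in> {v \<in> cyc_support x p. v > 0}" using i nz by simp
  qed
  have tele: "(\<Prod>i<j. sgn ((x ^^ i) p) * sgn ((x ^^ Suc i) p)) = sgn p * sgn ((x ^^ j) p)" for j
  proof (induction j)
    case 0
    show ?case using nz[of 0] by (simp add: sgn_if)
  next
    case (Suc j)
    have "sgn ((x ^^ j) p) * sgn ((x ^^ j) p) = 1" using nz[of j] by (simp add: sgn_if)
    moreover have "(\<Prod>i<Suc j. sgn ((x ^^ i) p) * sgn ((x ^^ Suc i) p)) =
        sgn p * (sgn ((x ^^ j) p) * sgn ((x ^^ j) p)) * sgn ((x ^^ Suc j) p)"
      by (simp only: prod.lessThan_Suc Suc.IH mult_ac)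
    ultimately show ?case by simp
  qed
  have "(\<Prod>i\<in>{v \<in> cyc_support x p. v > 0}. sgn (x i)) = (\<Prod>i<l. sgn (x \<bar>(x ^^ i) p\<bar>))"
    unfolding img by (simp add: prod.reindex[OF inj])
  also have "\<dots> = (\<Prod>i<l. sgn ((x ^^ i) p) * sgn ((x ^^ Suc i) p))"
    by (simp add: B_sgn_abs[OF nz x])
  also have "\<dots> = sgn p * sgn ((x ^^ l) p)" by (rule tele)
  also have "\<dots> = (if (x ^^ l) p = - p then - 1 else 1)"
    using l nz[of 0] by (auto simp: Q_def sgn_if)
  \<comment> \<open>If \<open>x^l\<close> fixed \<open>p\<close>, so would every power whose
    exponent is a multiple of \<open>l\<close>, in particular any power sending \<open>p\<close> to
    \<open>- p\<close>.\<close>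
  also have "(x ^^ l) p = - p \<longleftrightarrow> - p \<in> orbit x p"
  proof
    assume "- p \<in> orbit x p"
    then obtain i where i: "(x ^^ i) p = - p" using mem_orbit_iff[OF x, of "- p" p] by metis
    then have "l dvd i" using Q[of i] unfolding Q_def by blast
    then have "(x ^^ l) p = p \<Longrightarrow> (x ^^ i) p = p"
      using funpow_eq_iff_dvd[OF x] dvd_trans by metis
    then show "(x ^^ l) p = - p" using l i pm_nonzero[OF p] by (auto simp: Q_def)
  qed (use mem_orbit_iff[OF x] in metis)
  finally show ?thesis .
qed

text \<open>The positive points split among the signed cycles, and each cycle contributes its
  telescoped sign. Membership in \<open>D_n\<close> thus means an even number of cycles of class
  -1.\<close>

lemma neg_sign_eq_prod_classes:
  assumes x: "x \<in> carrier (B_group n)" and P: "P \<subseteq> pm n" "\<And>v. v \<in> pm n \<Longrightarrow> \<exists>!p. p \<in> P \<and> p \<in> cyc_support x v"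
  shows "neg_sign n x = (\<Prod>p\<in>P. if - p \<in> orbit x p then - 1 else 1)"
proof -
  have finP: "finite P" using P(1) finite_subset[OF _ finite_pm] by blast
  let ?S = "\<lambda>p. {v \<in> cyc_support x p. v > 0}"
  have fin: "finite (?S p)" if "p \<in> P" for p
    using cyc_support_subset_pm[OF x, of p] P(1) that by (intro finite_subset[OF _ finite_pm]) auto
  have disj: "?S p \<inter> ?S q = {}" if "p \<in> P" "q \<in> P" "p \<noteq> q" for p q
  proof (rule ccontr)
    assume "?S p \<inter> ?S q \<noteq> {}"
    then have "q \<in> cyc_support x p" using cyc_support_eq[OF x] cyc_support_refl[OF x] by blast
    moreover have "p \<in> pm n" using P(1) that by blast
    ultimately show False using P(2)[of p] that cyc_support_refl[OF x] by blast
  qed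
  have "{1..int n} = (\<Union>p\<in>P. ?S p)"
  proof (intro equalityI subsetI)
    fix v assume v: "v \<in> {1..int n}"
    then have "v \<in> pm n" by (auto simp: pm_def)
    then obtain p where "p \<in> P" "p \<in> cyc_support x v" using P(2) by blast
    then show "v \<in> (\<Union>p\<in>P. ?S p)" using cyc_support_sym[OF x] v by force
  next
    fix v assume "v \<in> (\<Union>p\<in>P. ?S p)"
    then have "v \<in> pm n" "v > 0" using cyc_support_subset_pm[OF x] P(1) by blast+
    then show "v \<in> {1..int n}" by (auto simp: pm_def)
  qed
  then have "neg_sign n x = (\<Prod>p\<in>P. \<Prod>i\<in>?S p. sgn (x i))"
    unfolding neg_sign_eq_prod[OF x] using prod.UNION_disjoint[OF finP, of ?S] fin disj by simp
  also have "\<dots> = (\<Prod>p\<in>P. if - p \<in> orbit x p then - 1 else 1)"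
    using P(1) by (intro prod.cong refl prod_sgn_cyc_support[OF x]) auto
  finally show ?thesis .
qed

text \<open>The parameter \<open>\<sigma>\<close> treats both sums of characters at once: 0 gives
  the identity and 1 gives \<open>w0 n\<close>.\<close>

definition central :: "nat \<Rightarrow> nat \<Rightarrow> int \<Rightarrow> int" where
  "central n \<sigma> v = (if v \<in> pm n then (- 1) ^ \<sigma> * v else v)"

section \<open>From local factors back to conditions on whole elements\<close>

lemma prod_if_const:
  assumes "finite A"
  shows "(\<Prod>p\<in>A. if Q p then f p else 0) = (if \<forall>p\<in>A. Q p then \<Prod>p\<in>A. f p else (0 :: complex))"
  using assms by (induction A) auto

text \<open>The points where \<open>f\<close> and \<open>c\<close> agree form a set invariant under
  \<open><x, y, -1>\<close>. Hence an equation such as \<open>x ^^ k = y\<close> is a conjunction of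
  conditions, one at each representative.\<close>

lemma (in commuting_pair) eq_of_eq_on_reps:
  assumes c: "c \<in> carrier (B_group n)" "c \<circ> x = x \<circ> c" "c \<circ> y = y \<circ> c"
    and f: "f \<in> carrier (B_group n)" "f \<circ> x = x \<circ> f" "f \<circ> y = y \<circ> f"
    and eq: "\<And>p. p \<in> reps n x y \<Longrightarrow> f p = c p"
  shows "f = c"
proof
  fix v
  show "f v = c v"
  proof (cases "v \<in> pm n")
    case True
    then obtain p where p: "p \<in> reps n x y" "p \<in> blk x y v" using reps_transversal by blast
    then have "v \<in> blk x y p" using blk_sym by blast
    moreover have "blk x y p \<subseteq> {v. f v = c v}"
      by (rule blk_least) (use c f eq[OF p(1)] in \<open>auto simp: fun_eq_iff B_neg\<close>)
    ultimately show ?thesis by blast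
  qed (simp add: B_fixes[OF f(1)] B_fixes[OF c(1)])
qed

lemma central_mem: "central n \<sigma> \<in> carrier (B_group n)"
proof -
  have "central n \<sigma> = piecewise n id (\<lambda>_. (- 1) ^ \<sigma>) (\<lambda>_. 0)"
    by (auto simp: central_def piecewise_def)
  then show ?thesis using piecewise_mem_B[OF B_id, of n "\<lambda>_. (- 1) ^ \<sigma>" "\<lambda>_. 0"] sign_power_mem by simp
qed

lemma central_commute:
  assumes "x \<in> carrier (B_group n)"
  shows "central n \<sigma> \<circ> x = x \<circ> central n \<sigma>"
  by (rule ext) (simp add: central_def B_mem_pm[OF assms] B_sign[OF assms sign_power_mem] del: insert_iff)

lemma (in commuting_pair) funpow_x_commute:
  "x ^^ k \<circ> x = x \<circ> x ^^ k" "x ^^ k \<circ> y = y \<circ> x ^^ k"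
  using funpow_commute[OF xy, of k 1] by (simp_all add: fun_eq_iff funpow_swap1)

lemma (in commuting_pair) prod_phiX:
  "(\<Prod>p\<in>reps n x y. phiX k \<sigma> y x p) = (if x ^^ k = central n \<sigma> then \<Prod>p\<in>reps n x y. wt x y p else 0)"
proof -
  have "(\<forall>p\<in>reps n x y. (x ^^ k) p = (- 1) ^ \<sigma> * p) \<longleftrightarrow> x ^^ k = central n \<sigma>"
  proof
    assume "\<forall>p\<in>reps n x y. (x ^^ k) p = (- 1) ^ \<sigma> * p"
    then have "(x ^^ k) p = central n \<sigma> p" if "p \<in> reps n x y" for p
      using that by (simp add: central_def reps_def)
    then show "x ^^ k = central n \<sigma>"
      by (rule eq_of_eq_on_reps[OF central_mem central_commute[OF x] central_commute[OF y] B_funpow[OF x] funpow_x_commute])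
  qed (auto simp: central_def reps_def)
  then show ?thesis unfolding phiX_def by (simp add: prod_if_const)
qed

lemma (in commuting_pair) prod_phiH:
  "(\<Prod>p\<in>reps n x y. phiH k \<sigma> y x p) =
     (if x ^^ k = y then (if odd \<sigma> then of_int (neg_sign n x) else 1) else 0)"
proof -
  have iff: "(\<forall>p\<in>reps n x y. (x ^^ k) p = y p) \<longleftrightarrow> x ^^ k = y"
  proof
    assume "\<forall>p\<in>reps n x y. (x ^^ k) p = y p"
    then show "x ^^ k = y"
      by (intro eq_of_eq_on_reps[OF y xy[symmetric] refl B_funpow[OF x] funpow_x_commute]) simp
  qed auto
  show ?thesis
  proof (cases "x ^^ k = y")
    case False
    then show ?thesis unfolding phiH_def by (simp add: prod_if_const iff)
  next
    case True
    \<comment> \<open>Once \<open>y\<close> is a power of \<open>x\<close>, the orbits are the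
      signed \<open>x\<close>-cycles, so the local factors multiply to the sign of
      \<open>x\<close>.\<close>
    have "blk x y v = cyc_support x v" for v
    proof
      have "y w \<in> cyc_support x v" if "w \<in> cyc_support x v" for w
        using cyc_supportI[OF x, of 1 k w] cyc_support_trans[OF x that] True by simp
      then show "blk x y v \<subseteq> cyc_support x v"
        by (intro blk_least) (auto simp: cyc_support_refl[OF x] cyc_support_invariant[OF x])
    qed (rule cyc_support_subset_blk(1))
    then have "neg_sign n x = (\<Prod>p\<in>reps n x y. if - p \<in> orbit x p then - 1 else 1)"
      using reps_transversal by (intro neg_sign_eq_prod_classes[OF x]) (auto simp: reps_def)
    then have "of_int (neg_sign n x) = (\<Prod>p\<in>reps n x y. if - p \<in> orbit x p then - 1 else (1 :: complex))"
      by (simp add: of_int_prod if_distrib[of of_int] cong: if_cong)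
    then show ?thesis using True by (simp add: phiH_def)
  qed
qed

text \<open>A \<open>k\<close>-th root of \<open>y\<close> commutes with \<open>y\<close>, so the
  centralizer of \<open>y\<close> contains all of them and can serve as the common index set for the
  exchange of local factors.\<close>

lemma sum_wt_eq_sum_roots:
  assumes y: "y \<in> carrier (B_group n)"
  shows "(\<Sum>x | x \<in> centralizer (B_group n) y \<and> x ^^ k = central n \<sigma>. \<Prod>p\<in>reps n x y. wt x y p) =
    (\<Sum>h | h \<in> carrier (B_group n) \<and> h ^^ k = y. if odd \<sigma> then of_int (neg_sign n h) else 1)"
proof -
  let ?Z = "centralizer (B_group n) y"
  have finZ: "finite ?Z" using finite_B by (simp add: centralizer_def)
  have pr: "commuting_pair n x y" if "x \<in> ?Z" for x
    using that y by unfold_locales (auto simp: mem_centralizer)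
  have orb: "- p \<in> orbit x' p \<longleftrightarrow> - p \<in> orbit x p" if "x \<in> carrier (B_group n)" "x' \<in> carrier (B_group n)"
    "\<And>i. (x' ^^ i) p = (x ^^ i) p" for x x' p
    using that by (simp add: mem_orbit_iff)
  have "(\<Sum>x\<in>?Z. \<Prod>p\<in>reps n x y. phiX k \<sigma> y x p) = (\<Sum>x\<in>?Z. \<Prod>p\<in>reps n x y. phiH k \<sigma> y x p)"
  proof (rule sum_prod_reps_exchange[OF y _ _ local_averages_eq[OF _ y]])
    fix x x' p
    assume B: "x \<in> carrier (B_group n)" "x' \<in> carrier (B_group n)" and eq: "\<And>i. (x' ^^ i) p = (x ^^ i) p"
    show "phiX k \<sigma> y x' p = phiX k \<sigma> y x p"
      unfolding phiX_def eq wt_cong[OF B eq] ..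
    show "phiH k \<sigma> y x' p = phiH k \<sigma> y x p"
      unfolding phiH_def eq orb[OF B eq] ..
  qed
  moreover have "(\<Sum>x\<in>?Z. \<Prod>p\<in>reps n x y. phiX k \<sigma> y x p) =
      (\<Sum>x | x \<in> ?Z \<and> x ^^ k = central n \<sigma>. \<Prod>p\<in>reps n x y. wt x y p)"
    unfolding sum.inter_filter[OF finZ] by (rule sum.cong[OF refl]) (rule commuting_pair.prod_phiX[OF pr])
  moreover have "(\<Sum>x\<in>?Z. \<Prod>p\<in>reps n x y. phiH k \<sigma> y x p) =
      (\<Sum>x | x \<in> ?Z \<and> x ^^ k = y. if odd \<sigma> then of_int (neg_sign n x) else 1)"
    unfolding sum.inter_filter[OF finZ] by (rule sum.cong[OF refl]) (rule commuting_pair.prod_phiH[OF pr])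
  moreover have "x \<circ> y = y \<circ> x" if "x ^^ k = y" for x
    unfolding that[symmetric] by (rule ext) (simp add: funpow_swap1)
  then have "{x. x \<in> ?Z \<and> x ^^ k = y} = {h. h \<in> carrier (B_group n) \<and> h ^^ k = y}"
    by (auto simp: mem_centralizer)
  ultimately show ?thesis by simp
qed

section \<open>Sums of higher Lie characters\<close>

lemma conj_class_B:
  assumes "x \<in> carrier (B_group n)"
  shows "conj_class (B_group n) x = (\<lambda>g. g \<circ> x \<circ> Hilbert_Choice.inv g) ` carrier (B_group n)"
  unfolding conj_class_def by (rule image_cong) (auto simp: B_inv)

lemma conj_class_memI:
  assumes x: "x \<in> carrier (B_group n)" and g: "g \<in> carrier (B_group n)" "g \<circ> x = x' \<circ> g"
  shows "x' \<in> conj_class (B_group n) x"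
proof -
  have "x' = g \<circ> x \<circ> Hilbert_Choice.inv g"
    using g(2) B_bij[OF g(1)] by (metis bij_is_surj comp_assoc comp_id surj_iff)
  then show ?thesis using g(1) by (auto simp: conj_class_B[OF x])
qed

lemma conj_class_memE:
  assumes "x' \<in> conj_class (B_group n) x" "x \<in> carrier (B_group n)"
  obtains g where "g \<in> carrier (B_group n)" "g \<circ> x = x' \<circ> g" "x' \<in> carrier (B_group n)"
proof -
  obtain g where g: "g \<in> carrier (B_group n)" "x' = g \<circ> x \<circ> Hilbert_Choice.inv g"
    using assms by (auto simp: conj_class_B)
  have "x' \<circ> g = g \<circ> x"
    using B_bij[OF g(1)] unfolding g(2) by (metis bij_is_inj comp_assoc comp_id inv_o_cancel)
  then show ?thesis using that[OF g(1)] g assms(2) by (simp add: B_comp B_inv_mem)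
qed

lemma conj_class_eq:
  assumes x: "x \<in> carrier (B_group n)" and x': "x' \<in> conj_class (B_group n) x"
  shows "conj_class (B_group n) x' = conj_class (B_group n) x"
proof -
  obtain g where g: "g \<in> carrier (B_group n)" "g \<circ> x = x' \<circ> g" and x'B: "x' \<in> carrier (B_group n)"
    using x' x by (rule conj_class_memE)
  have sub: "conj_class (B_group n) a \<subseteq> conj_class (B_group n) b"
    if a: "a \<in> carrier (B_group n)" and b: "b \<in> carrier (B_group n)"
      and h: "h \<in> carrier (B_group n)" "h \<circ> b = a \<circ> h" for a b h
  proof
    fix c assume "c \<in> conj_class (B_group n) a"
    then obtain u where u: "u \<in> carrier (B_group n)" "u \<circ> a = c \<circ> u" using a by (rule conj_class_memE)
    have "(u \<circ> h) \<circ> b = c \<circ> (u \<circ> h)" using h u by (metis comp_assoc)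
    then show "c \<in> conj_class (B_group n) b" by (rule conj_class_memI[OF b B_comp[OF u(1) h(1)]])
  qed
  have "Hilbert_Choice.inv g \<circ> x' = x \<circ> Hilbert_Choice.inv g"
    using g(2) B_bij[OF g(1)] by (metis bij_is_inj bij_is_surj comp_assoc comp_id id_comp inv_o_cancel surj_iff)
  then show ?thesis
    using sub[OF x'B x g] sub[OF x x'B B_inv_mem[OF g(1)]] by blast
qed

lemma conj_funpow:
  assumes "g \<circ> x = x' \<circ> g"
  shows "g ((x ^^ i) v) = (x' ^^ i) (g v)"
  by (induction i) (use assms in \<open>auto simp: fun_eq_iff\<close>)

text \<open>The map \<open>g \<mapsto> g x g^(-1)\<close> sends the relevant \<open>g\<close> onto
  the members of the class that commute with \<open>y\<close>. Its fibres are left cosets of the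
  centralizer of \<open>x\<close>, whose size cancels the denominator, and \<open>\<omega>\<close>
  at the conjugate of \<open>y\<close> is a product of transported weights.\<close>

lemma (in normalized_omega) induced_character_eq:
  assumes y: "y \<in> carrier (B_group n)"
  shows "induced_character (B_group n) (centralizer (B_group n) x) \<omega> y =
    (\<Sum>x' | x' \<in> conj_class (B_group n) x \<and> x' \<in> centralizer (B_group n) y. \<Prod>p\<in>reps n x' y. wt x' y p)"
proof -
  let ?B = "carrier (B_group n)" and ?Z = "centralizer (B_group n) x"
  let ?inv = Hilbert_Choice.inv
  define c where "c g = g \<circ> x \<circ> ?inv g" for g :: "int \<Rightarrow> int"
  define A where "A = {g \<in> ?B. ?inv g \<circ> y \<circ> g \<in> ?Z}"
  define W where "W x' = (\<Prod>p\<in>reps n x' y. wt x' y p)" for x'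
  have gg: "g (?inv g v) = v" "?inv g (g v) = v" if "g \<in> ?B" for g v
    using B_bij[OF that] by (simp_all add: bij_is_surj surj_f_inv_f bij_is_inj)
  have cB: "c g \<in> ?B" if "g \<in> ?B" for g
    using that xB by (simp add: c_def B_comp B_inv_mem)
  have cg: "g \<circ> x = c g \<circ> g" if "g \<in> ?B" for g by (rule ext) (simp add: c_def gg[OF that])
  have Z_iff: "?inv g \<circ> y \<circ> g \<in> ?Z \<longleftrightarrow> c g \<in> centralizer (B_group n) y" if g: "g \<in> ?B" for g
  proof -
    have "(?inv g \<circ> y \<circ> g) \<circ> x = x \<circ> (?inv g \<circ> y \<circ> g) \<longleftrightarrow> c g \<circ> y = y \<circ> c g"
    proof
      assume *: "(?inv g \<circ> y \<circ> g) \<circ> x = x \<circ> (?inv g \<circ> y \<circ> g)"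
      show "c g \<circ> y = y \<circ> c g"
      proof
        fix v
        have "?inv g (y (g (x (?inv g v)))) = x (?inv g (y (g (?inv g v))))" using * by (metis comp_apply)
        then have "g (?inv g (y (g (x (?inv g v))))) = g (x (?inv g (y (g (?inv g v)))))" by simp
        then show "(c g \<circ> y) v = (y \<circ> c g) v" by (simp add: c_def gg[OF g])
      qed
    next
      assume *: "c g \<circ> y = y \<circ> c g"
      show "(?inv g \<circ> y \<circ> g) \<circ> x = x \<circ> (?inv g \<circ> y \<circ> g)"
      proof
        fix v
        have "c g (y (g v)) = y (c g (g v))" using * by (metis comp_apply)
        then have "?inv g (c g (y (g v))) = ?inv g (y (c g (g v)))" by simp
        then show "((?inv g \<circ> y \<circ> g) \<circ> x) v = (x \<circ> (?inv g \<circ> y \<circ> g)) v" by (simp add: c_def gg[OF g])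
      qed
    qed
    then show ?thesis using g y cB by (simp add: mem_centralizer B_comp B_inv_mem)
  qed
  have val: "\<omega> (?inv g \<circ> y \<circ> g) = W (c g)" if "g \<in> A" for g
  proof -
    have g: "g \<in> ?B" and yg: "?inv g \<circ> y \<circ> g \<in> ?Z" using that by (auto simp: A_def)
    interpret pr: commuting_pair n "c g" y
      using cB[OF g] y yg Z_iff[OF g] by unfold_locales (auto simp: mem_centralizer)
    let ?y = "?inv g \<circ> y \<circ> g" and ?h = "?inv g"
    have hB: "?h \<in> ?B" by (rule B_inv_mem[OF g])
    have gy: "g \<circ> ?y = y \<circ> g" by (rule ext) (simp add: gg[OF g])
    have blk: "q \<in> blk x ?y v \<longleftrightarrow> g q \<in> blk (c g) y (g v)" for q v
    proof -
      have "q = e * (x ^^ i) ((?y ^^ j) v) \<longleftrightarrow> g q = e * (c g ^^ i) ((y ^^ j) (g v))" if "e \<in> {1,-1}" for e i j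
        unfolding conj_funpow[OF gy, symmetric] conj_funpow[OF cg[OF g], symmetric] B_sign[OF g that, symmetric]
        using gg(2)[OF g] by metis
      then show ?thesis unfolding blk_def mem_Collect_eq by blast
    qed
    \<comment> \<open>The representatives for the pair \<open>(c g, y)\<close>, pulled back along
      \<open>g\<close>, need not be the maxima of their orbits; so the product formula is applied to
      this arbitrary transversal.\<close>
    have "\<omega> ?y = (\<Prod>q\<in>?h ` reps n (c g) y. wt x ?y q)"
    proof (rule omega_eq_prod_wt[OF yg])
      show "?h ` reps n (c g) y \<subseteq> pm n" by (auto simp: reps_def B_mem_pm[OF hB])
      fix v assume "v \<in> pm n"
      then have "\<exists>!p. p \<in> reps n (c g) y \<and> p \<in> blk (c g) y (g v)"
        using pr.reps_transversal by (simp add: B_mem_pm[OF g])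
      then show "\<exists>!q. q \<in> ?h ` reps n (c g) y \<and> q \<in> blk x ?y v"
        unfolding blk using gg[OF g] by (smt (verit) imageE imageI)
    qed
    also have "\<dots> = (\<Prod>p\<in>reps n (c g) y. wt x ?y (?h p))"
      by (simp add: prod.reindex[OF inj_on_subset[OF bij_is_inj[OF B_bij[OF hB]] subset_UNIV]])
    also have "\<dots> = W (c g)"
      unfolding W_def
    proof (rule prod.cong[OF refl])
      fix p
      show "wt x ?y (?h p) = wt (c g) y p"
        using wt_transport[OF xB cB[OF g] g, where p = "?h p" and y = ?y and y' = y]
          conj_funpow[OF gy] conj_funpow[OF cg[OF g]] gg[OF g] by metis
    qed
    finally show ?thesis .
  qed
  have fiber: "card {g \<in> A. c g = x'} = card ?Z" if x': "x' \<in> c ` A" for x'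
  proof -
    obtain g0 where g0: "g0 \<in> A" "x' = c g0" using x' by blast
    then have g0B: "g0 \<in> ?B" by (simp add: A_def)
    have "bij_betw (\<lambda>z. g0 \<circ> z) ?Z {g \<in> A. c g = x'}"
    proof (rule bij_betw_byWitness[where f' = "\<lambda>g. ?inv g0 \<circ> g"])
      show "(\<lambda>z. g0 \<circ> z) ` ?Z \<subseteq> {g \<in> A. c g = x'}"
      proof
        fix g assume "g \<in> (\<lambda>z. g0 \<circ> z) ` ?Z"
        then obtain z where z: "z \<in> ?Z" "g = g0 \<circ> z" by blast
        have gB: "g \<in> ?B" using z g0B by (simp add: mem_centralizer B_comp)
        have "c g \<circ> g = g0 \<circ> z \<circ> x" using cg[OF gB] z by simp
        also have "\<dots> = (g0 \<circ> x) \<circ> z" using z(1) by (auto simp: mem_centralizer comp_assoc)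
        also have "\<dots> = x' \<circ> g" using cg[OF g0B] z(2) g0(2) by (simp add: comp_assoc)
        finally have "c g (g v) = x' (g v)" for v by (metis comp_apply)
        then have "c g v = x' v" for v using gg(1)[OF gB, of v] by metis
        then have cgx: "c g = x'" by (rule ext)
        then have "g \<in> A" using g0 gB Z_iff[OF gB] Z_iff[OF g0B] by (simp add: A_def)
        then show "g \<in> {g \<in> A. c g = x'}" using cgx by simp
      qed
      show "(\<lambda>g. ?inv g0 \<circ> g) ` {g \<in> A. c g = x'} \<subseteq> ?Z"
      proof
        fix z assume "z \<in> (\<lambda>g. ?inv g0 \<circ> g) ` {g \<in> A. c g = x'}"
        then obtain g where g: "g \<in> A" "c g = x'" "z = ?inv g0 \<circ> g" by blast
        then have gB: "g \<in> ?B" by (simp add: A_def)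
        have "z (x v) = x (z v)" for v
        proof -
          have "g (x v) = x' (g v)" using cg[OF gB] g(2) by (metis comp_apply)
          also have "\<dots> = x' (g0 (?inv g0 (g v)))" by (simp add: gg[OF g0B])
          also have "\<dots> = g0 (x (?inv g0 (g v)))" using cg[OF g0B] g0(2) by (metis comp_apply)
          finally show ?thesis using g(3) by (simp add: gg[OF g0B])
        qed
        then show "z \<in> ?Z" using g(3) gB g0B by (auto simp: mem_centralizer B_comp B_inv_mem)
      qed
    qed (auto simp: fun_eq_iff gg[OF g0B])
    then show ?thesis by (rule bij_betw_same_card[symmetric])
  qed
  have finA: "finite A" using finite_B by (simp add: A_def)
  have img: "c ` A = {x'. x' \<in> conj_class (B_group n) x \<and> x' \<in> centralizer (B_group n) y}"
    using Z_iff by (auto simp: conj_class_B[OF xB] c_def A_def)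
  have "id \<in> ?Z" by (simp add: mem_centralizer)
  moreover have "finite ?Z" using finite_B by (simp add: centralizer_def)
  ultimately have cardZ: "card ?Z \<noteq> 0" by auto
  have "(\<Sum>g\<in>A. \<omega> (?inv g \<circ> y \<circ> g)) = (\<Sum>g\<in>A. W (c g))" using val by simp
  also have "\<dots> = (\<Sum>x'\<in>c ` A. \<Sum>g\<in>{g \<in> A. c g = x'}. W (c g))" by (rule sum.image_gen[OF finA])
  also have "\<dots> = (\<Sum>x'\<in>c ` A. of_nat (card ?Z) * W x')" using fiber by (intro sum.cong) auto
  also have "\<dots> = of_nat (card ?Z) * (\<Sum>x'\<in>c ` A. W x')" by (simp add: sum_distrib_left)
  finally have "(\<Sum>g\<in>A. \<omega> (?inv g \<circ> y \<circ> g)) = of_nat (card ?Z) * (\<Sum>x'\<in>c ` A. W x')" .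
  moreover have "induced_character (B_group n) ?Z \<omega> y = (\<Sum>g\<in>A. \<omega> (?inv g \<circ> y \<circ> g)) / of_nat (card ?Z)"
    unfolding induced_character_def A_def
    by (rule arg_cong2[of _ _ _ _ "(/)"], rule sum.cong) (auto simp: B_inv)
  ultimately show ?thesis using cardZ unfolding img W_def by simp
qed

text \<open>The right-hand side is free of choices. The normalizing change of representative keeps
  the class, the centralizer and \<open>\<omega>\<close> itself, so the induced character is
  literally the same.\<close>

lemma higher_Lie_character_eq:
  assumes C: "C \<in> conj_classes (B_group n)" and psi: "is_higher_Lie_character n C \<psi>"
    and y: "y \<in> carrier (B_group n)"
  shows "\<psi> y = (\<Sum>x | x \<in> C \<and> x \<in> centralizer (B_group n) y. \<Prod>p\<in>reps n x y. wt x y p)"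
proof -
  obtain x0 where x0: "x0 \<in> carrier (B_group n)" "C = conj_class (B_group n) x0"
    using C by (auto simp: conj_classes_def)
  obtain x \<omega> where x: "x \<in> C" "is_omega n x \<omega>"
    and psi_y: "\<psi> y = induced_character (B_group n) (centralizer (B_group n) x) \<omega> y"
    using psi y unfolding is_higher_Lie_character_def by metis
  have xB: "x \<in> carrier (B_group n)" using x(1) x0 by (auto elim: conj_class_memE)
  obtain x' g where x': "normalized_omega n x' \<omega>" "centralizer (B_group n) x' = centralizer (B_group n) x"
    "g \<in> carrier (B_group n)" "g \<circ> x = x' \<circ> g"
    using is_omega_normalize[OF xB x(2)] by metis
  have "conj_class (B_group n) x' = C"
    using conj_class_eq[OF xB conj_class_memI[OF xB x'(3,4)]] conj_class_eq[OF x0(1)] x(1) x0(2) by simp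
  then show ?thesis using normalized_omega.induced_character_eq[OF x'(1) y] psi_y x'(2) by simp
qed

text \<open>Reducing the exponent modulo the group order replaces all integer powers, negative ones
  included, by one nonnegative exponent common to the whole group.\<close>

lemma int_pow_B:
  assumes "h \<in> carrier (B_group n)"
  shows "h [^]\<^bsub>B_group n\<^esub> (k :: int) = h ^^ nat (k mod int (expo n))"
proof -
  interpret G: group "B_group n" by (rule B_group)
  have e: "h [^]\<^bsub>B_group n\<^esub> int (expo n) = \<one>\<^bsub>B_group n\<^esub>"
    by (simp add: int_pow_int B_pow funpow_expo[OF assms])
  have "k = int (expo n) * (k div int (expo n)) + int (nat (k mod int (expo n)))"
    using expo_pos[of n] by simp
  then have "h [^]\<^bsub>B_group n\<^esub> k = h [^]\<^bsub>B_group n\<^esub> (int (expo n) * (k div int (expo n))) \<otimes>\<^bsub>B_group n\<^esub>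
      h [^]\<^bsub>B_group n\<^esub> int (nat (k mod int (expo n)))"
    using G.int_pow_mult[OF assms] by metis
  also have "h [^]\<^bsub>B_group n\<^esub> (int (expo n) * (k div int (expo n))) = \<one>\<^bsub>B_group n\<^esub>"
    using G.int_pow_pow[OF assms, of "int (expo n)" "k div int (expo n)"] e G.int_pow_one[of "k div int (expo n)"] by simp
  finally show ?thesis by (simp only: int_pow_int B_pow B_simps id_comp)
qed

text \<open>\<open>central n \<sigma>\<close> commutes with every signed permutation, so one member
  of a class satisfies the power condition exactly when all do. The condition on classes becomes one
  on elements, and the classes partition these.\<close>

lemma sum_higher_Lie_characters:
  assumes psi: "\<And>C. C \<in> conj_classes (B_group n) \<Longrightarrow> is_higher_Lie_character n C (\<psi> C)"
    and y: "y \<in> carrier (B_group n)"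
  shows "(\<Sum>C | C \<in> conj_classes (B_group n) \<and> class_power (B_group n) C k = {central n \<sigma>}. \<psi> C y) =
    (\<Sum>x | x \<in> centralizer (B_group n) y \<and> x ^^ nat (k mod int (expo n)) = central n \<sigma>. \<Prod>p\<in>reps n x y. wt x y p)"
proof -
  define l where "l = nat (k mod int (expo n))"
  define I where "I = {C \<in> conj_classes (B_group n). class_power (B_group n) C k = {central n \<sigma>}}"
  let ?A = "\<lambda>C. {x. x \<in> C \<and> x \<in> centralizer (B_group n) y}"
  have cls: "conj_class (B_group n) x = C" "x \<in> carrier (B_group n)" if C: "C \<in> conj_classes (B_group n)" "x \<in> C" for C x
  proof -
    obtain x0 where x0: "x0 \<in> carrier (B_group n)" "C = conj_class (B_group n) x0"
      using C(1) by (auto simp: conj_classes_def)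
    then show "conj_class (B_group n) x = C" "x \<in> carrier (B_group n)"
      using C(2) conj_class_eq by (auto elim: conj_class_memE)
  qed
  have self: "x \<in> conj_class (B_group n) x" if "x \<in> carrier (B_group n)" for x
    by (rule conj_class_memI[OF that B_id]) simp
  have finI: "finite I" unfolding I_def conj_classes_def using finite_B by simp
  have finA: "finite (?A C)" for C using finite_B by (auto simp: centralizer_def intro: finite_subset)
  have disj: "?A C \<inter> ?A D = {}" if "C \<in> I" "D \<in> I" "C \<noteq> D" for C D
    using that cls(1) unfolding I_def by blast
  have "(\<Union>C\<in>I. ?A C) = {x. x \<in> centralizer (B_group n) y \<and> x ^^ l = central n \<sigma>}"
  proof (intro equalityI subsetI)
    fix x assume "x \<in> (\<Union>C\<in>I. ?A C)"
    then obtain C where C: "C \<in> conj_classes (B_group n)" "class_power (B_group n) C k = {central n \<sigma>}"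
      "x \<in> C" "x \<in> centralizer (B_group n) y" by (auto simp: I_def)
    then have "x [^]\<^bsub>B_group n\<^esub> k = central n \<sigma>" unfolding class_power_def by blast
    then show "x \<in> {x. x \<in> centralizer (B_group n) y \<and> x ^^ l = central n \<sigma>}"
      using C(4) by (simp add: int_pow_B mem_centralizer l_def)
  next
    fix x assume x: "x \<in> {x. x \<in> centralizer (B_group n) y \<and> x ^^ l = central n \<sigma>}"
    then have xB: "x \<in> carrier (B_group n)" by (simp add: mem_centralizer)
    let ?C = "conj_class (B_group n) x"
    have "x' [^]\<^bsub>B_group n\<^esub> k = central n \<sigma>" if "x' \<in> ?C" for x'
    proof -
      obtain g where g: "g \<in> carrier (B_group n)" "g \<circ> x = x' \<circ> g" and x'B: "x' \<in> carrier (B_group n)"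
        using \<open>x' \<in> ?C\<close> xB by (rule conj_class_memE)
      have "(x' ^^ l) (g v) = central n \<sigma> (g v)" for v
        using conj_funpow[OF g(2), of l v] central_commute[OF g(1), of \<sigma>] x by (metis (mono_tags, lifting) comp_apply mem_Collect_eq)
      then have "x' ^^ l = central n \<sigma>" using B_bij[OF g(1)] by (metis bij_pointE ext)
      then show ?thesis by (simp add: int_pow_B[OF x'B] l_def)
    qed
    then have "class_power (B_group n) ?C k = {central n \<sigma>}"
      using image_constant[OF self[OF xB], of "central n \<sigma>"] unfolding class_power_def by simp
    then have "?C \<in> I" using xB by (simp add: I_def conj_classes_def)
    then show "x \<in> (\<Union>C\<in>I. ?A C)" using self[OF xB] x by blast
  qed
  then have "(\<Sum>x | x \<in> centralizer (B_group n) y \<and> x ^^ l = central n \<sigma>. \<Prod>p\<in>reps n x y. wt x y p) =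
      (\<Sum>C\<in>I. \<Sum>x\<in>?A C. \<Prod>p\<in>reps n x y. wt x y p)"
    using sum.UNION_disjoint[OF finI, of ?A] finA disj by simp
  also have "\<dots> = (\<Sum>C\<in>I. \<psi> C y)"
    by (rule sum.cong[OF refl]) (use higher_Lie_character_eq[OF _ psi y] in \<open>auto simp: I_def\<close>)
  finally show ?thesis by (simp add: I_def l_def)
qed

text \<open>The summand is 2 on \<open>D_n\<close> and 0 off it. For \<open>y\<close> outside
  \<open>D_n\<close> nothing survives, because powers of elements of the subgroup stay in
  it.\<close>

lemma sum_roots_eq:
  assumes y: "y \<in> carrier (B_group n)"
  shows "(\<Sum>h | h \<in> carrier (B_group n) \<and> h ^^ nat (k mod int (expo n)) = y. 1 + of_int (neg_sign n h) :: complex) =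
    (if y \<in> carrier (D_group n) then 2 * of_nat (roots (D_group n) k y) else 0)"
proof -
  let ?S = "{h. h \<in> carrier (B_group n) \<and> h ^^ nat (k mod int (expo n)) = y}"
  let ?R = "{h \<in> ?S. neg_sign n h = 1}"
  have fin: "finite ?S" using finite_B by simp
  have "(\<Sum>h\<in>?S. 1 + of_int (neg_sign n h)) = (\<Sum>h\<in>?S. if neg_sign n h = 1 then 2 else (0 :: complex))"
    by (rule sum.cong[OF refl]) (auto simp: neg_sign_def minus_one_power_iff)
  also have "\<dots> = (\<Sum>h\<in>?R. 2)" by (rule sum.inter_filter[OF fin, symmetric])
  also have "\<dots> = 2 * of_nat (card ?R)" by simp
  finally have S: "(\<Sum>h\<in>?S. 1 + of_int (neg_sign n h) :: complex) = 2 * of_nat (card ?R)" .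
  have pow: "h [^]\<^bsub>D_group n\<^esub> k = h ^^ nat (k mod int (expo n))" if "h \<in> carrier (D_group n)" for h
  proof -
    have "h [^]\<^bsub>B_group n\<^esub> k = h [^]\<^bsub>D_group n\<^esub> k"
      using group.int_pow_consistent[OF B_group D_subgroup that, of k] by (simp only: D_group_eq[symmetric])
    then show ?thesis using int_pow_B[of h n k] that by (simp add: D_carrier)
  qed
  have R: "?R = {h \<in> carrier (D_group n). h [^]\<^bsub>D_group n\<^esub> k = y}"
    using pow by (auto simp: D_carrier)
  show ?thesis
  proof (cases "y \<in> carrier (D_group n)")
    case True
    then show ?thesis using S R by (simp add: roots_def)
  next
    case False
    have "h [^]\<^bsub>D_group n\<^esub> k \<in> carrier (D_group n)" if "h \<in> carrier (D_group n)" for h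
    proof -
      interpret D: group "D_group n"
        using group.subgroup_imp_group[OF B_group D_subgroup] by (simp add: D_group_eq[symmetric])
      show ?thesis using that by (rule D.int_pow_closed)
    qed
    then have RE: "?R = {}" using False unfolding R by blast
    show ?thesis using S False unfolding RE by simp
  qed
qed

theorem theorem1p6:
  fixes n :: nat and k :: int
    and \<psi> :: "(int \<Rightarrow> int) set \<Rightarrow> (int \<Rightarrow> int) \<Rightarrow> complex"
    and y :: "int \<Rightarrow> int"
  assumes "n \<ge> 1"
    and "\<And>C. C \<in> conj_classes (B_group n) \<Longrightarrow> is_higher_Lie_character n C (\<psi> C)"
    and "y \<in> carrier (B_group n)"
  shows "(\<Sum>C | C \<in> conj_classes (B_group n) \<and> class_power (B_group n) C k = {\<one>\<^bsub>B_group n\<^esub>}. \<psi> C y)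
       + (\<Sum>C | C \<in> conj_classes (B_group n) \<and> class_power (B_group n) C k = {w0 n}. \<psi> C y)
       = (if y \<in> carrier (D_group n) then 2 * of_nat (roots (D_group n) k y) else 0)"
proof -
  let ?l = "nat (k mod int (expo n))"
  have "central n 0 = \<one>\<^bsub>B_group n\<^esub>" "central n 1 = w0 n"
    by (auto simp: central_def w0_def perm_restrict_def)
  then show ?thesis
    using sum_higher_Lie_characters[OF assms(2,3), of k 0] sum_higher_Lie_characters[OF assms(2,3), of k 1]
      sum_wt_eq_sum_roots[OF assms(3), of ?l 0] sum_wt_eq_sum_roots[OF assms(3), of ?l 1]
      sum_roots_eq[OF assms(3), of k]
    by (simp add: sum.distrib)
qed

end
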